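(* Let $d\ge 1$, let $\Lambda=[\lambda_{i,j}]\in\mathbb{R}^{d\times d}$ be symmetric positive semi-definite, and let $B_t=[B_1(t),\dots,B_d(t)]$, $t\ge0$, be a $d$-variate Brownian motion with covariance matrix $\Lambda$ for the $d$-variate dimension. Let $F$ be a twice continuously differentiable real function on $\mathbb{R}^{d+1}$. Then, for $t\ge 0$, almost surely, $$\begin{aligned}F(t,B_1(t),\dots,B_d(t))={}&F(0,B_1(0),\dots,B_d(0))+\sum_{i=1}^d\int_0^t\frac{\partial F}{\partial B_i}(s,B_1(s),\dots,B_d(s))\,\mathrm{d}B_i(s)\\&+\int_0^t\left\{\frac{\partial F}{\partial s}(s,B_1(s),\dots,B_d(s))+\frac12\sum_{i,j=1}^d\frac{\partial^2F}{\partial B_i\partial B_j}(s,B_1(s),\dots,B_d(s))\,\lambda_{i,j}\right\}\mathrm{d}s.\end{aligned}$$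
   Context: A $d$-variate Brownian motion with parameter (covariance) matrix $\Lambda$ is a process $B=(B_t)_{t\ge0}$ with values in $\mathbb{R}^d$ (row vectors), all of whose sample paths are continuous, and which satisfies $B\sim\mathcal{MGP}_d(\boldsymbol{0},k,\Lambda)$ with $k(s,t)=\min(s,t)$. That is, for all $n\ge1$ and $t_1,\dots,t_n\ge0$, the $n\times d$ random matrix $Z=[B_{t_1}^{\mathsf{T}},\dots,B_{t_n}^{\mathsf{T}}]^{\mathsf{T}}$ has matrix Gaussian distribution $\mathcal{MN}(0,(\min(t_i,t_j))_{i,j=1}^n,\Lambda)$, meaning $\mathrm{vec}(Z)\sim\mathcal{N}_{nd}(0,\Lambda\otimes(\min(t_i,t_j))_{i,j=1}^n)$, where $\mathrm{vec}$ stacks columns and $\otimes$ is the Kronecker product (degenerate Gaussians allowed). The arguments of $F$ are named $(s,B_1,\dots,B_d)$: $\partial F/\partial s$ denotes the partial derivative in the first variable, and $\partial F/\partial B_i$ the partial derivative in the $(i+1)$-th variable. The integrals $\int_0^t\cdots\,\mathrm{d}B_i(s)$ are Itô stochastic integrals (with respect to the usual augmentation of the filtration generated by $B$). *)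

theory Defs
  imports "HOL-Probability.Probability"
begin

section \<open>Gaussian vectors and matrices\<close>

definition normal_law :: "real \<Rightarrow> real \<Rightarrow> real measure" where
  "normal_law m v =
     (if v > 0 then density lborel (normal_density m (sqrt v)) else return borel m)"

text \<open>A random vector, indexed by a finite set \<open>I\<close>, is \<open>N(\<mu>, \<Sigma>)\<close> if every linear combination
  of its components is a (possibly degenerate) univariate normal variable with the mean and
  variance prescribed by \<open>\<mu>\<close> and \<open>\<Sigma>\<close>; \<open>\<Sigma>\<close> may be singular.\<close>

definition multivariate_normal ::
  "'a measure \<Rightarrow> 'i set \<Rightarrow> ('i \<Rightarrow> 'a \<Rightarrow> real) \<Rightarrow> ('i \<Rightarrow> real) \<Rightarrow> ('i \<Rightarrow> 'i \<Rightarrow> real) \<Rightarrow> bool" where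
  "multivariate_normal M I X \<mu> \<Sigma> \<longleftrightarrow>
     finite I \<and> (\<forall>i\<in>I. X i \<in> borel_measurable M) \<and>
     (\<forall>a. distr M borel (\<lambda>\<omega>. \<Sum>i\<in>I. a i * X i \<omega>) =
            normal_law (\<Sum>i\<in>I. a i * \<mu> i) (\<Sum>i\<in>I. \<Sum>j\<in>I. a i * a j * \<Sigma> i j))"

text \<open>An \<open>n \<times> d\<close> matrix is given by its rows \<open>0, \<dots>, n - 1\<close> in \<^typ>\<open>real^'d\<close>. The entries of its
  vectorisation are indexed by (column, row); the lexicographic order on these pairs is the order
  in which the columns are stacked, so the index of a Kronecker product is split in the same way.\<close>

definition vec_rows :: "(nat \<Rightarrow> real^'d) \<Rightarrow> 'd \<times> nat \<Rightarrow> real" where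
  "vec_rows Z = (\<lambda>(j, i). Z i $ j)"

definition kronecker ::
  "('i \<Rightarrow> 'i \<Rightarrow> real) \<Rightarrow> ('k \<Rightarrow> 'k \<Rightarrow> real) \<Rightarrow> 'i \<times> 'k \<Rightarrow> 'i \<times> 'k \<Rightarrow> real" where
  "kronecker A C = (\<lambda>(i, k) (i', k'). A i i' * C k k')"

definition matrix_normal ::
  "'a measure \<Rightarrow> nat \<Rightarrow> (nat \<Rightarrow> 'a \<Rightarrow> real^'d) \<Rightarrow> (nat \<Rightarrow> real^'d) \<Rightarrow> (nat \<Rightarrow> nat \<Rightarrow> real)
     \<Rightarrow> real^'d^'d \<Rightarrow> bool" where
  "matrix_normal M n Z \<mu> K \<Lambda> \<longleftrightarrow>
     multivariate_normal M (UNIV \<times> {..<n}) (\<lambda>p \<omega>. vec_rows (\<lambda>i. Z i \<omega>) p) (vec_rows \<mu>)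
       (kronecker (\<lambda>i j. \<Lambda> $ i $ j) K)"


section \<open>Multivariate Brownian motion\<close>

definition positive_semidefinite :: "real^'d^'d \<Rightarrow> bool" where
  "positive_semidefinite \<Lambda> \<longleftrightarrow> transpose \<Lambda> = \<Lambda> \<and> (\<forall>x. 0 \<le> x \<bullet> (\<Lambda> *v x))"

definition multivariate_gaussian_process ::
  "'a measure \<Rightarrow> 't set \<Rightarrow> ('t \<Rightarrow> 'a \<Rightarrow> real^'d) \<Rightarrow> ('t \<Rightarrow> real^'d) \<Rightarrow> ('t \<Rightarrow> 't \<Rightarrow> real)
     \<Rightarrow> real^'d^'d \<Rightarrow> bool" where
  "multivariate_gaussian_process M T X \<mu> k \<Lambda> \<longleftrightarrow>
     (\<forall>n\<ge>1. \<forall>t. (\<forall>i<n. t i \<in> T) \<longrightarrow>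
        matrix_normal M n (\<lambda>i. X (t i)) (\<lambda>i. \<mu> (t i)) (\<lambda>i j. k (t i) (t j)) \<Lambda>)"

definition brownian_motion :: "'a measure \<Rightarrow> real^'d^'d \<Rightarrow> (real \<Rightarrow> 'a \<Rightarrow> real^'d) \<Rightarrow> bool" where
  "brownian_motion M \<Lambda> B \<longleftrightarrow>
     multivariate_gaussian_process M {0..} B (\<lambda>_. 0) min \<Lambda> \<and>
     (\<forall>\<omega>\<in>space M. continuous_on {0..} (\<lambda>t. B t \<omega>))"

definition natural_filtration ::
  "'a measure \<Rightarrow> (real \<Rightarrow> 'a \<Rightarrow> 'b::topological_space) \<Rightarrow> real \<Rightarrow> 'a measure" where
  "natural_filtration M X s =
     sigma (space M) {X u -` A \<inter> space M |u A. 0 \<le> u \<and> u \<le> s \<and> A \<in> sets borel}"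

text \<open>The null sets of \<open>P\<close> are adjoined and right limits are taken. This is the usual augmentation
  provided that \<open>P\<close> is complete.\<close>

definition usual_augmentation :: "'a measure \<Rightarrow> (real \<Rightarrow> 'a measure) \<Rightarrow> real \<Rightarrow> 'a measure" where
  "usual_augmentation P G s =
     sigma (space P) (\<Inter>u\<in>{s<..}. sigma_sets (space P) (sets (G u) \<union> null_sets P))"

definition brownian_filtration ::
  "'a measure \<Rightarrow> (real \<Rightarrow> 'a \<Rightarrow> real^'d) \<Rightarrow> real \<Rightarrow> 'a measure" where
  "brownian_filtration M B = usual_augmentation (completion M) (natural_filtration M B)"


section \<open>The Ito integral\<close>

text \<open>The integral is defined first for simple processes
  \<open>\<Sum>k<n. \<xi>\<^sub>k 1\<^bsub>(\<tau>\<^sub>k, \<tau>\<^sub>k\<^sub>+\<^sub>1]\<^esub>\<close> with bounded \<open>\<xi>\<^sub>k\<close> measurable with respect to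
  the filtration at time \<open>\<tau>\<^sub>k\<close>.\<close>

definition simple_process ::
  "(real \<Rightarrow> 'a measure) \<Rightarrow> nat \<Rightarrow> (nat \<Rightarrow> real) \<Rightarrow> (nat \<Rightarrow> 'a \<Rightarrow> real) \<Rightarrow> bool" where
  "simple_process \<F> n \<tau> \<xi> \<longleftrightarrow>
     0 \<le> \<tau> 0 \<and> (\<forall>k<n. \<tau> k < \<tau> (Suc k)) \<and>
     (\<forall>k<n. \<xi> k \<in> borel_measurable (\<F> (\<tau> k)) \<and> bounded (\<xi> k ` space (\<F> (\<tau> k))))"

definition simple_value ::
  "nat \<Rightarrow> (nat \<Rightarrow> real) \<Rightarrow> (nat \<Rightarrow> 'a \<Rightarrow> real) \<Rightarrow> real \<Rightarrow> 'a \<Rightarrow> real" where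
  "simple_value n \<tau> \<xi> s \<omega> = (\<Sum>k<n. \<xi> k \<omega> * indicator {\<tau> k<..\<tau> (Suc k)} s)"

definition simple_integral ::
  "(real \<Rightarrow> 'a \<Rightarrow> real) \<Rightarrow> nat \<Rightarrow> (nat \<Rightarrow> real) \<Rightarrow> (nat \<Rightarrow> 'a \<Rightarrow> real) \<Rightarrow> real \<Rightarrow> 'a \<Rightarrow> real" where
  "simple_integral X n \<tau> \<xi> t \<omega> =
     (\<Sum>k<n. \<xi> k \<omega> * (X (min t (\<tau> (Suc k))) \<omega> - X (min t (\<tau> k)) \<omega>))"

definition progressively_measurable ::
  "(real \<Rightarrow> 'a measure) \<Rightarrow> (real \<Rightarrow> 'a \<Rightarrow> real) \<Rightarrow> bool" where
  "progressively_measurable \<F> H \<longleftrightarrow>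
     (\<forall>u\<ge>0. (\<lambda>(s, \<omega>). H s \<omega>) \<in> borel_measurable (restrict_space borel {0..u} \<Otimes>\<^sub>M \<F> u))"

definition tends_to_0_in_probability :: "'a measure \<Rightarrow> (nat \<Rightarrow> 'a \<Rightarrow> ennreal) \<Rightarrow> bool" where
  "tends_to_0_in_probability P Z \<longleftrightarrow>
     (\<forall>\<epsilon>>0. (\<lambda>m. measure P {\<omega> \<in> space P. ennreal \<epsilon> < Z m \<omega>}) \<longlonglongrightarrow> 0)"

text \<open>\<open>I\<close> is a version of the integral of \<open>H\<close> over \<open>[0, t]\<close> against \<open>X\<close>, where \<open>X\<close> is a constant
  multiple of a Brownian motion with respect to the filtration \<open>\<F>\<close> on the complete space \<open>P\<close>. The
  integrands are the progressively measurable processes whose paths are almost surely square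
  integrable on \<open>[0, t]\<close> (no finite second moment is required). The integral is the limit in
  probability of the integrals of simple processes that approximate \<open>H\<close> in \<open>L\<^sup>2[0, t]\<close>, in
  probability; the limit is almost surely independent of the approximating sequence. The
  integrals over \<open>[0, t]\<close> are nonnegative Lebesgue integrals, so that they are infinite, and not
  0, where the integrand is not integrable.\<close>

definition has_ito_integral ::
  "'a measure \<Rightarrow> (real \<Rightarrow> 'a measure) \<Rightarrow> (real \<Rightarrow> 'a \<Rightarrow> real) \<Rightarrow> (real \<Rightarrow> 'a \<Rightarrow> real) \<Rightarrow> real
     \<Rightarrow> ('a \<Rightarrow> real) \<Rightarrow> bool" where
  "has_ito_integral P \<F> X H t I \<longleftrightarrow>
     progressively_measurable \<F> H \<and>
     (AE \<omega> in P. (\<integral>\<^sup>+s\<in>{0..t}. ennreal ((H s \<omega>)\<^sup>2) \<partial>lborel) < \<infinity>) \<and>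
     I \<in> borel_measurable P \<and>
     (\<exists>n \<tau> \<xi>. (\<forall>m. simple_process \<F> (n m) (\<tau> m) (\<xi> m)) \<and>
        tends_to_0_in_probability P
          (\<lambda>m \<omega>. \<integral>\<^sup>+s\<in>{0..t}.
             ennreal ((simple_value (n m) (\<tau> m) (\<xi> m) s \<omega> - H s \<omega>)\<^sup>2) \<partial>lborel) \<and>
        tends_to_0_in_probability P
          (\<lambda>m \<omega>. ennreal \<bar>simple_integral X (n m) (\<tau> m) (\<xi> m) t \<omega> - I \<omega>\<bar>))"

definition ito_integral ::
  "'a measure \<Rightarrow> (real \<Rightarrow> 'a measure) \<Rightarrow> (real \<Rightarrow> 'a \<Rightarrow> real) \<Rightarrow> (real \<Rightarrow> 'a \<Rightarrow> real) \<Rightarrow> real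
     \<Rightarrow> 'a \<Rightarrow> real" where
  "ito_integral P \<F> X H t = (SOME I. has_ito_integral P \<F> X H t I)"


section \<open>Differentiability\<close>

definition twice_continuously_differentiable ::
  "('v::real_normed_vector \<Rightarrow> 'w::real_normed_vector) \<Rightarrow> bool" where
  "twice_continuously_differentiable f \<longleftrightarrow>
     (\<exists>(f' :: 'v \<Rightarrow> 'v \<Rightarrow>\<^sub>L 'w) (f'' :: 'v \<Rightarrow> 'v \<Rightarrow>\<^sub>L 'v \<Rightarrow>\<^sub>L 'w).
        (\<forall>x. (f has_derivative blinfun_apply (f' x)) (at x)) \<and>
        (\<forall>x. (f' has_derivative blinfun_apply (f'' x)) (at x)) \<and>
        continuous_on UNIV f'')"

definition partial_deriv :: "'v \<Rightarrow> ('v::real_vector \<Rightarrow> real) \<Rightarrow> 'v \<Rightarrow> real" where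
  "partial_deriv e f x = deriv (\<lambda>h. f (x + h *\<^sub>R e)) 0"

text \<open>\<open>\<real>\<^sup>d\<^sup>+\<^sup>1\<close> is represented as \<^typ>\<open>real \<times> (real^'d)\<close>, with the time variable first.\<close>

abbreviation time_deriv :: "(real \<times> (real^'d) \<Rightarrow> real) \<Rightarrow> real \<times> (real^'d) \<Rightarrow> real" where
  "time_deriv \<equiv> partial_deriv (1, 0)"

abbreviation space_deriv :: "'d \<Rightarrow> (real \<times> (real^'d) \<Rightarrow> real) \<Rightarrow> real \<times> (real^'d) \<Rightarrow> real" where
  "space_deriv i \<equiv> partial_deriv (0, axis i 1)"

end

theory Submission
  imports Defs
begin

text \<open>Along the dyadic partitions of \<open>[0, t]\<close>, Taylor's formula writes the increment of \<open>F\<close> as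
  Riemann sums for the \<open>ds\<close>-integral, the sums \<open>\<Sum>\<^sub>k \<partial>\<^sub>iF \<Delta>\<^sub>kB\<^sub>i\<close>, and the second-order sums
  \<open>\<Sum>\<^sub>k \<partial>\<^sub>i\<partial>\<^sub>jF (\<Delta>\<^sub>kB\<^sub>i \<Delta>\<^sub>kB\<^sub>j - \<lambda>\<^sub>i\<^sub>j \<Delta>\<^sub>ks)\<close>, up to an error that tends to 0 on every path
  of bounded quadratic variation. The second-order sums are sums of orthogonal martingale
  differences whose second moments (after clipping the coefficient) are of order \<open>2\<^sup>-\<^sup>m\<close>; so they tend
  to 0 almost surely. For the first-order sums, the Ito isometry for a
  predictably truncated simple integrand \<open>V\<close> gives
  \<open>P(\<bar>\<integral>V dX\<bar> > \<epsilon>) \<le> q \<delta> / \<epsilon>\<^sup>2 + P(\<integral>V\<^sup>2 ds > \<delta>)\<close>, where \<open>q\<close> is the variance parameter of \<open>X\<close>;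
  this makes them Cauchy in probability and makes the Ito integral almost surely unique. The
  orthogonality rests on the independence of the increments from the right-continuous augmented
  filtration, which is read off from Fourier transforms.\<close>

section \<open>Determination by Fourier transforms\<close>

text \<open>The integral is specified by a choice (\<open>SOME\<close>) among limits in probability,
  so it cannot be computed with directly: a concrete limit of dyadic sums has to be shown to
  qualify, and uniqueness then carries its value over to the chosen version. The derivatives of
  \<open>F\<close> may grow arbitrarily fast, so no moment of an integrand is available; second
  moments are therefore taken only after truncation or clipping, and the remaining estimates are
  made path by path, where continuity on \<open>[0, t]\<close> gives bounds. Simple processes need
  bounded coefficients, whence the clipping at level \<open>m\<close> in the \<open>m\<close>-th
  dyadic sum; on a fixed path it is inactive for all large \<open>m\<close>. The first-order sums
  are controlled only in probability, so their almost sure limits are taken along a subsequence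
  common to all coordinates; the second-order sums converge along the full dyadic sequence, hence
  along that subsequence too. The Gaussian hypothesis speaks of linear combinations at finitely many
  times, that is, of characteristic functions, and this is why independence is reached through
  Fourier transforms.\<close>

lemma integrable_indicator_comp_scaleR:
  fixes Y :: "'a \<Rightarrow> 'b::{banach, second_countable_topology}"
  assumes "integrable M Y" "A \<in> sets borel" "Z \<in> borel_measurable M"
  shows "integrable M (\<lambda>x. indicat_real A (Z x) *\<^sub>R Y x)"
proof (rule Bochner_Integration.integrable_bound[OF assms(1)])
  note [measurable] = assms(2,3) borel_measurable_integrable[OF assms(1)]
  show "(\<lambda>x. indicat_real A (Z x) *\<^sub>R Y x) \<in> borel_measurable M" by measurable
qed (auto simp: indicator_def)

lemma integrable_iexp_mult:
  fixes Y :: "'a \<Rightarrow> complex"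
  assumes "integrable M Y" "Z \<in> borel_measurable M"
  shows "integrable M (\<lambda>x. iexp (Z x) * Y x)"
proof (rule Bochner_Integration.integrable_bound[OF assms(1)])
  note [measurable] = assms(2) borel_measurable_integrable[OF assms(1)]
  show "(\<lambda>x. iexp (Z x) * Y x) \<in> borel_measurable M" by measurable
qed (auto simp: norm_mult)

text \<open>The positive and negative parts of \<open>Y\<close> define two measures, pushed forward
  by \<open>Z\<close>. The hypothesis says that their Fourier transforms agree, and at
  \<open>u = 0\<close> that their masses agree; after normalisation the uniqueness theorem for
  characteristic functions applies.\<close>

lemma fourier_transform_eq_0_real:
  fixes Y :: "'a \<Rightarrow> real"
  assumes Y: "integrable M Y" and Z: "Z \<in> borel_measurable M" and A: "A \<in> sets borel"
    and *: "\<And>u. (\<integral>x. iexp (u * Z x) * complex_of_real (Y x) \<partial>M) = 0"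
  shows "(\<integral>x. indicator A (Z x) * Y x \<partial>M) = 0"
proof -
  note [measurable] = Z A borel_measurable_integrable[OF Y]
  define Yp where "Yp x = max 0 (Y x)" for x
  define Yn where "Yn x = max 0 (- Y x)" for x
  have Yp: "integrable M Yp" and Yn: "integrable M Yn"
    unfolding Yp_def Yn_def using Y by auto
  note [measurable] = borel_measurable_integrable[OF Yp] borel_measurable_integrable[OF Yn]
  have pos: "Yp x \<ge> 0" "Yn x \<ge> 0" and Y_eq: "Y x = Yp x - Yn x" for x
    by (auto simp: Yp_def Yn_def)
  define c where "c = (\<integral>x. Yp x \<partial>M)"
  have c0: "c \<ge> 0" unfolding c_def using pos by (simp add: integral_nonneg_AE)
  have "(\<integral>x. complex_of_real (Y x) \<partial>M) = 0" using *[of 0] by simp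
  then have "(\<integral>x. Y x \<partial>M) = 0" by simp
  then have c_n: "c = (\<integral>x. Yn x \<partial>M)"
    using Yp Yn by (simp add: Y_eq c_def)
  show ?thesis
  \<comment> \<open>Mass 0 cannot be normalised; in that case both parts of \<open>Y\<close> vanish
    almost everywhere.\<close>
  proof (cases "c = 0")
    case True
    have "AE x in M. Yp x = 0"
      using True Yp pos by (subst integral_nonneg_eq_0_iff_AE[symmetric]) (auto simp: c_def)
    moreover have "AE x in M. Yn x = 0"
      using True Yn pos by (subst integral_nonneg_eq_0_iff_AE[symmetric]) (auto simp: c_n)
    ultimately have "AE x in M. indicator A (Z x) * Y x = 0"
      by eventually_elim (simp add: Y_eq)
    then show ?thesis by (rule integral_eq_zero_AE)
  next
    case False
    then have c: "c > 0" using c0 by simp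
    define \<mu> where "\<mu> U = distr (density M (\<lambda>x. ennreal (U x / c))) borel Z" for U :: "'a \<Rightarrow> real"
    have dist: "real_distribution (\<mu> U)"
      if U: "integrable M U" "\<And>x. U x \<ge> 0" "(\<integral>x. U x \<partial>M) = c" for U
    proof -
      note [measurable] = borel_measurable_integrable[OF U(1)]
      have "(\<integral>\<^sup>+x. ennreal (U x / c) \<partial>M) = 1"
        using U c by (subst nn_integral_eq_integral) auto
      then have "emeasure (density M (\<lambda>x. ennreal (U x / c))) (space M) = 1"
        by (subst emeasure_density) (auto intro!: nn_integral_cong)
      then interpret p: prob_space "density M (\<lambda>x. ennreal (U x / c))"
        by (intro prob_spaceI) auto
      show ?thesis unfolding \<mu>_def
        by (rule p.real_distribution_distr) simp
    qed
    have int: "(\<integral>x. f x \<partial>\<mu> U) = (\<integral>x. (U x / c) *\<^sub>R f (Z x) \<partial>M)"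
      if U: "integrable M U" "\<And>x. U x \<ge> 0" and f: "f \<in> borel_measurable borel"
      for U and f :: "real \<Rightarrow> 'z::{banach, second_countable_topology}"
    proof -
      note [measurable] = borel_measurable_integrable[OF U(1)] f
      show ?thesis unfolding \<mu>_def
        using U c by (subst integral_distr) (auto simp: integral_density)
    qed
    have "char (\<mu> Yp) = char (\<mu> Yn)"
    proof
      fix u
      have i: "integrable M (\<lambda>x. iexp (u * Z x) * complex_of_real (U x))" if "integrable M U" for U
        using that by (intro integrable_iexp_mult) auto
      have "0 = (\<integral>x. iexp (u * Z x) * complex_of_real (Yp x) -
                      iexp (u * Z x) * complex_of_real (Yn x) \<partial>M)"
        using *[of u] by (simp add: Y_eq algebra_simps)
      also have "\<dots> = (\<integral>x. iexp (u * Z x) * complex_of_real (Yp x) \<partial>M) -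
                      (\<integral>x. iexp (u * Z x) * complex_of_real (Yn x) \<partial>M)"
        by (rule Bochner_Integration.integral_diff[OF i[OF Yp] i[OF Yn]])
      finally have eq: "(\<integral>x. iexp (u * Z x) * complex_of_real (Yp x) \<partial>M) =
                      (\<integral>x. iexp (u * Z x) * complex_of_real (Yn x) \<partial>M)" by simp
      have "char (\<mu> U) u = (\<integral>x. iexp (u * Z x) * complex_of_real (U x) \<partial>M) / c"
        if "integrable M U" "\<And>x. U x \<ge> 0" for U
      proof -
        have "char (\<mu> U) u = (\<integral>x. (U x / c) *\<^sub>R iexp (u * Z x) \<partial>M)"
          unfolding char_def by (rule int[OF that]) measurable
        also have "\<dots> = (\<integral>x. (iexp (u * Z x) * complex_of_real (U x)) / c \<partial>M)"
          by (intro Bochner_Integration.integral_cong refl) (simp add: scaleR_conv_of_real)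
        finally show ?thesis by (simp only: integral_divide_zero)
      qed
      then show "char (\<mu> Yp) u = char (\<mu> Yn) u" using Yp Yn pos eq by simp
    qed
    then have "\<mu> Yp = \<mu> Yn"
      using dist[OF Yp pos(1)] dist[OF Yn pos(2)] c_def c_n by (intro Levy_uniqueness) auto
    then have "(\<integral>x. indicat_real A x \<partial>\<mu> Yp) = (\<integral>x. indicat_real A x \<partial>\<mu> Yn)" by simp
    then have "(\<integral>x. indicat_real A (Z x) * Yp x \<partial>M) / c = (\<integral>x. indicat_real A (Z x) * Yn x \<partial>M) / c"
      using int[OF Yp pos(1), of "indicat_real A"] int[OF Yn pos(2), of "indicat_real A"] A
      by (subst (1 2) integral_divide_zero[symmetric]) (simp add: mult.commute)
    moreover have "(\<integral>x. indicat_real A (Z x) * Y x \<partial>M) =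
        (\<integral>x. indicat_real A (Z x) * Yp x \<partial>M) - (\<integral>x. indicat_real A (Z x) * Yn x \<partial>M)"
      unfolding Y_eq right_diff_distrib
      using integrable_indicator_comp_scaleR[OF Yp A Z] integrable_indicator_comp_scaleR[OF Yn A Z]
      by (intro Bochner_Integration.integral_diff) auto
    ultimately show ?thesis using c by simp
  qed
qed

text \<open>Conjugation exchanges the transform of \<open>Y\<close> at \<open>-u\<close> with that
  of \<open>cnj (Y x)\<close> at \<open>u\<close>. Both vanish for every \<open>u\<close>, so the
  real and imaginary parts fall under the real case.\<close>

lemma fourier_transform_eq_0:
  fixes Y :: "'a \<Rightarrow> complex"
  assumes Y: "integrable M Y" and Z: "Z \<in> borel_measurable M" and A: "A \<in> sets borel"
    and *: "\<And>u. (\<integral>x. iexp (u * Z x) * Y x \<partial>M) = 0"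
  shows "(\<integral>x. indicat_real A (Z x) *\<^sub>R Y x \<partial>M) = 0"
proof -
  note iI = integrable_indicator_comp_scaleR[OF Y A Z]
  have i: "integrable M (\<lambda>x. iexp (u * Z x) * Y x)"
    "integrable M (\<lambda>x. iexp (u * Z x) * cnj (Y x))" for u
    using Y Z integrable_iexp_mult[of M Y "\<lambda>x. u * Z x"]
      integrable_iexp_mult[of M "\<lambda>x. cnj (Y x)" "\<lambda>x. u * Z x"] by auto
  have cnj: "(\<integral>x. iexp (u * Z x) * cnj (Y x) \<partial>M) = 0" for u
  proof -
    have "cnj (\<integral>x. iexp (- u * Z x) * Y x \<partial>M) = (\<integral>x. cnj (iexp (- u * Z x) * Y x) \<partial>M)"
      by (simp only: Bochner_Integration.integral_cnj)
    also have "\<dots> = (\<integral>x. iexp (u * Z x) * cnj (Y x) \<partial>M)"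
      by (simp add: exp_cnj)
    finally show ?thesis using *[of "-u"] by simp
  qed
  have "(\<integral>x. indicator A (Z x) * Re (Y x) \<partial>M) = 0"
  proof (rule fourier_transform_eq_0_real[OF _ Z A])
    show "integrable M (\<lambda>x. Re (Y x))" using Y by simp
    fix u
    have "(\<integral>x. iexp (u * Z x) * complex_of_real (Re (Y x)) \<partial>M) =
      (\<integral>x. (iexp (u * Z x) * Y x + iexp (u * Z x) * cnj (Y x)) / 2 \<partial>M)"
      by (intro Bochner_Integration.integral_cong refl)
         (simp add: complex_add_cnj distrib_left[symmetric])
    also have "\<dots> = 0"
      by (simp only: integral_divide_zero Bochner_Integration.integral_add[OF i] cnj *) simp
    finally show "(\<integral>x. iexp (u * Z x) * complex_of_real (Re (Y x)) \<partial>M) = 0" .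
  qed
  moreover have "(\<integral>x. indicator A (Z x) * Im (Y x) \<partial>M) = 0"
  proof (rule fourier_transform_eq_0_real[OF _ Z A])
    show "integrable M (\<lambda>x. Im (Y x))" using Y by simp
    fix u
    have "(\<integral>x. iexp (u * Z x) * complex_of_real (Im (Y x)) \<partial>M) =
      (\<integral>x. (iexp (u * Z x) * Y x - iexp (u * Z x) * cnj (Y x)) / (2 * \<i>) \<partial>M)"
    proof (intro Bochner_Integration.integral_cong refl)
      fix x
      have "complex_of_real (Im (Y x)) = (Y x - cnj (Y x)) / (2 * \<i>)"
        by (simp add: complex_diff_cnj) (simp add: complex_eq_iff)
      then show "iexp (u * Z x) * complex_of_real (Im (Y x)) =
          (iexp (u * Z x) * Y x - iexp (u * Z x) * cnj (Y x)) / (2 * \<i>)"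
        by (simp only: right_diff_distrib times_divide_eq_right)
    qed
    also have "\<dots> = 0"
      by (simp only: integral_divide_zero Bochner_Integration.integral_diff[OF i] cnj *) simp
    finally show "(\<integral>x. iexp (u * Z x) * complex_of_real (Im (Y x)) \<partial>M) = 0" .
  qed
  ultimately show ?thesis
    using integral_Re[OF iI] integral_Im[OF iI] by (intro complex_eqI) simp_all
qed

text \<open>One coordinate at a time is turned from an exponential into an indicator: with the
  remaining exponentials absorbed into the integrable factor, the one-dimensional lemma applies to
  \<open>Z i\<close>, and the indicator obtained is then multiplied into \<open>Y\<close> for the
  induction hypothesis.\<close>

lemma fourier_transform_eq_0_multi:
  fixes Y :: "'a \<Rightarrow> complex" and Z :: "'i \<Rightarrow> 'a \<Rightarrow> real"
  assumes "finite I" and "integrable M Y" and "\<And>i. i \<in> I \<Longrightarrow> Z i \<in> borel_measurable M"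
    and "\<And>i. i \<in> I \<Longrightarrow> A i \<in> sets borel"
    and "\<And>u. (\<integral>x. iexp (\<Sum>i\<in>I. u i * Z i x) * Y x \<partial>M) = 0"
  shows "(\<integral>x. (\<Prod>i\<in>I. indicat_real (A i) (Z i x)) *\<^sub>R Y x \<partial>M) = 0"
  using assms
proof (induction I arbitrary: Y rule: finite_induct)
  case (insert i I)
  note [measurable] = insert.prems(2,3)
  have Zi: "Z i \<in> borel_measurable M" and Ai: "A i \<in> sets borel" using insert.prems by auto
  define Y' where "Y' x = indicat_real (A i) (Z i x) *\<^sub>R Y x" for x
  have "(\<integral>x. (\<Prod>j\<in>I. indicat_real (A j) (Z j x)) *\<^sub>R Y' x \<partial>M) = 0"
  proof (rule insert.IH)
    show "integrable M Y'" unfolding Y'_def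
      by (rule integrable_indicator_comp_scaleR[OF insert.prems(1) Ai Zi])
    fix u
    have "(\<integral>x. indicat_real (A i) (Z i x) *\<^sub>R (iexp (\<Sum>j\<in>I. u j * Z j x) * Y x) \<partial>M) = 0"
    proof (rule fourier_transform_eq_0[OF _ Zi Ai])
      show "integrable M (\<lambda>x. iexp (\<Sum>j\<in>I. u j * Z j x) * Y x)"
        using insert.prems by (intro integrable_iexp_mult) auto
      fix s
      have "(\<integral>x. iexp (s * Z i x) * (iexp (\<Sum>j\<in>I. u j * Z j x) * Y x) \<partial>M)
          = (\<integral>x. iexp (\<Sum>j\<in>insert i I. (u(i := s)) j * Z j x) * Y x \<partial>M)"
      proof (intro Bochner_Integration.integral_cong refl)
        fix x
        have "(\<Sum>j\<in>insert i I. (u(i := s)) j * Z j x) = s * Z i x + (\<Sum>j\<in>I. u j * Z j x)"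
          using insert.hyps by (auto intro!: sum.cong)
        then show "iexp (s * Z i x) * (iexp (\<Sum>j\<in>I. u j * Z j x) * Y x) =
            iexp (\<Sum>j\<in>insert i I. (u(i := s)) j * Z j x) * Y x"
          by (simp add: distrib_left exp_add mult.assoc del: of_real_sum fun_upd_apply)
      qed
      also have "\<dots> = 0" by (rule insert.prems(4))
      finally show "(\<integral>x. iexp (s * Z i x) * (iexp (\<Sum>j\<in>I. u j * Z j x) * Y x) \<partial>M) = 0" .
    qed
    then show "(\<integral>x. iexp (\<Sum>j\<in>I. u j * Z j x) * Y' x \<partial>M) = 0"
      unfolding Y'_def by (simp add: algebra_simps)
  qed (use insert.prems in auto)
  then show ?case using insert.hyps by (simp add: Y'_def mult.commute)
qed simp

text \<open>The sets over which the integral vanishes form a Dynkin system: complements use that the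
  total integral is 0, disjoint unions use countable additivity.\<close>

lemma set_integral_eq_0_sigma_sets:
  fixes Y :: "'a \<Rightarrow> 'b::{banach, second_countable_topology}"
  assumes G: "Int_stable G" "G \<subseteq> sets M" and Y: "integrable M Y"
    and G0: "\<And>A. A \<in> G \<Longrightarrow> (LINT x:A|M. Y x) = 0" and "(LINT x|M. Y x) = 0"
    and A: "A \<in> sigma_sets (space M) G"
  shows "(LINT x:A|M. Y x) = 0"
proof -
  have si: "set_integrable M A Y" if "A \<in> sets M" for A
    unfolding set_integrable_def using that Y by (intro integrable_mult_indicator)
  have sub: "A \<in> sigma_sets (space M) G \<Longrightarrow> A \<in> sets M" for A
    by (rule sets.sigma_sets_subset[OF G(2), THEN subsetD])
  have "G \<subseteq> Pow (space M)" using G(2) sets.space_closed by blast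
  from G(1) this A show ?thesis
  proof (induction A rule: sigma_sets_induct_disjoint)
    case (basic A) then show ?case by (rule G0)
  next
    case empty show ?case by (simp add: set_lebesgue_integral_def)
  next
    case (compl A)
    have A: "A \<in> sets M" using compl sub by auto
    have "(LINT x:A \<union> (space M - A)|M. Y x) = (LINT x:A|M. Y x) + (LINT x:space M - A|M. Y x)"
      using A by (intro set_integral_Un si) auto
    moreover have "A \<union> (space M - A) = space M" using sets.sets_into_space[OF A] by auto
    ultimately show ?case using compl assms(5) by (simp add: set_integral_space[OF Y])
  next
    case (union A)
    have [measurable]: "A i \<in> sets M" for i using union by (intro sub) auto
    have "(LINT x:(\<Union>i. A i)|M. Y x) = (\<Sum>i. (LINT x:A i|M. Y x))"
      using union by (intro lebesgue_integral_countable_add si) (auto simp: disjoint_family_on_def)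
    then show ?case using union by simp
  qed
qed

section \<open>Brownian motion with respect to its augmented filtration\<close>

text \<open>The kernel is \<open>min s t = \<integral> 1\<^bsub>[0, s)\<^esub> 1\<^bsub>[0, t)\<^esub>\<close>. Nonnegativity matters because
  \<^const>\<open>normal_law\<close> with a negative variance is a point mass.\<close>

lemma min_kernel_nonneg:
  fixes \<Lambda> :: "real^'d^'d" and c :: "nat \<Rightarrow> real^'d"
  assumes \<Lambda>: "positive_semidefinite \<Lambda>" and t: "\<And>i. i < n \<Longrightarrow> 0 \<le> t i"
  shows "0 \<le> (\<Sum>i<n. \<Sum>j<n. (c i \<bullet> (\<Lambda> *v c j)) * min (t i) (t j))"
proof -
  \<comment> \<open>With this vector-valued step function the double sum becomes the integral of the
    quadratic form of \<open>\<Lambda>\<close> in \<open>f r\<close>, which is nonnegative at each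
    \<open>r\<close>.\<close>
  define f where "f r = (\<Sum>i<n. indicat_real {0..<t i} r *\<^sub>R c i)" for r
  have f_eq: "f r \<bullet> (\<Lambda> *v f r) =
      (\<Sum>i<n. \<Sum>j<n. (c i \<bullet> (\<Lambda> *v c j)) * indicat_real ({0..<t i} \<inter> {0..<t j}) r)" for r
  proof -
    have "(\<Sum>i<n. g i *\<^sub>R c i) \<bullet> (\<Lambda> *v (\<Sum>i<n. g i *\<^sub>R c i)) =
        (\<Sum>i<n. \<Sum>j<n. (c i \<bullet> (\<Lambda> *v c j)) * (g i * g j))" for g
      by (simp only: linear_sum[OF matrix_vector_mul_linear] inner_sum_left)
         (simp add: inner_sum_right matrix_vector_mult_scaleR mult_ac)
    then show ?thesis unfolding f_def indicator_inter_arith .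
  qed
  have "has_bochner_integral lborel (\<lambda>r. (c i \<bullet> (\<Lambda> *v c j)) * indicat_real ({0..<t i} \<inter> {0..<t j}) r)
      ((c i \<bullet> (\<Lambda> *v c j)) * min (t i) (t j))" if "i < n" "j < n" for i j
  proof -
    have "{0..<t i} \<inter> {0..<t j} = {0..<min (t i) (t j)}" by auto
    moreover have "has_bochner_integral lborel (indicat_real {0..<min (t i) (t j)})
        (measure lborel {0..<min (t i) (t j)})"
      using t[OF that(1)] t[OF that(2)] by (intro has_bochner_integral_real_indicator) auto
    ultimately show ?thesis
      using t[OF that(1)] t[OF that(2)] by (intro has_bochner_integral_mult_right) auto
  qed
  then have "has_bochner_integral lborel (\<lambda>r. f r \<bullet> (\<Lambda> *v f r))
      (\<Sum>i<n. \<Sum>j<n. (c i \<bullet> (\<Lambda> *v c j)) * min (t i) (t j))"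
    unfolding f_eq by (intro has_bochner_integral_sum) auto
  then have "(\<integral>r. f r \<bullet> (\<Lambda> *v f r) \<partial>lborel) = (\<Sum>i<n. \<Sum>j<n. (c i \<bullet> (\<Lambda> *v c j)) * min (t i) (t j))"
    by (rule has_bochner_integral_integral_eq)
  then show ?thesis
    using \<Lambda> Bochner_Integration.integral_nonneg[of lborel "\<lambda>r. f r \<bullet> (\<Lambda> *v f r)"]
    by (simp add: positive_semidefinite_def)
qed

section \<open>Characteristic functions of the finite-dimensional laws\<close>

lemma char_normal_law:
  assumes "0 \<le> v"
  shows "char (normal_law 0 v) \<theta> = exp (- (v * \<theta>\<^sup>2) / 2)"
proof (cases "v = 0")
  case True
  have "char (return borel 0) \<theta> = 1"
    unfolding char_def by (subst integral_return) auto
  then show ?thesis using True by (simp add: normal_law_def)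
next
  case False
  define \<sigma> where "\<sigma> = sqrt v"
  have \<sigma>: "\<sigma> > 0" "\<sigma>\<^sup>2 = v" using False assms by (auto simp: \<sigma>_def)
  have "char (normal_law 0 v) \<theta> = (\<integral>x. normal_density 0 \<sigma> x *\<^sub>R iexp (\<theta> * x) \<partial>lborel)"
    using False assms by (simp add: normal_law_def char_def \<sigma>_def[symmetric] integral_density)
  also have "\<dots> = \<bar>\<sigma>\<bar> *\<^sub>R (\<integral>x. normal_density 0 \<sigma> (0 + \<sigma> * x) *\<^sub>R iexp (\<theta> * (0 + \<sigma> * x)) \<partial>lborel)"
    using \<sigma> by (intro lborel_integral_real_affine) simp
  also have "\<dots> = (\<integral>x. \<bar>\<sigma>\<bar> *\<^sub>R (normal_density 0 \<sigma> (0 + \<sigma> * x) *\<^sub>R iexp (\<theta> * (0 + \<sigma> * x))) \<partial>lborel)"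
    by (rule integral_scaleR_right[symmetric])
  also have "\<dots> = (\<integral>x. std_normal_density x *\<^sub>R iexp ((\<theta> * \<sigma>) * x) \<partial>lborel)"
  proof (intro Bochner_Integration.integral_cong refl)
    fix x
    have "\<bar>\<sigma>\<bar> * normal_density 0 \<sigma> (0 + \<sigma> * x) = std_normal_density x"
      using \<sigma>(1) by (simp add: normal_density_def power_mult_distrib real_sqrt_mult)
    then show "\<bar>\<sigma>\<bar> *\<^sub>R (normal_density 0 \<sigma> (0 + \<sigma> * x) *\<^sub>R iexp (\<theta> * (0 + \<sigma> * x))) =
        std_normal_density x *\<^sub>R iexp ((\<theta> * \<sigma>) * x)"
      by (simp only: scaleR_scaleR) (simp add: mult.assoc)
  qed
  also have "\<dots> = char std_normal_distribution (\<theta> * \<sigma>)"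
    by (simp add: char_def integral_density)
  also have "\<dots> = exp (- (v * \<theta>\<^sup>2) / 2)"
    by (simp add: char_std_normal_distribution power_mult_distrib \<sigma> mult.commute)
  finally show ?thesis .
qed

lemma brownian_motion_measurable:
  assumes "brownian_motion M \<Lambda> B" "0 \<le> t"
  shows "B t \<in> borel_measurable M"
proof -
  have "matrix_normal M 1 (\<lambda>i. B t) (\<lambda>i. 0) (\<lambda>i j. min t t) \<Lambda>"
    using assms by (auto simp: brownian_motion_def multivariate_gaussian_process_def
        dest!: spec[of _ "1::nat"] spec[of _ "\<lambda>_. t"])
  then have "(\<lambda>x. B t x $ i) \<in> borel_measurable M" for i
    by (force simp: matrix_normal_def multivariate_normal_def vec_rows_def)
  then show ?thesis
    by (subst borel_measurable_euclidean_space)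
       (auto simp: Basis_vec_def inner_axis)
qed

text \<open>The entry \<open>(j, i)\<close> of the vectorisation is coordinate \<open>j\<close> of
  \<open>B (t i)\<close>, so its weight is \<open>c i $ j\<close>. Regrouping the quadratic form of
  the Kronecker product by rows collects the coordinates into
  \<open>c i \<bullet> (\<Lambda> *v c j)\<close>.\<close>

lemma brownian_motion_linear_combination:
  fixes B :: "real \<Rightarrow> 'a \<Rightarrow> real^'d" and c :: "nat \<Rightarrow> real^'d"
  assumes B: "brownian_motion M \<Lambda> B" and n: "n \<ge> 1" and t: "\<And>i. i < n \<Longrightarrow> 0 \<le> t i"
  shows "distr M borel (\<lambda>x. \<Sum>i<n. c i \<bullet> B (t i) x) =
    normal_law 0 (\<Sum>i<n. \<Sum>j<n. (c i \<bullet> (\<Lambda> *v c j)) * min (t i) (t j))"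
proof -
  define a where "a = (\<lambda>(j, i). c i $ j)"
  have "matrix_normal M n (\<lambda>i. B (t i)) (\<lambda>i. 0) (\<lambda>i j. min (t i) (t j)) \<Lambda>"
    using B n t by (simp add: brownian_motion_def multivariate_gaussian_process_def)
  then have "distr M borel (\<lambda>x. \<Sum>p\<in>UNIV \<times> {..<n}. a p * vec_rows (\<lambda>i. B (t i) x) p) =
      normal_law (\<Sum>p\<in>UNIV \<times> {..<n}. a p * vec_rows (\<lambda>i. 0) p)
        (\<Sum>p\<in>UNIV \<times> {..<n}. \<Sum>p'\<in>UNIV \<times> {..<n}. a p * a p' *
           kronecker (\<lambda>i j. \<Lambda> $ i $ j) (\<lambda>i j. min (t i) (t j)) p p')"
    unfolding matrix_normal_def multivariate_normal_def by blast
  also have "(\<lambda>x. \<Sum>p\<in>UNIV \<times> {..<n}. a p * vec_rows (\<lambda>i. B (t i) x) p) = (\<lambda>x. \<Sum>i<n. c i \<bullet> B (t i) x)"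
    unfolding sum.cartesian_product' inner_vec_def
    by (subst sum.swap) (simp add: a_def vec_rows_def)
  also have "(\<Sum>p\<in>UNIV \<times> {..<n}. a p * vec_rows (\<lambda>i. 0 :: real^'d) p) = 0"
    by (simp add: vec_rows_def split_beta)
  also have "(\<Sum>p\<in>UNIV \<times> {..<n}. \<Sum>p'\<in>UNIV \<times> {..<n}. a p * a p' *
           kronecker (\<lambda>i j. \<Lambda> $ i $ j) (\<lambda>i j. min (t i) (t j)) p p') =
      (\<Sum>i<n. \<Sum>j<n. (c i \<bullet> (\<Lambda> *v c j)) * min (t i) (t j))" (is "?L = ?R")
  proof -
    have "?L = (\<Sum>k\<in>UNIV. \<Sum>i<n. \<Sum>l\<in>UNIV. \<Sum>j<n. c i $ k * c j $ l * (\<Lambda> $ k $ l * min (t i) (t j)))"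
      by (simp add: sum.cartesian_product' a_def kronecker_def)
    also have "\<dots> = (\<Sum>i<n. \<Sum>k\<in>UNIV. \<Sum>j<n. \<Sum>l\<in>UNIV. c i $ k * c j $ l * (\<Lambda> $ k $ l * min (t i) (t j)))"
      by (subst sum.swap) (intro sum.cong refl sum.swap)
    also have "\<dots> = (\<Sum>i<n. \<Sum>j<n. \<Sum>k\<in>UNIV. \<Sum>l\<in>UNIV. c i $ k * c j $ l * (\<Lambda> $ k $ l * min (t i) (t j)))"
      by (intro sum.cong refl sum.swap)
    also have "\<dots> = ?R"
      by (simp add: inner_vec_def matrix_vector_mult_def sum_distrib_left sum_distrib_right mult_ac)
    finally show ?thesis .
  qed
  finally show ?thesis .
qed

lemma (in prob_space) brownian_motion_char:
  fixes c :: "nat \<Rightarrow> real^'d"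
  assumes \<Lambda>: "positive_semidefinite \<Lambda>" and B: "brownian_motion M \<Lambda> B" and t: "\<And>i. i < n \<Longrightarrow> 0 \<le> t i"
  shows "(\<integral>x. iexp (\<Sum>i<n. c i \<bullet> B (t i) x) \<partial>M) =
    exp (- (\<Sum>i<n. \<Sum>j<n. (c i \<bullet> (\<Lambda> *v c j)) * min (t i) (t j)) / 2)"
\<comment> \<open>The definition of the process starts at one time point; the empty list of times
  arises later from cylinders without conditions.\<close>
proof (cases "n = 0")
  case False
  have [measurable]: "(\<lambda>x. \<Sum>i<n. c i \<bullet> B (t i) x) \<in> borel_measurable M"
    using brownian_motion_measurable[OF B t] by auto
  have "(\<integral>x. iexp (\<Sum>i<n. c i \<bullet> B (t i) x) \<partial>M) =
      char (distr M borel (\<lambda>x. \<Sum>i<n. c i \<bullet> B (t i) x)) 1"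
    unfolding char_def by (subst integral_distr) (auto simp del: of_real_sum)
  also have "\<dots> = exp (- (\<Sum>i<n. \<Sum>j<n. (c i \<bullet> (\<Lambda> *v c j)) * min (t i) (t j)) / 2)"
    using False by (subst brownian_motion_linear_combination[OF B _ t])
      (auto simp: char_normal_law min_kernel_nonneg[OF \<Lambda> t])
  finally show ?thesis .
qed (simp add: prob_space)

text \<open>The increment is appended as two more points, \<open>s\<close> with weight
  \<open>- a\<close> and \<open>u\<close> with weight \<open>a\<close>. Since
  \<open>t i \<le> s\<close>, both minima with \<open>t i\<close> equal \<open>t i\<close>, so the
  covariances with the past cancel and the variance splits into that of the past and that of the
  increment.\<close>

lemma (in prob_space) brownian_motion_char_increment:
  fixes c :: "nat \<Rightarrow> real^'d"
  assumes \<Lambda>: "positive_semidefinite \<Lambda>" and B: "brownian_motion M \<Lambda> B"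
    and t: "\<And>i. i < n \<Longrightarrow> 0 \<le> t i \<and> t i \<le> s" and su: "0 \<le> s" "s \<le> u"
  shows "(\<integral>x. iexp (\<Sum>i<n. c i \<bullet> B (t i) x) *
      (iexp (a \<bullet> (B u x - B s x)) - exp (- ((a \<bullet> (\<Lambda> *v a)) * (u - s)) / 2)) \<partial>M) = 0"
proof -
  define c' where "c' = c(n := - a, Suc n := a)"
  define t' where "t' = t(n := s, Suc n := u)"
  define V where "V = (\<Sum>i<n. \<Sum>j<n. (c i \<bullet> (\<Lambda> *v c j)) * min (t i) (t j))"
  define q where "q = (a \<bullet> (\<Lambda> *v a)) * (u - s)"
  have t': "0 \<le> t' i" if "i < Suc (Suc n)" for i
    using that t su by (auto simp: t'_def less_Suc_eq)
  have [measurable]: "B s \<in> borel_measurable M" "B u \<in> borel_measurable M"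
    using su by (auto intro: brownian_motion_measurable[OF B])
  have [measurable]: "(\<lambda>x. \<Sum>i<n. c i \<bullet> B (t i) x) \<in> borel_measurable M"
    using brownian_motion_measurable[OF B] t by auto
  have sum_c': "(\<Sum>i<Suc (Suc n). c' i \<bullet> B (t' i) x) =
      (\<Sum>i<n. c i \<bullet> B (t i) x) + a \<bullet> (B u x - B s x)" for x
    by (simp add: c'_def t'_def inner_diff_right)
  have V': "(\<Sum>i<Suc (Suc n). \<Sum>j<Suc (Suc n). (c' i \<bullet> (\<Lambda> *v c' j)) * min (t' i) (t' j)) = V + q"
  proof -
    have m: "(\<Lambda> *v (- x)) = - (\<Lambda> *v x)" for x
      using matrix_vector_mult_scaleR[of \<Lambda> "-1" x] by simp
    have 1: "(\<Sum>i<n. \<Sum>j<n. (c' i \<bullet> (\<Lambda> *v c' j)) * min (t' i) (t' j)) = V"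
      unfolding V_def by (intro sum.cong refl) (simp add: c'_def t'_def)
    have 2: "(c' i \<bullet> (\<Lambda> *v c' n)) * min (t' i) (t' n) +
        (c' i \<bullet> (\<Lambda> *v c' (Suc n))) * min (t' i) (t' (Suc n)) = 0" if "i < n" for i
      using that t[OF that] su by (simp add: c'_def t'_def m)
    have 3: "(c' n \<bullet> (\<Lambda> *v c' j)) * min (t' n) (t' j) +
        (c' (Suc n) \<bullet> (\<Lambda> *v c' j)) * min (t' (Suc n)) (t' j) = 0" if "j < n" for j
      using that t[OF that] su by (simp add: c'_def t'_def m)
    have 4: "(c' n \<bullet> (\<Lambda> *v c' n)) * min (t' n) (t' n) + (c' n \<bullet> (\<Lambda> *v c' (Suc n))) * min (t' n) (t' (Suc n))
        + ((c' (Suc n) \<bullet> (\<Lambda> *v c' n)) * min (t' (Suc n)) (t' n) +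
           (c' (Suc n) \<bullet> (\<Lambda> *v c' (Suc n))) * min (t' (Suc n)) (t' (Suc n))) = q"
      using su by (simp add: c'_def t'_def m q_def algebra_simps)
    have "(\<Sum>i<Suc (Suc n). \<Sum>j<Suc (Suc n). (c' i \<bullet> (\<Lambda> *v c' j)) * min (t' i) (t' j)) =
       V + (\<Sum>i<n. (c' i \<bullet> (\<Lambda> *v c' n)) * min (t' i) (t' n) +
        (c' i \<bullet> (\<Lambda> *v c' (Suc n))) * min (t' i) (t' (Suc n))) +
       (\<Sum>j<n. (c' n \<bullet> (\<Lambda> *v c' j)) * min (t' n) (t' j) +
        (c' (Suc n) \<bullet> (\<Lambda> *v c' j)) * min (t' (Suc n)) (t' j)) + q"
      unfolding 1[symmetric] 4[symmetric] sum.lessThan_Suc sum.distrib by (simp add: algebra_simps)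
    then show ?thesis using 2 3 by simp
  qed
  have "(\<integral>x. iexp (\<Sum>i<n. c i \<bullet> B (t i) x) * iexp (a \<bullet> (B u x - B s x)) \<partial>M) =
      (\<integral>x. iexp (\<Sum>i<Suc (Suc n). c' i \<bullet> B (t' i) x) \<partial>M)"
    unfolding sum_c' of_real_add distrib_left exp_add by simp
  also have "\<dots> = exp (- (V + q) / 2)"
    unfolding V'[symmetric] by (rule brownian_motion_char[OF \<Lambda> B t'])
  finally have 1: "(\<integral>x. iexp (\<Sum>i<n. c i \<bullet> B (t i) x) * iexp (a \<bullet> (B u x - B s x)) \<partial>M) =
      exp (- (V + q) / 2)" .
  have 2: "(\<integral>x. iexp (\<Sum>i<n. c i \<bullet> B (t i) x) \<partial>M) = exp (- V / 2)"
    unfolding V_def using t by (intro brownian_motion_char[OF \<Lambda> B]) auto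
  have int: "integrable M (\<lambda>x. iexp (\<Sum>i<n. c i \<bullet> B (t i) x) * iexp (a \<bullet> (B u x - B s x)))"
    by (rule integrable_const_bound[where B = 1]) (auto simp: norm_mult simp del: of_real_sum)
  have int': "integrable M (\<lambda>x. iexp (\<Sum>i<n. c i \<bullet> B (t i) x) * complex_of_real (exp (- q / 2)))"
    by (intro integrable_mult_left integrable_const_bound[where B = 1]) (auto simp del: of_real_sum)
  show ?thesis
    unfolding q_def[symmetric] unfolding right_diff_distrib Bochner_Integration.integral_diff[OF int int'] 1
      integral_mult_left_zero 2
    by (simp add: exp_add[symmetric] diff_divide_distrib add_divide_distrib flip: of_real_mult)
qed

text \<open>This is all that the stochastic calculus below uses of Brownian motion. Law and
  independence are stated only for scalar projections of a single increment; products of two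
  coordinates are recovered from these by polarisation.\<close>

locale filtered_brownian_motion = prob_space M for M :: "'a measure" +
  fixes \<F> :: "real \<Rightarrow> 'a measure" and \<Lambda> :: "real^'d^'d" and B :: "real \<Rightarrow> 'a \<Rightarrow> real^'d"
  assumes space_F [simp]: "space (\<F> s) = space M"
    and sets_F: "sets (\<F> s) \<subseteq> sets M"
    and F_mono: "s \<le> u \<Longrightarrow> sets (\<F> s) \<subseteq> sets (\<F> u)"
    and adapted: "0 \<le> s \<Longrightarrow> B s \<in> borel_measurable (\<F> s)"
    and continuous_paths: "x \<in> space M \<Longrightarrow> continuous_on {0..} (\<lambda>s. B s x)"
    and psd: "positive_semidefinite \<Lambda>"
    and increment_distr: "0 \<le> s \<Longrightarrow> s \<le> u \<Longrightarrow>
      distr M borel (\<lambda>x. a \<bullet> (B u x - B s x)) = normal_law 0 ((a \<bullet> (\<Lambda> *v a)) * (u - s))"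
    and increment_indep: "0 \<le> s \<Longrightarrow> s \<le> u \<Longrightarrow> A \<in> sets (\<F> s) \<Longrightarrow> C \<in> sets borel \<Longrightarrow>
      prob (A \<inter> {x \<in> space M. a \<bullet> (B u x - B s x) \<in> C}) =
      prob A * prob {x \<in> space M. a \<bullet> (B u x - B s x) \<in> C}"

text \<open>The augmentation adjoins the null sets of the completed measure, so the argument runs on
  the completion; a function measurable for the original space has the same law there.\<close>

lemma brownian_motion_completion:
  assumes "brownian_motion M \<Lambda> B"
  shows "brownian_motion (completion M) \<Lambda> B"
proof -
  have *: "multivariate_normal (completion M) I X \<mu> \<Sigma>" if "multivariate_normal M I X \<mu> \<Sigma>"
    for I :: "('d \<times> nat) set" and X \<mu> \<Sigma>
  proof -
    have [measurable]: "X i \<in> borel_measurable M" if "i \<in> I" for i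
      using that \<open>multivariate_normal M I X \<mu> \<Sigma>\<close> by (simp add: multivariate_normal_def)
    have "distr (completion M) borel (\<lambda>x. \<Sum>i\<in>I. a i * X i x) =
        distr M borel (\<lambda>x. \<Sum>i\<in>I. a i * X i x)" for a
      by (rule distr_completion) measurable
    then show ?thesis
      using that by (auto simp: multivariate_normal_def intro: measurable_completion)
  qed
  show ?thesis
    using assms *
    unfolding brownian_motion_def multivariate_gaussian_process_def matrix_normal_def space_completion
    by blast
qed

section \<open>Independence of increments from the augmented past\<close>

lemma sets_natural_filtration:
  "sets (natural_filtration M X s) =
    sigma_sets (space M) {X u -` A \<inter> space M |u A. 0 \<le> u \<and> u \<le> s \<and> A \<in> sets borel}"
  unfolding natural_filtration_def by (rule sets_measure_of) auto

lemma sets_natural_filtration_subset: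
  assumes "\<And>t. 0 \<le> t \<Longrightarrow> X t \<in> borel_measurable M"
  shows "sets (natural_filtration M X s) \<subseteq> sets M"
  unfolding sets_natural_filtration
  by (rule sets.sigma_sets_subset) (auto intro!: measurable_sets assms)

text \<open>In other words, the conditional characteristic function of the increment given the past
  is the constant Gaussian one. It is enough to test on cylinders, an intersection-stable generator
  of the filtration, where the multidimensional Fourier lemma reduces the claim to the
  characteristic functions already computed.\<close>

lemma (in prob_space) integral_increment_natural_filtration:
  fixes B :: "real \<Rightarrow> 'a \<Rightarrow> real^'d"
  assumes \<Lambda>: "positive_semidefinite \<Lambda>" and B: "brownian_motion M \<Lambda> B"
    and su: "0 \<le> s" "s \<le> u" and E: "E \<in> sets (natural_filtration M B s)"
  shows "(LINT x:E|M. iexp (a \<bullet> (B u x - B s x)) -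
    complex_of_real (exp (- ((a \<bullet> (\<Lambda> *v a)) * (u - s)) / 2))) = 0" (is "(LINT x:E|M. ?Y x) = 0")
proof -
  have B_meas: "B t \<in> borel_measurable M" if "0 \<le> t" for t
    using that by (rule brownian_motion_measurable[OF B])
  note [measurable] = B_meas[OF su(1)] B_meas[OF order.trans[OF su]]
  have Y: "integrable M ?Y"
    by (intro Bochner_Integration.integrable_diff integrable_const integrable_const_bound[where B = 1])
       auto
  \<comment> \<open>Indexing by pairs of a time and a direction makes every condition a scalar one,
    which is the form of the indicators in the Fourier lemma.\<close>
  define cyl where "cyl I A = {x \<in> space M. \<forall>p\<in>I. snd p \<bullet> B (fst p) x \<in> A p}"
    for I :: "(real \<times> (real^'d)) set" and A :: "real \<times> (real^'d) \<Rightarrow> real set"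
  define G where "G = {cyl I A |I A. finite I \<and> I \<subseteq> {0..s} \<times> UNIV \<and> (\<forall>p. A p \<in> sets borel)}"
  have G_I: "cyl I A \<in> G" if "finite I" "I \<subseteq> {0..s} \<times> UNIV" "\<forall>p. A p \<in> sets borel" for I A
    unfolding G_def by (intro CollectI exI[of _ I] exI[of _ A] conjI refl that)
  have cyl_sets: "cyl I A \<in> sets M"
    if "finite I" "I \<subseteq> {0..s} \<times> UNIV" "\<forall>p. A p \<in> sets borel" for I A
  proof -
    have "(\<lambda>x. snd p \<bullet> B (fst p) x) -` A p \<inter> space M \<in> sets M" if "p \<in> I" for p
    proof (rule measurable_sets)
      have [measurable]: "B (fst p) \<in> borel_measurable M"
        using that \<open>I \<subseteq> _\<close> by (intro B_meas) auto
      show "(\<lambda>x. snd p \<bullet> B (fst p) x) \<in> borel_measurable M" by measurable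
      show "A p \<in> sets borel" using \<open>\<forall>p. A p \<in> sets borel\<close> by blast
    qed
    then have "{x \<in> space M. snd p \<bullet> B (fst p) x \<in> A p} \<in> sets M" if "p \<in> I" for p
      using that by (simp add: vimage_def Int_def conj_commute)
    then show ?thesis unfolding cyl_def
      by (rule sets.sets_Collect_finite_All) (use that in auto)
  qed
  have "Int_stable G"
  proof (rule Int_stableI)
    fix a b assume "a \<in> G" "b \<in> G"
    then obtain I A I' A' where
      I: "a = cyl I A" "finite I" "I \<subseteq> {0..s} \<times> UNIV" "\<forall>p. A p \<in> sets borel" and
      I': "b = cyl I' A'" "finite I'" "I' \<subseteq> {0..s} \<times> UNIV" "\<forall>p. A' p \<in> sets borel"
      unfolding G_def by blast
    \<comment> \<open>Padding with \<open>UNIV\<close> the coordinates absent from one index set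
      lets cylinders over different index sets be intersected.\<close>
    define A'' where "A'' p = (if p \<in> I then A p else UNIV) \<inter> (if p \<in> I' then A' p else UNIV)" for p
    have "a \<inter> b = cyl (I \<union> I') A''"
      using I(1) I'(1) by (auto simp: cyl_def A''_def)
    moreover have "finite (I \<union> I')" "I \<union> I' \<subseteq> {0..s} \<times> UNIV" using I I' by auto
    moreover have "\<forall>p. A'' p \<in> sets borel"
      unfolding A''_def using I(4) I'(4) by (intro allI sets.Int) auto
    ultimately show "a \<inter> b \<in> G" by (metis G_I)
  qed
  moreover have G_sub: "G \<subseteq> sets M" unfolding G_def using cyl_sets by auto
  moreover note Y
  moreover have G0: "(LINT x:A|M. ?Y x) = 0" if "A \<in> G" for A
  proof -
    obtain I A' where I: "A = cyl I A'" "finite I" "I \<subseteq> {0..s} \<times> UNIV" "\<forall>p. A' p \<in> sets borel"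
      using \<open>A \<in> G\<close> unfolding G_def by blast
    obtain h where h: "bij_betw h {..<card I} I"
      using ex_bij_betw_nat_finite[OF I(2)] by (auto simp: lessThan_atLeast0)
    have hI: "h i \<in> I" if "i < card I" for i using h that by (auto simp: bij_betw_def)
    have "(\<integral>x. (\<Prod>p\<in>I. indicat_real (A' p) (snd p \<bullet> B (fst p) x)) *\<^sub>R ?Y x \<partial>M) = 0"
    proof (rule fourier_transform_eq_0_multi[OF I(2) Y])
      show "(\<lambda>x. snd p \<bullet> B (fst p) x) \<in> borel_measurable M" if "p \<in> I" for p
      proof -
        have [measurable]: "B (fst p) \<in> borel_measurable M"
          using that \<open>I \<subseteq> _\<close> by (intro B_meas) auto
        show ?thesis by measurable
      qed
      fix \<theta> :: "real \<times> (real^'d) \<Rightarrow> real"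
      \<comment> \<open>The frequency \<open>\<theta> p\<close> is absorbed into the direction and
        the index set is enumerated, which gives a linear combination at finitely many
        times.\<close>
      have "(\<Sum>p\<in>I. \<theta> p * (snd p \<bullet> B (fst p) x)) =
          (\<Sum>i<card I. (\<theta> (h i) *\<^sub>R snd (h i)) \<bullet> B (fst (h i)) x)" for x
        by (subst sum.reindex_bij_betw[OF h, symmetric]) simp
      then show "(\<integral>x. iexp (\<Sum>p\<in>I. \<theta> p * (snd p \<bullet> B (fst p) x)) * ?Y x \<partial>M) = 0"
        using hI I(3) by (simp only:) (rule brownian_motion_char_increment[OF \<Lambda> B _ su], force)
    qed (use I in auto)
    also have "(\<integral>x. (\<Prod>p\<in>I. indicat_real (A' p) (snd p \<bullet> B (fst p) x)) *\<^sub>R ?Y x \<partial>M) =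
        (LINT x:A|M. ?Y x)"
      unfolding set_lebesgue_integral_def
    proof (intro Bochner_Integration.integral_cong refl)
      fix x assume x: "x \<in> space M"
      have "(\<Prod>p\<in>I. indicat_real (A' p) (snd p \<bullet> B (fst p) x)) = indicator A x"
      proof (cases "x \<in> A")
        case True then show ?thesis by (simp add: I cyl_def)
      next
        case False
        then obtain p where "p \<in> I" "snd p \<bullet> B (fst p) x \<notin> A' p"
          using x by (auto simp: I cyl_def)
        then have "\<exists>p\<in>I. indicat_real (A' p) (snd p \<bullet> B (fst p) x) = 0" by (intro bexI[of _ p]) simp_all
          then have "(\<Prod>p\<in>I. indicat_real (A' p) (snd p \<bullet> B (fst p) x)) = 0" by (rule prod_zero[OF I(2)])
          then show ?thesis using False by simp
      qed
      then show "(\<Prod>p\<in>I. indicat_real (A' p) (snd p \<bullet> B (fst p) x)) *\<^sub>R ?Y x =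
          indicat_real A x *\<^sub>R ?Y x" by simp
    qed
    finally show ?thesis .
  qed
  moreover have "(LINT x|M. ?Y x) = 0"
  proof -
    have "space M = cyl {} (\<lambda>_. UNIV)" by (simp add: cyl_def)
    then have "space M \<in> G" using G_I[of "{}" "\<lambda>_. UNIV"] by (simp only:) simp
    from G0[OF this] show ?thesis by (simp only: set_integral_space[OF Y])
  qed
  moreover have "E \<in> sigma_sets (space M) G"
  proof -
    have G_pow: "G \<subseteq> Pow (space M)" using G_sub sets.space_closed by blast
    have B_G: "B r \<in> borel_measurable (sigma (space M) G)" if r: "0 \<le> r" "r \<le> s" for r
    proof (subst borel_measurable_euclidean_space, intro ballI measurableI)
      fix i :: "real^'d" and A :: "real set" assume "A \<in> sets borel"
      have "(\<lambda>x. B r x \<bullet> i) -` A \<inter> space M = cyl {(r, i)} (\<lambda>_. A)"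
        by (auto simp: cyl_def inner_commute)
      also have "\<dots> \<in> G" using r \<open>A \<in> sets borel\<close> by (intro G_I) auto
      finally show "(\<lambda>x. B r x \<bullet> i) -` A \<inter> space (sigma (space M) G) \<in> sets (sigma (space M) G)"
        using G_pow by (simp add: space_measure_of sets_measure_of)
    qed auto
    have "{B u -` A \<inter> space M |u A. 0 \<le> u \<and> u \<le> s \<and> A \<in> sets borel} \<subseteq> sigma_sets (space M) G"
    proof clarify
      fix u and A :: "(real^'d) set" assume "0 \<le> u" "u \<le> s" "A \<in> sets borel"
      then show "B u -` A \<inter> space M \<in> sigma_sets (space M) G"
        using measurable_sets[OF B_G, of u A] G_pow by (simp add: space_measure_of sets_measure_of)
    qed
    then have "sigma_sets (space M) {B u -` A \<inter> space M |u A. 0 \<le> u \<and> u \<le> s \<and> A \<in> sets borel} \<subseteq>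
        sigma_sets (space M) G"
      by (rule sigma_sets_mono)
    then show ?thesis using E unfolding sets_natural_filtration by blast
  qed
  ultimately show ?thesis by (rule set_integral_eq_0_sigma_sets)
qed

text \<open>The sets that agree almost everywhere with a member of \<open>G\<close> form a
  sigma-algebra. This allows the adjoined null sets to be discarded under an integral.\<close>

lemma sigma_sets_null_sets_AE_eq:
  assumes "A \<in> sigma_sets (space M) (sets G \<union> null_sets M)" "space G = space M"
  shows "\<exists>A'\<in>sets G. AE x in M. x \<in> A \<longleftrightarrow> x \<in> A'"
  using assms(1)
proof induction
  case (Basic a)
  then show ?case
  proof
    assume "a \<in> null_sets M"
    then have "AE x in M. x \<in> a \<longleftrightarrow> x \<in> {}" by (auto dest: AE_not_in)
    then show ?thesis by blast
  qed auto
next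
  case (Compl a)
  then obtain A' where A': "A' \<in> sets G" "AE x in M. x \<in> a \<longleftrightarrow> x \<in> A'" by blast
  have "AE x in M. x \<in> space M - a \<longleftrightarrow> x \<in> space M - A'" using A'(2) by eventually_elim auto
  moreover have "space M - A' \<in> sets G" using A'(1) assms(2) by (metis sets.compl_sets)
  ultimately show ?case by blast
next
  case (Union a)
  then obtain A' where A': "\<And>i. A' i \<in> sets G" "\<And>i. AE x in M. x \<in> a i \<longleftrightarrow> x \<in> A' i" by metis
  have "AE x in M. \<forall>i. x \<in> a i \<longleftrightarrow> x \<in> A' i" using A'(2) by (simp add: AE_all_countable)
  then have "AE x in M. x \<in> (\<Union>i. a i) \<longleftrightarrow> x \<in> (\<Union>i. A' i)" by eventually_elim auto
  then show ?case using A'(1) by blast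
qed auto

lemma sets_usual_augmentation:
  assumes "\<And>u. sets (G u) \<subseteq> sets P"
  shows "sets (usual_augmentation P G s) =
    (\<Inter>u\<in>{s<..}. sigma_sets (space P) (sets (G u) \<union> null_sets P))" (is "_ = ?I")
proof -
  define S where "S u = sigma_sets (space P) (sets (G u) \<union> null_sets P)" for u
  have pow: "sets (G u) \<union> null_sets P \<subseteq> Pow (space P)" for u
    using assms[of u] sets.space_closed[of P] by (auto simp: null_sets_def)
  have "S u \<subseteq> Pow (space P)" for u
    unfolding S_def using sigma_sets_into_sp[OF pow] by blast
  \<comment> \<open>A real above \<open>s\<close> has to be exhibited here, because an intersection
    over an empty index set would be the universe.\<close>
  then have "(\<Inter>u\<in>{s<..}. S u) \<subseteq> Pow (space P)"
    using gt_ex[of s] by blast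
  then have "sets (usual_augmentation P G s) = sigma_sets (space P) (\<Inter>u\<in>{s<..}. S u)"
    unfolding usual_augmentation_def S_def[symmetric] by (rule sets_measure_of)
  also have "\<dots> = (\<Inter>u\<in>{s<..}. S u)"
  proof
    show "sigma_sets (space P) (\<Inter>u\<in>{s<..}. S u) \<subseteq> (\<Inter>u\<in>{s<..}. S u)"
    proof (intro INT_greatest)
      fix u assume "u \<in> {s<..}"
      then show "sigma_sets (space P) (\<Inter>u\<in>{s<..}. S u) \<subseteq> S u"
        unfolding S_def by (intro sigma_sets_mono) auto
    qed
  qed (auto intro: sigma_sets.Basic)
  finally show ?thesis unfolding S_def .
qed

lemma usual_augmentation_natural_filtration_sets:
  assumes B: "brownian_motion M \<Lambda> B"
  shows "A \<in> sets (usual_augmentation M (natural_filtration M B) s) \<longleftrightarrow>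
    (\<forall>u>s. A \<in> sigma_sets (space M) (sets (natural_filtration M B u) \<union> null_sets M))"
  by (subst sets_usual_augmentation)
     (auto intro!: sets_natural_filtration_subset brownian_motion_measurable[OF B] dest: subsetD)

text \<open>Up to a null set, \<open>E\<close> belongs to the natural filtration at every
  \<open>r > s\<close>. The previous case therefore applies to the increment from \<open>r\<close>
  to \<open>u\<close>, and path continuity with dominated convergence lets \<open>r\<close> decrease
  to \<open>s\<close>.\<close>

lemma (in prob_space) integral_increment_augmented_filtration:
  fixes B :: "real \<Rightarrow> 'a \<Rightarrow> real^'d"
  assumes \<Lambda>: "positive_semidefinite \<Lambda>" and B: "brownian_motion M \<Lambda> B"
    and su: "0 \<le> s" "s \<le> u" and E: "E \<in> sets (usual_augmentation M (natural_filtration M B) s)"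
    and E_sets: "E \<in> events"
  shows "(LINT x:E|M. iexp (a \<bullet> (B u x - B s x)) -
    complex_of_real (exp (- ((a \<bullet> (\<Lambda> *v a)) * (u - s)) / 2))) = 0"
\<comment> \<open>For \<open>s = u\<close> there is no \<open>r\<close> with
  \<open>s < r \<le> u\<close>, but then the integrand is identically 0.\<close>
proof (cases "s = u")
  case True
  then show ?thesis by (simp add: set_lebesgue_integral_def)
next
  case False
  define Y where "Y r x = iexp (a \<bullet> (B u x - B r x)) -
    complex_of_real (exp (- ((a \<bullet> (\<Lambda> *v a)) * (u - r)) / 2))" for r x
  have B_meas: "0 \<le> t \<Longrightarrow> B t \<in> borel_measurable M" for t
    by (rule brownian_motion_measurable[OF B])
  have Y_meas: "Y r \<in> borel_measurable M" if "0 \<le> r" for r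
  proof -
    note [measurable] = B_meas[OF that] B_meas[OF order.trans[OF su]]
    show ?thesis unfolding Y_def by measurable
  qed
  have Y0: "(LINT x:E|M. Y r x) = 0" if r: "s < r" "r \<le> u" for r
  proof -
    have "E \<in> sigma_sets (space M) (sets (natural_filtration M B r) \<union> null_sets M)"
      using E r by (simp add: usual_augmentation_natural_filtration_sets[OF B])
    then have "\<exists>A'\<in>sets (natural_filtration M B r). AE x in M. x \<in> E \<longleftrightarrow> x \<in> A'"
      by (rule sigma_sets_null_sets_AE_eq) (simp add: natural_filtration_def space_measure_of_conv)
    then obtain A' where A': "A' \<in> sets (natural_filtration M B r)" "AE x in M. x \<in> E \<longleftrightarrow> x \<in> A'"
      by blast
    have [measurable]: "A' \<in> events" "Y r \<in> borel_measurable M"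
      using A'(1) sets_natural_filtration_subset[of B M r] B_meas Y_meas r su by auto
    note [measurable] = E_sets
    have "(LINT x:E|M. Y r x) = (LINT x:A'|M. Y r x)"
      unfolding set_lebesgue_integral_def
      by (rule integral_cong_AE) (use A'(2) in \<open>auto elim!: eventually_mono simp: indicator_def\<close>)
    also have "\<dots> = 0"
      unfolding Y_def using r su by (intro integral_increment_natural_filtration[OF \<Lambda> B _ _ A'(1)]) auto
    finally show ?thesis .
  qed
  define r where "r n = s + (u - s) / real (Suc n)" for n
  have r: "s < r n" "r n \<le> u" for n
  proof -
    show "s < r n" using False su by (simp add: r_def)
    have "(u - s) / real (Suc n) \<le> (u - s) / 1"
      using su by (intro divide_left_mono) auto
    then show "r n \<le> u" by (simp add: r_def)
  qed
  have r_lim: "r \<longlonglongrightarrow> s"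
    unfolding r_def
    using tendsto_add[OF tendsto_const LIMSEQ_Suc[OF lim_const_over_n], of s "u - s"] by simp
  have lim: "(\<lambda>n. Y (r n) x) \<longlonglongrightarrow> Y s x" if "x \<in> space M" for x
  proof -
    have "continuous_on {0..} (\<lambda>t. B t x)"
      using B that by (simp add: brownian_motion_def)
    moreover have "r n \<in> {0..}" for n using r(1)[of n] su by simp
    ultimately have "(\<lambda>n. B (r n) x) \<longlonglongrightarrow> B s x"
      using su by (intro continuous_on_tendsto_compose[OF _ r_lim]) auto
    then show ?thesis unfolding Y_def by (intro tendsto_intros r_lim) simp_all
  qed
  have "(\<lambda>n. LINT x:E|M. Y (r n) x) \<longlonglongrightarrow> (LINT x:E|M. Y s x)"
    unfolding set_lebesgue_integral_def
  proof (rule integral_dominated_convergence[where w = "\<lambda>_. 2"])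
    note [measurable] = E_sets Y_meas[OF su(1)]
    show "(\<lambda>x. indicat_real E x *\<^sub>R Y s x) \<in> borel_measurable M" by measurable
    show "(\<lambda>x. indicat_real E x *\<^sub>R Y (r n) x) \<in> borel_measurable M" for n
    proof -
      have [measurable]: "Y (r n) \<in> borel_measurable M" using r(1)[of n] su by (intro Y_meas) simp
      show ?thesis by measurable
    qed
    show "AE x in M. norm (indicat_real E x *\<^sub>R Y (r n) x) \<le> 2" for n
    proof (rule AE_I2)
      fix x
      have "norm (Y (r n) x) \<le> norm (iexp (a \<bullet> (B u x - B (r n) x))) +
          norm (complex_of_real (exp (- ((a \<bullet> (\<Lambda> *v a)) * (u - r n)) / 2)))"
        unfolding Y_def by (rule norm_triangle_ineq4)
      also have "\<dots> \<le> 1 + 1"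
        using \<Lambda> r(2)[of n] by (intro add_mono) (auto simp: positive_semidefinite_def)
      finally show "norm (indicat_real E x *\<^sub>R Y (r n) x) \<le> 2"
        by (auto simp: indicator_def)
    qed
  qed (auto intro!: AE_I2 tendsto_scaleR lim)
  then have "(LINT x:E|M. Y s x) = 0"
    using Y0[OF r] by (simp add: LIMSEQ_const_iff)
  then show ?thesis unfolding Y_def .
qed

lemma (in prob_space) brownian_motion_filtered:
  fixes B :: "real \<Rightarrow> 'a \<Rightarrow> real^'d"
  assumes \<Lambda>: "positive_semidefinite \<Lambda>" and B: "brownian_motion M \<Lambda> B"
  shows "filtered_brownian_motion M (usual_augmentation M (natural_filtration M B)) \<Lambda> B"
proof -
  define F where "F = usual_augmentation M (natural_filtration M B)"
  note F_sets = usual_augmentation_natural_filtration_sets[OF B, folded F_def]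
  have B_meas: "0 \<le> t \<Longrightarrow> B t \<in> borel_measurable M" for t
    by (rule brownian_motion_measurable[OF B])
  have space_F: "space (F s) = space M" for s
    by (simp add: F_def usual_augmentation_def space_measure_of_conv)
  have sets_F: "A \<in> events" if "A \<in> sets (F s)" for A s
  proof -
    have "A \<in> sigma_sets (space M) (sets (natural_filtration M B (s + 1)) \<union> null_sets M)"
      using that unfolding F_sets by simp
    moreover have "sets (natural_filtration M B (s + 1)) \<union> null_sets M \<subseteq> events"
      using sets_natural_filtration_subset[of B M "s + 1"] B_meas by auto
    ultimately show ?thesis using sets.sigma_sets_subset by blast
  qed
  have adapted: "B s \<in> borel_measurable (F s)" if "0 \<le> s" for s
  proof (rule measurableI)
    fix A :: "(real^'d) set" assume A: "A \<in> sets borel"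
    have "B s -` A \<inter> space M \<in> sets (natural_filtration M B u)" if "s < u" for u
      unfolding sets_natural_filtration using A that \<open>0 \<le> s\<close> by (intro sigma_sets.Basic) force
    then show "B s -` A \<inter> space (F s) \<in> sets (F s)" unfolding F_sets space_F by auto
  qed simp
  have distr: "distr M borel (\<lambda>x. a \<bullet> (B u x - B s x)) = normal_law 0 ((a \<bullet> (\<Lambda> *v a)) * (u - s))"
    if "0 \<le> s" "s \<le> u" for a s u
  proof -
    have m: "(\<Lambda> *v (- x)) = - (\<Lambda> *v x)" for x
      using matrix_vector_mult_scaleR[of \<Lambda> "-1" x] by simp
    have "distr M borel (\<lambda>x. \<Sum>i<2::nat. (if i = 0 then - a else a) \<bullet> B (if i = 0 then s else u) x) =
      normal_law 0 (\<Sum>i<2::nat. \<Sum>j<2::nat. ((if i = 0 then - a else a) \<bullet> (\<Lambda> *v (if j = 0 then - a else a))) *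
         min (if i = 0 then s else u) (if j = 0 then s else u))"
      by (rule brownian_motion_linear_combination[OF B]) (use that in auto)
    then show ?thesis
      using that by (simp add: numeral_2_eq_2 m inner_diff_right algebra_simps)
  qed
  have indep: "prob (A \<inter> {x \<in> space M. a \<bullet> (B u x - B s x) \<in> C}) =
      prob A * prob {x \<in> space M. a \<bullet> (B u x - B s x) \<in> C}"
    if su: "0 \<le> s" "s \<le> u" and A: "A \<in> sets (F s)" and C: "C \<in> sets borel" for a s u A C
  proof -
    note [measurable] = B_meas[OF su(1)] B_meas[OF order.trans[OF su]] sets_F[OF A] C
    define W where "W x = a \<bullet> (B u x - B s x)" for x
    have [measurable]: "W \<in> borel_measurable M" unfolding W_def by measurable
    \<comment> \<open>Scaling the direction \<open>a\<close> by \<open>\<theta>\<close> reaches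
      every frequency of the scalar variable \<open>W\<close>.\<close>
    have key: "(\<integral>x. iexp (\<theta> * W x) * complex_of_real (indicator E x) \<partial>M) =
        exp (- (((\<theta> *\<^sub>R a) \<bullet> (\<Lambda> *v (\<theta> *\<^sub>R a))) * (u - s)) / 2) * complex_of_real (prob E)"
      if E: "E \<in> sets (F s)" for E \<theta>
    proof -
      have [measurable]: "E \<in> events" by (rule sets_F[OF E])
      define c where "c = complex_of_real (exp (- (((\<theta> *\<^sub>R a) \<bullet> (\<Lambda> *v (\<theta> *\<^sub>R a))) * (u - s)) / 2))"
      have "(LINT x:E|M. iexp ((\<theta> *\<^sub>R a) \<bullet> (B u x - B s x)) - c) = 0"
        unfolding c_def
        by (rule integral_increment_augmented_filtration[OF \<Lambda> B su E[unfolded F_def] sets_F[OF E]])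
      also have "(LINT x:E|M. iexp ((\<theta> *\<^sub>R a) \<bullet> (B u x - B s x)) - c) =
          (\<integral>x. iexp (\<theta> * W x) * complex_of_real (indicator E x) - c * complex_of_real (indicator E x) \<partial>M)"
        unfolding set_lebesgue_integral_def W_def
        by (intro Bochner_Integration.integral_cong refl) (simp split: split_indicator)
      also have "\<dots> = (\<integral>x. iexp (\<theta> * W x) * complex_of_real (indicator E x) \<partial>M) -
          (\<integral>x. c * complex_of_real (indicator E x) \<partial>M)"
        by (intro Bochner_Integration.integral_diff integrable_iexp_mult integrable_mult_right
              integrable_of_real integrable_real_indicator) (auto simp: emeasure_eq_measure)
      finally show ?thesis unfolding c_def by (simp add: integral_mult_right_zero)
    qed
    \<comment> \<open>By \<open>key\<close>, the transforms over \<open>A\<close> and over the whole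
      space carry the same Gaussian factor, so the centred indicator of \<open>A\<close> has
      transform 0 along \<open>W\<close>; the Fourier lemma then gives independence of
      \<open>A\<close> and \<open>W\<close>.\<close>
    have "(\<integral>x. indicator C (W x) * (indicator A x - prob A) \<partial>M) = 0"
    proof (rule fourier_transform_eq_0_real)
      show "integrable M (\<lambda>x. indicator A x - prob A)"
        by (intro Bochner_Integration.integrable_diff integrable_const integrable_const_bound[where B = 1]) auto
      fix \<theta>
      have sp: "space M \<in> sets (F s)" using sets.top[of "F s"] by (simp add: space_F)
      have i: "integrable M (\<lambda>x. iexp (\<theta> * W x) * complex_of_real (indicator A x))"
        "integrable M (\<lambda>x. iexp (\<theta> * W x) * complex_of_real (indicator (space M) x) * complex_of_real (prob A))"
        by (rule integrable_const_bound[where B = 1]; simp add: norm_mult indicator_def)+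
      have "(\<integral>x. iexp (\<theta> * W x) * complex_of_real (indicator A x - prob A) \<partial>M) =
         (\<integral>x. iexp (\<theta> * W x) * complex_of_real (indicator A x) -
            iexp (\<theta> * W x) * complex_of_real (indicator (space M) x) * complex_of_real (prob A) \<partial>M)"
        by (intro Bochner_Integration.integral_cong refl) (simp add: algebra_simps)
      also have "\<dots> = 0"
        unfolding Bochner_Integration.integral_diff[OF i] integral_mult_left_zero key[OF A] key[OF sp]
        by (simp add: prob_space)
      finally show "(\<integral>x. iexp (\<theta> * W x) * complex_of_real (indicator A x - prob A) \<partial>M) = 0" .
    qed measurable
    also have "(\<integral>x. indicator C (W x) * (indicator A x - prob A) \<partial>M) =
        (\<integral>x. indicator (A \<inter> {x \<in> space M. W x \<in> C}) x -
          prob A * indicator {x \<in> space M. W x \<in> C} x \<partial>M)"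
      by (intro Bochner_Integration.integral_cong refl) (auto simp: indicator_def)
    also have "\<dots> = prob (A \<inter> {x \<in> space M. W x \<in> C}) - prob A * prob {x \<in> space M. W x \<in> C}"
      by (subst Bochner_Integration.integral_diff)
         (auto intro!: integrable_real_indicator simp: emeasure_eq_measure)
    finally show ?thesis unfolding W_def by simp
  qed
  show ?thesis
    unfolding F_def[symmetric]
  proof
    show "sets (F s) \<subseteq> sets (F u)" if "s \<le> u" for s u
      using that by (auto simp: F_sets)
    show "continuous_on {0..} (\<lambda>s. B s x)" if "x \<in> space M" for x
      using B that by (simp add: brownian_motion_def)
  qed (use space_F sets_F adapted distr indep \<Lambda> in auto)
qed

section \<open>Orthogonality of weighted increments\<close>

lemma normal_law_moments:
  assumes "0 \<le> v"
  shows "integrable (normal_law 0 v) (\<lambda>x. x ^ k)"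
    and "(\<integral>x. x \<partial>normal_law 0 v) = 0"
    and "(\<integral>x. x\<^sup>2 \<partial>normal_law 0 v) = v"
    and "(\<integral>x. x ^ 4 \<partial>normal_law 0 v) = 3 * v\<^sup>2"
proof -
  have "integrable (normal_law 0 v) (\<lambda>x. x ^ k) \<and> (\<integral>x. x \<partial>normal_law 0 v) = 0 \<and>
    (\<integral>x. x\<^sup>2 \<partial>normal_law 0 v) = v \<and> (\<integral>x. x ^ 4 \<partial>normal_law 0 v) = 3 * v\<^sup>2"
  proof (cases "v = 0")
    case True
    then show ?thesis
      by (auto simp: normal_law_def integral_return intro!: integrableI_bounded)
         (simp add: nn_integral_return)
  next
    case False
    define \<sigma> where "\<sigma> = sqrt v"
    have \<sigma>: "\<sigma> > 0" "v = \<sigma>\<^sup>2" using False assms by (auto simp: \<sigma>_def)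
    have law: "normal_law 0 v = density lborel (normal_density 0 \<sigma>)"
      using False assms by (simp add: normal_law_def \<sigma>_def)
    have "integrable (normal_law 0 v) (\<lambda>x. x ^ k)"
      unfolding law by (subst integrable_density) (auto simp: integrable_normal_moment[OF \<sigma>(1), of 0, simplified])
    moreover have "(\<integral>x. x \<partial>normal_law 0 v) = 0"
      unfolding law using integral_normal_moment_odd[OF \<sigma>(1), of 0 0] by (subst integral_density) auto
    moreover have "(\<integral>x. x\<^sup>2 \<partial>normal_law 0 v) = v"
      unfolding law using integral_normal_moment_even[OF \<sigma>(1), of 0 1] \<sigma>
      by (subst integral_density) auto
    moreover have "(\<integral>x. x ^ 4 \<partial>normal_law 0 v) = 3 * v\<^sup>2"
      unfolding law using integral_normal_moment_even[OF \<sigma>(1), of 0 2] \<sigma>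
      by (subst integral_density) (auto simp: field_simps fact_numeral)
    ultimately show ?thesis by blast
  qed
  then show "integrable (normal_law 0 v) (\<lambda>x. x ^ k)" "(\<integral>x. x \<partial>normal_law 0 v) = 0"
    "(\<integral>x. x\<^sup>2 \<partial>normal_law 0 v) = v" "(\<integral>x. x ^ 4 \<partial>normal_law 0 v) = 3 * v\<^sup>2"
    by blast+
qed

lemma (in prob_space) expectation_square_bounded:
  fixes Y :: "'a \<Rightarrow> real"
  assumes [measurable]: "Y \<in> borel_measurable M" and C: "\<And>x. x \<in> space M \<Longrightarrow> \<bar>Y x\<bar> \<le> C"
  shows "integrable M (\<lambda>x. (Y x)\<^sup>2)" "expectation (\<lambda>x. (Y x)\<^sup>2) \<le> C\<^sup>2"
proof -
  have le: "(Y x)\<^sup>2 \<le> C\<^sup>2" if "x \<in> space M" for x using power_mono[OF C[OF that], of 2] by simp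
  then show i: "integrable M (\<lambda>x. (Y x)\<^sup>2)" by (intro integrable_const_bound[where B = "C\<^sup>2"]) auto
  have "expectation (\<lambda>x. (Y x)\<^sup>2) \<le> expectation (\<lambda>x. C\<^sup>2)" by (intro integral_mono i le) auto
  then show "expectation (\<lambda>x. (Y x)\<^sup>2) \<le> C\<^sup>2" by (simp add: prob_space)
qed

context filtered_brownian_motion
begin

lemma measurable_F_mono: "f \<in> measurable (\<F> s) N \<Longrightarrow> s \<le> u \<Longrightarrow> f \<in> measurable (\<F> u) N"
  using F_mono[of s u] by (auto simp: measurable_def)

lemma measurable_F: "f \<in> measurable (\<F> s) N \<Longrightarrow> f \<in> measurable M N"
  using sets_F[of s] by (auto simp: measurable_def)

lemma B_measurable: "0 \<le> s \<Longrightarrow> B s \<in> borel_measurable M"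
  using adapted measurable_F by blast

lemma variance_nonneg: "0 \<le> a \<bullet> (\<Lambda> *v a)"
  using psd by (simp add: positive_semidefinite_def)

lemma increment_moments:
  fixes a :: "real^'d"
  assumes su: "0 \<le> s" "s \<le> u"
  defines "W \<equiv> \<lambda>x. a \<bullet> (B u x - B s x)" and "v \<equiv> (a \<bullet> (\<Lambda> *v a)) * (u - s)"
  shows "integrable M (\<lambda>x. W x ^ k)" and "expectation W = 0"
    and "expectation (\<lambda>x. (W x)\<^sup>2) = v" and "expectation (\<lambda>x. W x ^ 4) = 3 * v\<^sup>2"
proof -
  note [measurable] = B_measurable[OF su(1)] B_measurable[OF order.trans[OF su]]
  have [measurable]: "W \<in> borel_measurable M" unfolding W_def by measurable
  have v: "0 \<le> v" using su variance_nonneg[of a] by (simp add: v_def)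
  have d: "normal_law 0 v = distr M borel W"
    using increment_distr[OF su, of a] by (simp add: W_def v_def)
  note m = normal_law_moments[OF v, unfolded d]
  show "integrable M (\<lambda>x. W x ^ k)" using m(1)[of k] by (simp add: integrable_distr_eq)
  show "expectation W = 0" "expectation (\<lambda>x. (W x)\<^sup>2) = v" "expectation (\<lambda>x. W x ^ 4) = 3 * v\<^sup>2"
    using m(2-4) by (simp_all add: integral_distr)
qed

lemma expectation_mult_increment:
  fixes h :: "real \<Rightarrow> real" and a :: "real^'d"
  assumes su: "0 \<le> s" "s \<le> u" and Y: "Y \<in> borel_measurable (\<F> s)" "integrable M Y"
    and h: "h \<in> borel_measurable borel" "integrable M (\<lambda>x. h (a \<bullet> (B u x - B s x)))"
  shows "integrable M (\<lambda>x. Y x * h (a \<bullet> (B u x - B s x)))"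
    and "expectation (\<lambda>x. Y x * h (a \<bullet> (B u x - B s x))) =
      expectation Y * expectation (\<lambda>x. h (a \<bullet> (B u x - B s x)))"
proof -
  define W where "W x = a \<bullet> (B u x - B s x)" for x
  note [measurable] = B_measurable[OF su(1)] B_measurable[OF order.trans[OF su]] h(1)
  have W [measurable]: "W \<in> borel_measurable M" unfolding W_def by measurable
  \<comment> \<open>The preimages under \<open>W\<close> already form a sigma-algebra, so the
    product rule for single events is independence of two sigma-algebras and passes on to functions
    of \<open>W\<close>.\<close>
  define GW where "GW = {W -` C \<inter> space M |C. C \<in> sets borel}"
  have "indep_set (sets (\<F> s)) GW"
    unfolding indep_sets2_eq
  proof (intro conjI ballI)
    show "sets (\<F> s) \<subseteq> events" by (rule sets_F)
    show "GW \<subseteq> events" by (auto simp: GW_def)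
    fix A b assume A: "A \<in> sets (\<F> s)" and "b \<in> GW"
    then obtain C where "b = {x \<in> space M. W x \<in> C}" "C \<in> sets borel"
      by (auto simp: GW_def)
    then show "prob (A \<inter> b) = prob A * prob b"
      using increment_indep[OF su A, of C a] by (simp add: W_def)
  qed
  moreover have "sigma_sets (space M) {Y -` A \<inter> space M |A. A \<in> sets borel} \<subseteq> sets (\<F> s)"
    using measurable_sets[OF Y(1)] by (intro sets.sigma_sets_subset[of _ "\<F> s", unfolded space_F]) auto
  moreover have "sigma_sets (space M) {(\<lambda>x. h (W x)) -` A \<inter> space M |A. A \<in> sets borel} \<subseteq> GW"
  proof -
    have GW: "GW = sets (vimage_algebra (space M) W borel)"
      unfolding GW_def by (subst sets_vimage_algebra2) auto
    have "(\<lambda>x. h (W x)) -` A \<inter> space M \<in> GW" if "A \<in> sets borel" for A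
    proof -
      have "(\<lambda>x. h (W x)) -` A \<inter> space M = W -` (h -` A \<inter> space borel) \<inter> space M" by auto
      then show ?thesis using measurable_sets[OF h(1) that] unfolding GW_def by blast
    qed
    then show ?thesis
      unfolding GW
      by (intro sets.sigma_sets_subset[of _ "vimage_algebra (space M) W borel", unfolded space_vimage_algebra])
         auto
  qed
  ultimately have "indep_set (sigma_sets (space M) {Y -` A \<inter> space M |A. A \<in> sets borel})
      (sigma_sets (space M) {(\<lambda>x. h (W x)) -` A \<inter> space M |A. A \<in> sets borel})"
    unfolding indep_sets2_eq by blast
  then have "indep_var borel Y borel (\<lambda>x. h (W x))"
    unfolding indep_var_eq using measurable_F[OF Y(1)] by simp
  from indep_var_integrable[OF this Y(2)] indep_var_lebesgue_integral[OF this Y(2)] h(2)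
  show "integrable M (\<lambda>x. Y x * h (a \<bullet> (B u x - B s x)))"
    "expectation (\<lambda>x. Y x * h (a \<bullet> (B u x - B s x))) =
      expectation Y * expectation (\<lambda>x. h (a \<bullet> (B u x - B s x)))"
    by (simp_all add: W_def)
qed

text \<open>Two uses are covered: \<open>h k x = x\<close> gives the isometry for simple integrands,
  and \<open>h k x = x\<^sup>2 - v\<close> gives the fluctuations of quadratic variation. Only the
  second moment of \<open>D k\<close> is assumed, with bounded weights \<open>Y k\<close>.
  Measurability of the partial sum and nonnegativity of the last time are part of the conclusion
  because the next induction step relies on them.\<close>

lemma orthogonal_sum:
  fixes h :: "nat \<Rightarrow> real \<Rightarrow> real" and a :: "real^'d" and Y :: "nat \<Rightarrow> 'a \<Rightarrow> real"
    and \<tau> :: "nat \<Rightarrow> real"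
  defines "D \<equiv> \<lambda>k x. h k (a \<bullet> (B (\<tau> (Suc k)) x - B (\<tau> k) x))"
  assumes "0 \<le> \<tau> 0" and "\<And>k. k < n \<Longrightarrow> \<tau> k \<le> \<tau> (Suc k)"
    and "\<And>k. k < n \<Longrightarrow> Y k \<in> borel_measurable (\<F> (\<tau> k))"
    and "\<And>k x. k < n \<Longrightarrow> x \<in> space M \<Longrightarrow> \<bar>Y k x\<bar> \<le> C k"
    and "\<And>k. h k \<in> borel_measurable borel"
    and "\<And>k. k < n \<Longrightarrow> integrable M (\<lambda>x. (D k x)\<^sup>2)"
    and "\<And>k. k < n \<Longrightarrow> expectation (D k) = 0"
  shows "(\<lambda>x. \<Sum>k<n. Y k x * D k x) \<in> borel_measurable (\<F> (\<tau> n)) \<and>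
    integrable M (\<lambda>x. (\<Sum>k<n. Y k x * D k x)\<^sup>2) \<and>
    expectation (\<lambda>x. (\<Sum>k<n. Y k x * D k x)\<^sup>2) =
      (\<Sum>k<n. expectation (\<lambda>x. (Y k x)\<^sup>2) * expectation (\<lambda>x. (D k x)\<^sup>2)) \<and> 0 \<le> \<tau> n"
  using assms(2-)
proof (induction n)
  case 0
  then show ?case by simp
next
  case (Suc n)
  define S where "S x = (\<Sum>k<n. Y k x * D k x)" for x
  have IH: "S \<in> borel_measurable (\<F> (\<tau> n))" "integrable M (\<lambda>x. (S x)\<^sup>2)"
    "expectation (\<lambda>x. (S x)\<^sup>2) =
      (\<Sum>k<n. expectation (\<lambda>x. (Y k x)\<^sup>2) * expectation (\<lambda>x. (D k x)\<^sup>2))" "0 \<le> \<tau> n"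
    using Suc unfolding S_def by auto
  have le: "\<tau> n \<le> \<tau> (Suc n)" using Suc.prems by simp
  have pos: "0 \<le> \<tau> (Suc n)" using IH(4) le by simp
  have Y: "Y n \<in> borel_measurable (\<F> (\<tau> n))" using Suc.prems by simp
  have D_meas: "D n \<in> borel_measurable (\<F> (\<tau> (Suc n)))"
  proof -
    note [measurable] = adapted[OF pos] measurable_F_mono[OF adapted[OF IH(4)] le] Suc.prems(5)
    show ?thesis unfolding D_def by measurable
  qed
  note meas_M [measurable] = measurable_F[OF D_meas] measurable_F[OF Y] measurable_F[OF IH(1)]
  have Y_bound: "\<bar>Y n x\<bar> \<le> C n" if "x \<in> space M" for x using Suc.prems(4) that by simp
  have int_D2: "integrable M (\<lambda>x. (D n x)\<^sup>2)" and D_0: "expectation (D n) = 0"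
    using Suc.prems by auto
  have int_D: "integrable M (D n)" by (rule square_integrable_imp_integrable[OF _ int_D2]) simp
  have int_S: "integrable M S" by (rule square_integrable_imp_integrable[OF _ IH(2)]) simp
  have int_SY: "integrable M (\<lambda>x. S x * Y n x)"
  proof (rule Bochner_Integration.integrable_bound)
    show "integrable M (\<lambda>x. C n * S x)" using int_S by simp
    show "AE x in M. norm (S x * Y n x) \<le> norm (C n * S x)"
    proof (rule AE_I2)
      fix x assume "x \<in> space M"
      from Y_bound[OF this] have "\<bar>Y n x\<bar> \<le> \<bar>C n\<bar>" by simp
      then show "norm (S x * Y n x) \<le> norm (C n * S x)"
        by (simp add: abs_mult mult.commute[of "\<bar>S x\<bar>"] mult_right_mono)
    qed
  qed simp
  have int_Y2: "integrable M (\<lambda>x. (Y n x)\<^sup>2)"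
    using Y_bound by (rule expectation_square_bounded(1)[OF measurable_F[OF Y]])
  \<comment> \<open>The cross term vanishes: the earlier sum times the new weight is known at time
    \<open>\<tau> n\<close>, and the new increment term is independent of that past and
    centred.\<close>
  have SYD: "integrable M (\<lambda>x. S x * Y n x * D n x)" "expectation (\<lambda>x. S x * Y n x * D n x) = 0"
  proof -
    have SY: "(\<lambda>x. S x * Y n x) \<in> borel_measurable (\<F> (\<tau> n))" using IH(1) Y by measurable
    note * = expectation_mult_increment[OF IH(4) le SY int_SY Suc.prems(5) int_D[unfolded D_def]]
    show "integrable M (\<lambda>x. S x * Y n x * D n x)" "expectation (\<lambda>x. S x * Y n x * D n x) = 0"
      using * D_0 by (simp_all add: D_def)
  qed
  have Y2D2: "integrable M (\<lambda>x. (Y n x)\<^sup>2 * (D n x)\<^sup>2)"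
    "expectation (\<lambda>x. (Y n x)\<^sup>2 * (D n x)\<^sup>2) = expectation (\<lambda>x. (Y n x)\<^sup>2) * expectation (\<lambda>x. (D n x)\<^sup>2)"
  proof -
    have Y2: "(\<lambda>x. (Y n x)\<^sup>2) \<in> borel_measurable (\<F> (\<tau> n))" using Y by measurable
    have h2: "(\<lambda>x. (h n x)\<^sup>2) \<in> borel_measurable borel" using Suc.prems(5)[of n] by measurable
    note * = expectation_mult_increment[OF IH(4) le Y2 int_Y2 h2 int_D2[unfolded D_def]]
    show "integrable M (\<lambda>x. (Y n x)\<^sup>2 * (D n x)\<^sup>2)"
      "expectation (\<lambda>x. (Y n x)\<^sup>2 * (D n x)\<^sup>2) = expectation (\<lambda>x. (Y n x)\<^sup>2) * expectation (\<lambda>x. (D n x)\<^sup>2)"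
      using * by (simp_all add: D_def)
  qed
  have eq: "(\<Sum>k<Suc n. Y k x * D k x)\<^sup>2 = (S x)\<^sup>2 + (2 * (S x * Y n x * D n x) + (Y n x)\<^sup>2 * (D n x)\<^sup>2)" for x
    by (simp add: S_def power2_eq_square algebra_simps)
  have "(\<lambda>x. S x + Y n x * D n x) \<in> borel_measurable (\<F> (\<tau> (Suc n)))"
    using measurable_F_mono[OF IH(1) le] measurable_F_mono[OF Y le] D_meas by measurable
  moreover have "integrable M (\<lambda>x. (S x)\<^sup>2 + (2 * (S x * Y n x * D n x) + (Y n x)\<^sup>2 * (D n x)\<^sup>2))"
    using IH(2) SYD(1) Y2D2(1) by simp
  moreover have "expectation (\<lambda>x. (S x)\<^sup>2 + (2 * (S x * Y n x * D n x) + (Y n x)\<^sup>2 * (D n x)\<^sup>2)) =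
      expectation (\<lambda>x. (S x)\<^sup>2) + expectation (\<lambda>x. (Y n x)\<^sup>2) * expectation (\<lambda>x. (D n x)\<^sup>2)"
    using IH(2) SYD Y2D2 by simp
  ultimately show ?case unfolding eq using IH(3) pos by (simp add: S_def)
qed

text \<open>Setting \<open>v\<^sub>k\<close> to 0 once \<open>\<Sum>i\<le>k. v\<^sub>i\<^sup>2 (\<tau>\<^sub>i\<^sub>+\<^sub>1 - \<tau>\<^sub>i)\<close> exceeds \<open>\<delta>\<close> keeps \<open>v\<^sub>k\<close> measurable at time \<open>\<tau>\<^sub>k\<close>
  and changes nothing unless the full sum exceeds \<open>\<delta>\<close>.\<close>

lemma simple_integral_prob_bound:
  fixes a :: "real^'d"
  assumes \<tau>: "0 \<le> \<tau> 0" "\<And>k. k < n \<Longrightarrow> \<tau> k \<le> \<tau> (Suc k)"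
    and v: "\<And>k. k < n \<Longrightarrow> v k \<in> borel_measurable (\<F> (\<tau> k))"
    and C: "\<And>k x. k < n \<Longrightarrow> x \<in> space M \<Longrightarrow> \<bar>v k x\<bar> \<le> C k"
    and pos: "0 < \<epsilon>" "0 < \<delta>"
  shows "prob {x \<in> space M. \<epsilon> < \<bar>\<Sum>k<n. v k x * (a \<bullet> (B (\<tau> (Suc k)) x - B (\<tau> k) x))\<bar>} \<le>
    (a \<bullet> (\<Lambda> *v a)) * \<delta> / \<epsilon>\<^sup>2 +
    prob {x \<in> space M. \<delta> < (\<Sum>k<n. (v k x)\<^sup>2 * (\<tau> (Suc k) - \<tau> k))}"
proof -
  define q where "q = a \<bullet> (\<Lambda> *v a)"
  have q: "0 \<le> q" unfolding q_def by (rule variance_nonneg)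
  define A where "A m x = (\<Sum>k<m. (v k x)\<^sup>2 * (\<tau> (Suc k) - \<tau> k))" for m x
  define w where "w k x = (if A (Suc k) x \<le> \<delta> then v k x else 0)" for k x
  define S where "S x = (\<Sum>k<n. w k x * (a \<bullet> (B (\<tau> (Suc k)) x - B (\<tau> k) x)))" for x
  have \<tau>_mono: "\<tau> i \<le> \<tau> j" if "i \<le> j" "j \<le> n" for i j
    using that(1,2)
  proof (induction j rule: dec_induct)
    case (step m)
    then show ?case using \<tau>(2)[of m] by simp
  qed simp
  have \<tau>0: "0 \<le> \<tau> k" if "k \<le> n" for k using \<tau>_mono[of 0 k] \<tau>(1) that by simp
  \<comment> \<open>Only \<open>v 0, ..., v k\<close> enter, and the lengths of the intervals are
    deterministic; so the stopping decision for step \<open>k\<close> is known at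
    \<open>\<tau> k\<close>, before its increment starts.\<close>
  have A_meas: "A m \<in> borel_measurable (\<F> (\<tau> k))" if "m \<le> Suc k" "k < n" for m k
  proof -
    have [measurable]: "v i \<in> borel_measurable (\<F> (\<tau> k))" if "i \<in> {..<m}" for i
      using that \<open>m \<le> Suc k\<close> \<open>k < n\<close> by (intro measurable_F_mono[OF v] \<tau>_mono) auto
    show ?thesis unfolding A_def by measurable
  qed
  have w_meas: "w k \<in> borel_measurable (\<F> (\<tau> k))" if "k < n" for k
  proof -
    note [measurable] = v[OF that] A_meas[OF order.refl that]
    show ?thesis unfolding w_def by measurable
  qed
  have w_bound: "\<bar>w k x\<bar> \<le> C k" if "k < n" "x \<in> space M" for k x
    using C[OF that] by (auto simp: w_def)
  have A_mono: "A i x \<le> A n x" if "i \<le> n" for i x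
    unfolding A_def using that \<tau>(2) by (intro sum_mono2) auto
  \<comment> \<open>Either the newest term is switched off and the previous bound persists, or the
    untruncated sum is still at most \<open>\<delta>\<close> and dominates the truncated
    one.\<close>
  have w_sum: "(\<Sum>k<m. (w k x)\<^sup>2 * (\<tau> (Suc k) - \<tau> k)) \<le> \<delta>" if "m \<le> n" for m x
    using that
  proof (induction m)
    case 0
    then show ?case using pos by simp
  next
    case (Suc m)
    show ?case
    proof (cases "A (Suc m) x \<le> \<delta>")
      case True
      have "(\<Sum>k<Suc m. (w k x)\<^sup>2 * (\<tau> (Suc k) - \<tau> k)) \<le> A (Suc m) x"
        unfolding A_def using Suc.prems \<tau>(2) by (intro sum_mono mult_right_mono) (auto simp: w_def)
      then show ?thesis using True by simp
    next
      case False
      then show ?thesis using Suc by (simp add: w_def)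
    qed
  qed
  have orth: "S \<in> borel_measurable (\<F> (\<tau> n)) \<and> integrable M (\<lambda>x. (S x)\<^sup>2) \<and>
      expectation (\<lambda>x. (S x)\<^sup>2) = (\<Sum>k<n. expectation (\<lambda>x. (w k x)\<^sup>2) *
        expectation (\<lambda>x. (a \<bullet> (B (\<tau> (Suc k)) x - B (\<tau> k) x))\<^sup>2)) \<and> 0 \<le> \<tau> n"
    unfolding S_def
    by (rule orthogonal_sum[of \<tau> n w C "\<lambda>_ x. x" a])
       (use \<tau> \<tau>0 w_meas w_bound in \<open>auto intro: increment_moments(1,2)\<close>)
  then have [measurable]: "S \<in> borel_measurable M" by (auto intro: measurable_F)
  have "expectation (\<lambda>x. (S x)\<^sup>2) = (\<Sum>k<n. expectation (\<lambda>x. (w k x)\<^sup>2) * (q * (\<tau> (Suc k) - \<tau> k)))"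
    using orth \<tau> \<tau>0 by (auto simp: increment_moments(3) q_def intro!: sum.cong)
  also have "\<dots> = q * expectation (\<lambda>x. \<Sum>k<n. (w k x)\<^sup>2 * (\<tau> (Suc k) - \<tau> k))"
  proof (subst Bochner_Integration.integral_sum)
    fix k assume "k \<in> {..<n}"
    then have k: "k < n" by simp
    have "integrable M (\<lambda>x. (w k x)\<^sup>2)"
      using w_bound[OF k] by (rule expectation_square_bounded(1)[OF measurable_F[OF w_meas[OF k]]])
    then show "integrable M (\<lambda>x. (w k x)\<^sup>2 * (\<tau> (Suc k) - \<tau> k))" by simp
  qed (simp add: sum_distrib_left mult_ac)
  also have "\<dots> \<le> q * expectation (\<lambda>x. \<delta>)"
  proof (intro mult_left_mono integral_mono_AE' q)
    show "AE x in M. (\<Sum>k<n. (w k x)\<^sup>2 * (\<tau> (Suc k) - \<tau> k)) \<le> \<delta>" using w_sum by simp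
  qed (use pos in auto)
  finally have S2: "expectation (\<lambda>x. (S x)\<^sup>2) \<le> q * \<delta>" by (simp add: prob_space)
  have "prob {x \<in> space M. \<epsilon> < \<bar>S x\<bar>} \<le> prob {x \<in> space M. \<epsilon>\<^sup>2 \<le> (S x)\<^sup>2}"
  proof (intro finite_measure_mono Collect_mono impI)
    fix x assume "x \<in> space M \<and> \<epsilon> < \<bar>S x\<bar>"
    then show "x \<in> space M \<and> \<epsilon>\<^sup>2 \<le> (S x)\<^sup>2" using pos by (auto simp: abs_le_square_iff[symmetric])
  qed simp
  also have "\<dots> \<le> expectation (\<lambda>x. (S x)\<^sup>2) / \<epsilon>\<^sup>2"
    using orth pos by (intro integral_Markov_inequality_measure[where A = "{}"]) auto
  also have "\<dots> \<le> q * \<delta> / \<epsilon>\<^sup>2" using S2 by (intro divide_right_mono) auto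
  finally have 1: "prob {x \<in> space M. \<epsilon> < \<bar>S x\<bar>} \<le> q * \<delta> / \<epsilon>\<^sup>2" .
  have A_n: "A n \<in> borel_measurable M"
  proof -
    have [measurable]: "v i \<in> borel_measurable M" if "i \<in> {..<n}" for i
      using that by (intro measurable_F[OF v]) auto
    show ?thesis unfolding A_def by measurable
  qed
  have "prob {x \<in> space M. \<epsilon> < \<bar>\<Sum>k<n. v k x * (a \<bullet> (B (\<tau> (Suc k)) x - B (\<tau> k) x))\<bar>} \<le>
      prob ({x \<in> space M. \<epsilon> < \<bar>S x\<bar>} \<union> {x \<in> space M. \<delta> < A n x})"
  proof (intro finite_measure_mono subsetI)
    fix x assume x: "x \<in> {x \<in> space M. \<epsilon> < \<bar>\<Sum>k<n. v k x * (a \<bullet> (B (\<tau> (Suc k)) x - B (\<tau> k) x))\<bar>}"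
    show "x \<in> {x \<in> space M. \<epsilon> < \<bar>S x\<bar>} \<union> {x \<in> space M. \<delta> < A n x}"
    proof (cases "\<delta> < A n x")
      case False
      then have "w k x = v k x" if "k < n" for k
        using A_mono[of "Suc k" x] that by (auto simp: w_def)
      then show ?thesis using x by (simp add: S_def)
    qed (use x in auto)
  qed (use A_n in auto)
  also have "\<dots> \<le> prob {x \<in> space M. \<epsilon> < \<bar>S x\<bar>} + prob {x \<in> space M. \<delta> < A n x}"
    using A_n by (intro measure_Un_le) auto
  finally show ?thesis using 1 unfolding A_def q_def by simp
qed

end

section \<open>Uniqueness of the Ito integral\<close>

text \<open>Two simple processes can be subtracted only over a common partition. The points are cut
  off at \<open>t\<close> because a simple process may extend past the end of the integration
  interval.\<close>

locale partition_refinement =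
  fixes n :: nat and \<tau> :: "nat \<Rightarrow> real" and N :: nat and \<sigma> :: "nat \<Rightarrow> real" and t :: real
  assumes tau_less: "k < n \<Longrightarrow> \<tau> k < \<tau> (Suc k)"
    and sigma_less: "i < j \<Longrightarrow> j \<le> N \<Longrightarrow> \<sigma> i < \<sigma> j"
    and sigma_le: "j \<le> N \<Longrightarrow> \<sigma> j \<le> t"
    and refines: "k \<le> n \<Longrightarrow> min t (\<tau> k) \<in> \<sigma> ` {..N}"
begin

lemma sigma_less_iff: "i \<le> N \<Longrightarrow> j \<le> N \<Longrightarrow> \<sigma> i < \<sigma> j \<longleftrightarrow> i < j"
  using sigma_less by (metis linorder_neqE_nat order_less_asym order_less_irrefl)

text \<open>No \<open>\<tau> k\<close> lies strictly inside a cell: if it is below \<open>s\<close>,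
  it is also below \<open>t\<close>, hence a point of \<open>\<sigma>\<close> before
  \<open>\<sigma> (Suc j)\<close>, hence at most \<open>\<sigma> j\<close>.\<close>

lemma tau_less_iff:
  assumes "k \<le> n" "j < N" "s \<in> {\<sigma> j<..\<sigma> (Suc j)}"
  shows "\<tau> k < s \<longleftrightarrow> \<tau> k \<le> \<sigma> j"
proof
  assume "\<tau> k < s"
  moreover have "\<sigma> (Suc j) \<le> t" using assms by (intro sigma_le) simp
  ultimately have "min t (\<tau> k) = \<tau> k" "\<tau> k < \<sigma> (Suc j)" using assms by auto
  moreover obtain i where "i \<le> N" "min t (\<tau> k) = \<sigma> i" using refines[OF assms(1)] by auto
  ultimately have "\<sigma> i < \<sigma> (Suc j)" by simp
  then have "i \<le> j" using \<open>i \<le> N\<close> assms(2) by (simp add: sigma_less_iff)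
  then have "\<sigma> i \<le> \<sigma> j" using sigma_less[of i j] assms(2) by (cases "i = j") auto
  then show "\<tau> k \<le> \<sigma> j" using \<open>min t (\<tau> k) = \<tau> k\<close> \<open>min t (\<tau> k) = \<sigma> i\<close> by simp
qed (use assms in auto)

text \<open>The cells are open on the left and closed on the right, so the right endpoint can
  represent the constant value on a cell.\<close>

lemma simple_value_refine:
  assumes "j < N" "s \<in> {\<sigma> j<..\<sigma> (Suc j)}"
  shows "simple_value n \<tau> \<xi> s x = simple_value n \<tau> \<xi> (\<sigma> (Suc j)) x"
  unfolding simple_value_def
proof (intro sum.cong refl)
  fix k assume "k \<in> {..<n}"
  have S: "\<sigma> (Suc j) \<in> {\<sigma> j<..\<sigma> (Suc j)}" using sigma_less[of j "Suc j"] assms(1) by simp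
  have "s \<in> {\<tau> k<..\<tau> (Suc k)} \<longleftrightarrow> \<sigma> (Suc j) \<in> {\<tau> k<..\<tau> (Suc k)}"
    using tau_less_iff[OF _ assms, of k] tau_less_iff[OF _ assms, of "Suc k"]
      tau_less_iff[OF _ assms(1) S, of k] tau_less_iff[OF _ assms(1) S, of "Suc k"] \<open>k \<in> {..<n}\<close>
    by (auto simp: not_less[symmetric])
  then show "\<xi> k x * indicator {\<tau> k<..\<tau> (Suc k)} s =
      \<xi> k x * indicator {\<tau> k<..\<tau> (Suc k)} (\<sigma> (Suc j))" by (simp add: indicator_def)
qed

lemma simple_integral_refine:
  "simple_integral X n \<tau> \<xi> t x =
    (\<Sum>j<N. simple_value n \<tau> \<xi> (\<sigma> (Suc j)) x * (X (\<sigma> (Suc j)) x - X (\<sigma> j) x))"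
proof -
  have "X (min t (\<tau> (Suc k))) x - X (min t (\<tau> k)) x =
      (\<Sum>j<N. indicator {\<tau> k<..\<tau> (Suc k)} (\<sigma> (Suc j)) * (X (\<sigma> (Suc j)) x - X (\<sigma> j) x))"
    if k: "k < n" for k
  proof -
    obtain a where a: "a \<le> N" "min t (\<tau> k) = \<sigma> a" using refines[of k] k by auto
    obtain b where b: "b \<le> N" "min t (\<tau> (Suc k)) = \<sigma> b" using refines[of "Suc k"] k by auto
    have "\<sigma> a \<le> \<sigma> b" using tau_less[OF k] a b by (auto simp: min_def split: if_splits)
    then have ab: "a \<le> b" using sigma_less[of b a] a by (meson leD leI)
    \<comment> \<open>The cells inside the truncated interval are exactly those with index from
      \<open>a\<close> to \<open>b - 1\<close>, so the increments over them telescope.\<close>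
    have ind: "\<sigma> (Suc j) \<in> {\<tau> k<..\<tau> (Suc k)} \<longleftrightarrow> j \<in> {a..<b}" if "j < N" for j
    proof -
      have "\<sigma> (Suc j) \<le> t" using that by (intro sigma_le) simp
      then have "\<sigma> (Suc j) \<in> {\<tau> k<..\<tau> (Suc k)} \<longleftrightarrow> \<sigma> a < \<sigma> (Suc j) \<and> \<not> \<sigma> b < \<sigma> (Suc j)"
        unfolding a(2)[symmetric] b(2)[symmetric] by auto
      then show ?thesis using that a b by (auto simp: sigma_less_iff)
    qed
    have "(\<Sum>j<N. indicator {\<tau> k<..\<tau> (Suc k)} (\<sigma> (Suc j)) * (X (\<sigma> (Suc j)) x - X (\<sigma> j) x)) =
        (\<Sum>j\<in>{a..<b}. X (\<sigma> (Suc j)) x - X (\<sigma> j) x)"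
      using b ind by (intro sum.mono_neutral_cong_right) auto
    also have "\<dots> = X (\<sigma> b) x - X (\<sigma> a) x"
      by (rule sum_Suc_diff'[OF ab])
    finally show ?thesis using a b by simp
  qed
  note eq = this
  have "simple_integral X n \<tau> \<xi> t x =
      (\<Sum>k<n. \<Sum>j<N. \<xi> k x * indicator {\<tau> k<..\<tau> (Suc k)} (\<sigma> (Suc j)) * (X (\<sigma> (Suc j)) x - X (\<sigma> j) x))"
    unfolding simple_integral_def
    by (intro sum.cong refl) (simp only: eq lessThan_iff sum_distrib_left mult.assoc)
  also have "\<dots> = (\<Sum>j<N. simple_value n \<tau> \<xi> (\<sigma> (Suc j)) x * (X (\<sigma> (Suc j)) x - X (\<sigma> j) x))"
    by (subst sum.swap) (simp only: simple_value_def sum_distrib_right)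
  finally show ?thesis .
qed

end

text \<open>The cells are pairwise disjoint but need not cover \<open>[0, t]\<close>, hence an
  inequality rather than an equality.\<close>

lemma step_function_nn_integral_le:
  fixes \<sigma> :: "nat \<Rightarrow> real" and G :: "real \<Rightarrow> real"
  assumes \<sigma>: "\<And>i j. i < j \<Longrightarrow> j \<le> N \<Longrightarrow> \<sigma> i < \<sigma> j" "\<And>j. j \<le> N \<Longrightarrow> \<sigma> j \<in> {0..t}"
    and G: "\<And>j s. j < N \<Longrightarrow> s \<in> {\<sigma> j<..\<sigma> (Suc j)} \<Longrightarrow> G s = v j"
  shows "ennreal (\<Sum>j<N. (v j)\<^sup>2 * (\<sigma> (Suc j) - \<sigma> j)) \<le> (\<integral>\<^sup>+s\<in>{0..t}. ennreal ((G s)\<^sup>2) \<partial>lborel)"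
proof -
  have le: "\<sigma> i \<le> \<sigma> j" if "i \<le> j" "j \<le> N" for i j using \<sigma>(1)[of i j] that by (cases "i = j") auto
  have "ennreal (\<Sum>j<N. (v j)\<^sup>2 * (\<sigma> (Suc j) - \<sigma> j)) = (\<Sum>j<N. ennreal ((v j)\<^sup>2 * (\<sigma> (Suc j) - \<sigma> j)))"
    using le by (intro sum_ennreal[symmetric]) auto
  also have "\<dots> = (\<Sum>j<N. (\<integral>\<^sup>+s. ennreal ((v j)\<^sup>2) * indicator {\<sigma> j<..\<sigma> (Suc j)} s \<partial>lborel))"
    using le by (intro sum.cong refl) (auto simp: nn_integral_cmult_indicator ennreal_mult')
  also have "\<dots> = (\<integral>\<^sup>+s. (\<Sum>j<N. ennreal ((v j)\<^sup>2) * indicator {\<sigma> j<..\<sigma> (Suc j)} s) \<partial>lborel)"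
    by (rule nn_integral_sum[symmetric]) measurable
  also have "\<dots> \<le> (\<integral>\<^sup>+s\<in>{0..t}. ennreal ((G s)\<^sup>2) \<partial>lborel)"
  proof (rule nn_integral_mono)
    fix s :: real
    show "(\<Sum>j<N. ennreal ((v j)\<^sup>2) * indicator {\<sigma> j<..\<sigma> (Suc j)} s) \<le> ennreal ((G s)\<^sup>2) * indicator {0..t} s"
    proof (cases "\<exists>j<N. s \<in> {\<sigma> j<..\<sigma> (Suc j)}")
      case True
      then obtain i where i: "i < N" "s \<in> {\<sigma> i<..\<sigma> (Suc i)}" by blast
      have "(\<Sum>j<N. ennreal ((v j)\<^sup>2) * indicator {\<sigma> j<..\<sigma> (Suc j)} s) =
          (\<Sum>j<N. if j = i then ennreal ((v i)\<^sup>2) else 0)"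
      proof (intro sum.cong refl)
        fix j assume j: "j \<in> {..<N}"
        show "ennreal ((v j)\<^sup>2) * indicator {\<sigma> j<..\<sigma> (Suc j)} s = (if j = i then ennreal ((v i)\<^sup>2) else 0)"
          using i j le[of "Suc i" j] le[of "Suc j" i] by (cases j i rule: linorder_cases) auto
      qed
      also have "\<dots> = ennreal ((G s)\<^sup>2)" using i G by simp
      also have "\<dots> = ennreal ((G s)\<^sup>2) * indicator {0..t} s"
        using i \<sigma>(2)[of i] \<sigma>(2)[of "Suc i"] by auto
      finally show ?thesis by simp
    next
      case False
      then have "(\<Sum>j<N. ennreal ((v j)\<^sup>2) * indicator {\<sigma> j<..\<sigma> (Suc j)} s) = 0"
        by (intro sum.neutral) auto
      then show ?thesis by simp
    qed
  qed
  finally show ?thesis .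
qed

lemma nn_integral_square_diff_triangle:
  fixes f g h :: "real \<Rightarrow> real"
  assumes [measurable]: "f \<in> borel_measurable borel" "g \<in> borel_measurable borel" "h \<in> borel_measurable borel"
    "A \<in> sets borel"
  shows "(\<integral>\<^sup>+s\<in>A. ennreal ((f s - g s)\<^sup>2) \<partial>lborel) \<le>
    2 * (\<integral>\<^sup>+s\<in>A. ennreal ((f s - h s)\<^sup>2) \<partial>lborel) + 2 * (\<integral>\<^sup>+s\<in>A. ennreal ((g s - h s)\<^sup>2) \<partial>lborel)"
proof -
  have "(\<integral>\<^sup>+s\<in>A. ennreal ((f s - g s)\<^sup>2) \<partial>lborel) \<le>
    (\<integral>\<^sup>+s. 2 * (ennreal ((f s - h s)\<^sup>2) * indicator A s) + 2 * (ennreal ((g s - h s)\<^sup>2) * indicator A s) \<partial>lborel)"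
  proof (rule nn_integral_mono)
    fix s
    \<comment> \<open>With \<open>p = f s - h s\<close> and \<open>q = g s - h s\<close>, the right
      side minus the left side is \<open>(p + q)\<^sup>2\<close>.\<close>
    have "(f s - g s)\<^sup>2 \<le> 2 * (f s - h s)\<^sup>2 + 2 * (g s - h s)\<^sup>2"
      using zero_le_power2[of "(f s - h s) + (g s - h s)"] by (simp add: power2_eq_square algebra_simps)
    then have "ennreal ((f s - g s)\<^sup>2) \<le> ennreal (2 * (f s - h s)\<^sup>2 + 2 * (g s - h s)\<^sup>2)"
      by (rule ennreal_leI)
    also have "\<dots> = 2 * ennreal ((f s - h s)\<^sup>2) + 2 * ennreal ((g s - h s)\<^sup>2)"
      by (simp add: ennreal_plus ennreal_mult')
    finally show "ennreal ((f s - g s)\<^sup>2) * indicator A s \<le>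
        2 * (ennreal ((f s - h s)\<^sup>2) * indicator A s) + 2 * (ennreal ((g s - h s)\<^sup>2) * indicator A s)"
      by (auto simp: indicator_def)
  qed
  also have "\<dots> = 2 * (\<integral>\<^sup>+s\<in>A. ennreal ((f s - h s)\<^sup>2) \<partial>lborel) +
      2 * (\<integral>\<^sup>+s\<in>A. ennreal ((g s - h s)\<^sup>2) \<partial>lborel)"
    by (simp add: nn_integral_add nn_integral_cmult)
  finally show ?thesis .
qed

abbreviation sq_dist :: "(real \<Rightarrow> 'a \<Rightarrow> real) \<Rightarrow> (real \<Rightarrow> 'a \<Rightarrow> real) \<Rightarrow> real \<Rightarrow> 'a \<Rightarrow> ennreal" where
  "sq_dist V H t x \<equiv> \<integral>\<^sup>+s\<in>{0..t}. ennreal ((V s x - H s x)\<^sup>2) \<partial>lborel"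

context filtered_brownian_motion
begin

section \<open>Measurability and comparison of simple integrals\<close>

lemma simple_processD:
  assumes "simple_process \<F> n \<tau> \<xi>"
  shows "0 \<le> \<tau> 0" "k < n \<Longrightarrow> \<tau> k < \<tau> (Suc k)" "k < n \<Longrightarrow> \<xi> k \<in> borel_measurable (\<F> (\<tau> k))"
    "k \<le> n \<Longrightarrow> 0 \<le> \<tau> k" "\<exists>C. \<forall>k<n. \<forall>x\<in>space M. \<bar>\<xi> k x\<bar> \<le> C k"
proof -
  show 0: "0 \<le> \<tau> 0" and 1: "k < n \<Longrightarrow> \<tau> k < \<tau> (Suc k)" and "k < n \<Longrightarrow> \<xi> k \<in> borel_measurable (\<F> (\<tau> k))"
    for k using assms by (auto simp: simple_process_def)
  show "0 \<le> \<tau> k" if "k \<le> n"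
    using that
  proof (induction k)
    case (Suc k)
    then show ?case using 1[of k] by simp
  qed (use 0 in simp)
  have "\<exists>c. \<forall>x\<in>space M. \<bar>\<xi> k x\<bar> \<le> c" if "k < n" for k
    using assms that unfolding simple_process_def bounded_iff by auto
  then show "\<exists>C. \<forall>k<n. \<forall>x\<in>space M. \<bar>\<xi> k x\<bar> \<le> C k" by metis
qed

lemma simple_value_measurable [measurable]:
  assumes "simple_process \<F> n \<tau> \<xi>"
  shows "(\<lambda>(s, x). simple_value n \<tau> \<xi> s x) \<in> borel_measurable (borel \<Otimes>\<^sub>M M)"
proof -
  have [measurable]: "\<xi> k \<in> borel_measurable M" if "k \<in> {..<n}" for k
    using simple_processD(3)[OF assms, of k] that by (auto intro: measurable_F)
  show ?thesis unfolding simple_value_def by measurable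
qed

lemma simple_integral_measurable:
  assumes "simple_process \<F> n \<tau> \<xi>" "0 \<le> t"
  shows "simple_integral (\<lambda>s x. a \<bullet> B s x) n \<tau> \<xi> t \<in> borel_measurable M"
proof -
  have [measurable]: "\<xi> k \<in> borel_measurable M" "B (min t (\<tau> k)) \<in> borel_measurable M"
    "B (min t (\<tau> (Suc k))) \<in> borel_measurable M" if "k \<in> {..<n}" for k
    using simple_processD[OF assms(1)] that assms(2) by (auto intro!: measurable_F B_measurable)
  show ?thesis unfolding simple_integral_def[abs_def] by measurable
qed

lemma nn_integral_square_measurable:
  fixes G :: "real \<Rightarrow> 'a \<Rightarrow> real"
  assumes "(\<lambda>(s, x). G s x) \<in> borel_measurable (borel \<Otimes>\<^sub>M M)"
  shows "(\<lambda>x. \<integral>\<^sup>+s\<in>{0..t}. ennreal ((G s x)\<^sup>2) \<partial>lborel) \<in> borel_measurable M"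
proof (rule lborel.borel_measurable_nn_integral)
  have [measurable]: "(\<lambda>(x, s). G s x) \<in> borel_measurable (M \<Otimes>\<^sub>M borel)"
    using measurable_pair_swap[OF assms] by (simp add: split_beta)
  show "(\<lambda>(x, s). ennreal ((G s x)\<^sup>2) * indicator {0..t} s) \<in> borel_measurable (M \<Otimes>\<^sub>M lborel)"
    by measurable
qed

text \<open>Over the common refinement the difference of the two integrals is a single simple
  integral with coefficients \<open>v j\<close>, to which the truncated isometry bound applies; the
  sum of squares in that bound is at most the squared distance of the integrands.\<close>

lemma simple_process_diff_prob_bound:
  fixes a :: "real^'d"
  assumes V: "simple_process \<F> n \<tau> \<xi>" and V': "simple_process \<F> n' \<tau>' \<xi>'" and t: "0 \<le> t"
    and pos: "0 < \<epsilon>" "0 < \<delta>"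
  defines "X \<equiv> \<lambda>s x. a \<bullet> B s x"
  shows "prob {x \<in> space M. \<epsilon> < \<bar>simple_integral X n \<tau> \<xi> t x - simple_integral X n' \<tau>' \<xi>' t x\<bar>} \<le>
    (a \<bullet> (\<Lambda> *v a)) * \<delta> / \<epsilon>\<^sup>2 +
    prob {x \<in> space M. ennreal \<delta> <
      (sq_dist (simple_value n \<tau> \<xi>) (simple_value n' \<tau>' \<xi>') t x)}"
proof -
  \<comment> \<open>This set is nonempty even when \<open>n\<close> and \<open>n'\<close> are 0,
    since the initial points are included; it has one point more than there are cells, whence
    \<open>N = card S - 1\<close>.\<close>
  define S where "S = (\<lambda>k. min t (\<tau> k)) ` {..n} \<union> (\<lambda>k. min t (\<tau>' k)) ` {..n'}"
  have S: "finite S" "S \<noteq> {}" "S \<subseteq> {0..t}"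
    using simple_processD(4)[OF V] simple_processD(4)[OF V'] t by (auto simp: S_def)
  obtain l where l: "sorted_wrt (<) l" "set l = S" "length l = card S"
    using finite_set_strict_sorted[OF S(1)] by blast
  define N where "N = card S - 1"
  define \<sigma> where "\<sigma> j = l ! j" for j
  have "card S > 0" using S by (simp add: card_gt_0_iff)
  then have len: "length l = Suc N" using l by (simp add: N_def)
  have \<sigma>_less: "\<sigma> i < \<sigma> j" if "i < j" "j \<le> N" for i j
    using that l(1) len by (auto simp: \<sigma>_def intro: sorted_wrt_nth_less)
  have img: "S = \<sigma> ` {..N}"
  proof -
    have "S = (!) l ` {..<Suc N}" using l(2) len by (metis nth_image take_all_iff order.refl lessThan_atLeast0)
    then show ?thesis by (simp add: \<sigma>_def[abs_def] lessThan_Suc_atMost)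
  qed
  have \<sigma>_in: "\<sigma> j \<in> {0..t}" if "j \<le> N" for j using img S(3) that by auto
  interpret R: partition_refinement n \<tau> N \<sigma> t
    using simple_processD(2)[OF V] \<sigma>_less \<sigma>_in img by unfold_locales (auto simp: S_def)
  interpret R': partition_refinement n' \<tau>' N \<sigma> t
    using simple_processD(2)[OF V'] \<sigma>_less \<sigma>_in img by unfold_locales (auto simp: S_def)
  define v where "v j x = simple_value n \<tau> \<xi> (\<sigma> (Suc j)) x - simple_value n' \<tau>' \<xi>' (\<sigma> (Suc j)) x" for j x
  obtain C where C: "\<forall>k<n. \<forall>x\<in>space M. \<bar>\<xi> k x\<bar> \<le> C k" using simple_processD(5)[OF V] by blast
  obtain C' where C': "\<forall>k<n'. \<forall>x\<in>space M. \<bar>\<xi>' k x\<bar> \<le> C' k" using simple_processD(5)[OF V'] by blast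
  have bound: "\<bar>simple_value m T y s x\<bar> \<le> (\<Sum>k<m. \<bar>c k\<bar>)"
    if "\<forall>k<m. \<forall>x\<in>space M. \<bar>y k x\<bar> \<le> c k" "x \<in> space M" for m T y c s x
  proof -
    have "\<bar>simple_value m T y s x\<bar> \<le> (\<Sum>k<m. \<bar>y k x * indicator {T k<..T (Suc k)} s\<bar>)"
      unfolding simple_value_def by (rule sum_abs)
    also have "\<dots> \<le> (\<Sum>k<m. \<bar>c k\<bar>)"
      using that by (intro sum_mono) (force simp: indicator_def)
    finally show ?thesis .
  qed
  \<comment> \<open>The value is read off at the right endpoint but must be known at the left one:
    every term that is nonzero there starts at some \<open>T k \<le> \<sigma> j\<close>.\<close>
  have meas: "simple_value m T y (\<sigma> (Suc j)) \<in> borel_measurable (\<F> (\<sigma> j))"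
    if "simple_process \<F> m T y" "partition_refinement m T N \<sigma> t" "j < N" for m T y j
  proof -
    interpret partition_refinement m T N \<sigma> t by (rule that)
    have S: "\<sigma> (Suc j) \<in> {\<sigma> j<..\<sigma> (Suc j)}" using \<sigma>_less[of j "Suc j"] that by simp
    have "(\<lambda>x. y k x * indicator {T k<..T (Suc k)} (\<sigma> (Suc j))) \<in> borel_measurable (\<F> (\<sigma> j))"
      if k: "k < m" for k
    proof (cases "\<sigma> (Suc j) \<in> {T k<..T (Suc k)}")
      case True
      then have "T k \<le> \<sigma> j" using tau_less_iff[of k, OF _ \<open>j < N\<close> S] k by auto
      then have "y k \<in> borel_measurable (\<F> (\<sigma> j))"
        using simple_processD(3)[OF \<open>simple_process \<F> m T y\<close> k] by (rule measurable_F_mono[rotated])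
      then show ?thesis by measurable
    qed simp
    then show ?thesis unfolding simple_value_def[abs_def] by (intro borel_measurable_sum) auto
  qed
  have "prob {x \<in> space M. \<epsilon> < \<bar>simple_integral X n \<tau> \<xi> t x - simple_integral X n' \<tau>' \<xi>' t x\<bar>} =
    prob {x \<in> space M. \<epsilon> < \<bar>\<Sum>j<N. v j x * (a \<bullet> (B (\<sigma> (Suc j)) x - B (\<sigma> j) x))\<bar>}"
    unfolding R.simple_integral_refine R'.simple_integral_refine v_def X_def
    by (simp add: sum_subtractf left_diff_distrib inner_diff_right)
  also have "\<dots> \<le> (a \<bullet> (\<Lambda> *v a)) * \<delta> / \<epsilon>\<^sup>2 +
      prob {x \<in> space M. \<delta> < (\<Sum>j<N. (v j x)\<^sup>2 * (\<sigma> (Suc j) - \<sigma> j))}"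
  proof (rule simple_integral_prob_bound[OF _ _ _ _ pos])
    show "0 \<le> \<sigma> 0" using \<sigma>_in[of 0] by simp
    show "\<sigma> k \<le> \<sigma> (Suc k)" if "k < N" for k using \<sigma>_less[of k "Suc k"] that by simp
    show "v k \<in> borel_measurable (\<F> (\<sigma> k))" if "k < N" for k
      unfolding v_def using meas[OF V R.partition_refinement_axioms that]
        meas[OF V' R'.partition_refinement_axioms that] by measurable
    show "\<bar>v k x\<bar> \<le> (\<lambda>_. (\<Sum>k<n. \<bar>C k\<bar>) + (\<Sum>k<n'. \<bar>C' k\<bar>)) k" if "k < N" "x \<in> space M" for k x
      using bound[OF C that(2), of \<tau> "\<sigma> (Suc k)"] bound[OF C' that(2), of \<tau>' "\<sigma> (Suc k)"] unfolding v_def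
      by simp
  qed
  also have "prob {x \<in> space M. \<delta> < (\<Sum>j<N. (v j x)\<^sup>2 * (\<sigma> (Suc j) - \<sigma> j))} \<le>
    prob {x \<in> space M. ennreal \<delta> <
      (sq_dist (simple_value n \<tau> \<xi>) (simple_value n' \<tau>' \<xi>') t x)}"
  proof (intro finite_measure_mono Collect_mono impI conjI; (elim conjE)?)
    fix x assume x: "x \<in> space M" "\<delta> < (\<Sum>j<N. (v j x)\<^sup>2 * (\<sigma> (Suc j) - \<sigma> j))"
    show "x \<in> space M" by (rule x)
    have "ennreal \<delta> < ennreal (\<Sum>j<N. (v j x)\<^sup>2 * (\<sigma> (Suc j) - \<sigma> j))"
      using x(2) pos by (intro ennreal_lessI) auto
    also have "\<dots> \<le> (sq_dist (simple_value n \<tau> \<xi>) (simple_value n' \<tau>' \<xi>') t x)"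
    proof (rule step_function_nn_integral_le)
      fix j s assume js: "j < N" "s \<in> {\<sigma> j<..\<sigma> (Suc j)}"
      show "simple_value n \<tau> \<xi> s x - simple_value n' \<tau>' \<xi>' s x = v j x"
        using R.simple_value_refine[OF js, of \<xi> x] R'.simple_value_refine[OF js, of \<xi>' x] by (simp add: v_def)
    qed (use \<sigma>_less \<sigma>_in in auto)
    finally show "ennreal \<delta> < \<dots>" .
  next
    have [measurable]: "(\<lambda>(s, x). simple_value n \<tau> \<xi> s x - simple_value n' \<tau>' \<xi>' s x) \<in> borel_measurable (borel \<Otimes>\<^sub>M M)"
      using simple_value_measurable[OF V] simple_value_measurable[OF V'] by (simp add: split_beta)
    have "(\<lambda>x. sq_dist (simple_value n \<tau> \<xi>) (simple_value n' \<tau>' \<xi>') t x)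
        \<in> borel_measurable M"
      by (rule nn_integral_square_measurable) measurable
    then show "{x \<in> space M. ennreal \<delta> <
      (sq_dist (simple_value n \<tau> \<xi>) (simple_value n' \<tau>' \<xi>') t x)} \<in> events"
      by measurable
  qed
  finally show ?thesis by simp
qed

text \<open>Progressive measurability is joint measurability on \<open>[0, t]\<close> only. Clamping
  the time argument extends it to the whole line and leaves the process unchanged on
  \<open>[0, t]\<close>.\<close>

lemma progressively_measurable_clamp:
  assumes "progressively_measurable \<F> H" "0 \<le> t"
  shows "(\<lambda>(s, x). H (max 0 (min s t)) x) \<in> borel_measurable (borel \<Otimes>\<^sub>M M)"
proof -
  have "(\<lambda>(s, x). H s x) \<in> borel_measurable (restrict_space borel {0..t} \<Otimes>\<^sub>M \<F> t)"
    using assms by (simp add: progressively_measurable_def)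
  moreover have "(\<lambda>(s, x). (max 0 (min s t), x)) \<in> borel \<Otimes>\<^sub>M M \<rightarrow>\<^sub>M restrict_space borel {0..t} \<Otimes>\<^sub>M \<F> t"
    unfolding split_beta
  proof (rule measurable_Pair)
    show "(\<lambda>p. max 0 (min (fst p) t)) \<in> borel \<Otimes>\<^sub>M M \<rightarrow>\<^sub>M restrict_space borel {0..t}"
      using assms(2) by (intro measurable_restrict_space2) auto
    have "(\<lambda>x. x) \<in> M \<rightarrow>\<^sub>M \<F> t" using sets_F[of t] by (auto simp: measurable_def)
    then show "snd \<in> borel \<Otimes>\<^sub>M M \<rightarrow>\<^sub>M \<F> t" by (rule measurable_compose[OF measurable_snd])
  qed
  ultimately have "(\<lambda>(s, x). H s x) \<circ> (\<lambda>(s, x). (max 0 (min s t), x)) \<in> borel_measurable (borel \<Otimes>\<^sub>M M)"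
    by (rule measurable_comp[rotated])
  then show ?thesis by (simp add: comp_def split_beta)
qed

lemma simple_process_approx_measurable:
  assumes V: "simple_process \<F> n \<tau> \<xi>" and H: "progressively_measurable \<F> H" and t: "0 \<le> t"
  shows "(\<lambda>x. sq_dist (simple_value n \<tau> \<xi>) H t x) \<in> borel_measurable M"
proof -
  have "(\<lambda>(s, x). simple_value n \<tau> \<xi> s x - H (max 0 (min s t)) x) \<in> borel_measurable (borel \<Otimes>\<^sub>M M)"
    using simple_value_measurable[OF V] progressively_measurable_clamp[OF H t] by (simp add: split_beta)
  then have "(\<lambda>x. \<integral>\<^sup>+s\<in>{0..t}. ennreal ((simple_value n \<tau> \<xi> s x - H (max 0 (min s t)) x)\<^sup>2) \<partial>lborel)
      \<in> borel_measurable M"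
    by (rule nn_integral_square_measurable)
  also have "(\<lambda>x. \<integral>\<^sup>+s\<in>{0..t}. ennreal ((simple_value n \<tau> \<xi> s x - H (max 0 (min s t)) x)\<^sup>2) \<partial>lborel) =
    (\<lambda>x. sq_dist (simple_value n \<tau> \<xi>) H t x)"
    by (intro ext nn_integral_cong) (auto split: split_indicator)
  finally show ?thesis .
qed

text \<open>The squared distance between the two simple processes is at most twice the sum of their
  squared distances to \<open>H\<close>; if both of these are at most \<open>\<delta> / 4\<close>,
  it is at most \<open>\<delta>\<close>.\<close>

lemma simple_process_prob_bound:
  fixes a :: "real^'d"
  assumes V: "simple_process \<F> n \<tau> \<xi>" and V': "simple_process \<F> n' \<tau>' \<xi>'" and t: "0 \<le> t"
    and H: "progressively_measurable \<F> H" and pos: "0 < \<epsilon>" "0 < \<delta>"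
  defines "X \<equiv> \<lambda>s x. a \<bullet> B s x"
  shows "prob {x \<in> space M. \<epsilon> < \<bar>simple_integral X n \<tau> \<xi> t x - simple_integral X n' \<tau>' \<xi>' t x\<bar>} \<le>
    (a \<bullet> (\<Lambda> *v a)) * \<delta> / \<epsilon>\<^sup>2 +
    prob {x \<in> space M. ennreal (\<delta> / 4) < (sq_dist (simple_value n \<tau> \<xi>) H t x)} +
    prob {x \<in> space M. ennreal (\<delta> / 4) < (sq_dist (simple_value n' \<tau>' \<xi>') H t x)}"
proof -
  define Z where "Z x = (sq_dist (simple_value n \<tau> \<xi>) H t x)" for x
  define Z' where "Z' x = (sq_dist (simple_value n' \<tau>' \<xi>') H t x)" for x
  have [measurable]: "Z \<in> borel_measurable M" "Z' \<in> borel_measurable M"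
    unfolding Z_def Z'_def using simple_process_approx_measurable[OF V H t]
      simple_process_approx_measurable[OF V' H t] by simp_all
  define D where "D x = (sq_dist (simple_value n \<tau> \<xi>) (simple_value n' \<tau>' \<xi>') t x)" for x
  have D_le: "D x \<le> 2 * Z x + 2 * Z' x" if x: "x \<in> space M" for x
  proof -
    define Hc where "Hc s = H (max 0 (min s t)) x" for s
    have c: "(\<lambda>s. f (s, x)) \<in> borel_measurable borel" if "f \<in> borel_measurable (borel \<Otimes>\<^sub>M M)" for f :: "real \<times> 'a \<Rightarrow> real"
      by (rule measurable_compose[OF measurable_Pair2'[OF x] that])
    have [measurable]: "(\<lambda>s. simple_value n \<tau> \<xi> s x) \<in> borel_measurable borel"
      "(\<lambda>s. simple_value n' \<tau>' \<xi>' s x) \<in> borel_measurable borel" "Hc \<in> borel_measurable borel"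
      using c[OF simple_value_measurable[OF V]] c[OF simple_value_measurable[OF V']]
        c[OF progressively_measurable_clamp[OF H t]] by (simp_all add: Hc_def[abs_def])
    have "D x \<le> 2 * (\<integral>\<^sup>+s\<in>{0..t}. ennreal ((simple_value n \<tau> \<xi> s x - Hc s)\<^sup>2) \<partial>lborel) +
        2 * (\<integral>\<^sup>+s\<in>{0..t}. ennreal ((simple_value n' \<tau>' \<xi>' s x - Hc s)\<^sup>2) \<partial>lborel)"
      unfolding D_def by (rule nn_integral_square_diff_triangle) measurable
    also have "(\<integral>\<^sup>+s\<in>{0..t}. ennreal ((simple_value n \<tau> \<xi> s x - Hc s)\<^sup>2) \<partial>lborel) = Z x"
      unfolding Z_def Hc_def by (intro nn_integral_cong) (auto split: split_indicator)
    also have "(\<integral>\<^sup>+s\<in>{0..t}. ennreal ((simple_value n' \<tau>' \<xi>' s x - Hc s)\<^sup>2) \<partial>lborel) = Z' x"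
      unfolding Z'_def Hc_def by (intro nn_integral_cong) (auto split: split_indicator)
    finally show ?thesis .
  qed
  have "prob {x \<in> space M. ennreal \<delta> < D x} \<le>
      prob ({x \<in> space M. ennreal (\<delta> / 4) < Z x} \<union> {x \<in> space M. ennreal (\<delta> / 4) < Z' x})"
  proof (intro finite_measure_mono subsetI)
    fix x assume x: "x \<in> {x \<in> space M. ennreal \<delta> < D x}"
    have "ennreal (\<delta> / 4) < Z x \<or> ennreal (\<delta> / 4) < Z' x"
    proof (rule ccontr)
      assume "\<not> ?thesis"
      then have "2 * Z x + 2 * Z' x \<le> 2 * ennreal (\<delta> / 4) + 2 * ennreal (\<delta> / 4)"
        by (intro add_mono mult_left_mono) (auto simp: not_less)
      also have "2 * ennreal (\<delta> / 4) = ennreal (2 * (\<delta> / 4))" using pos by (subst ennreal_mult') auto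
      also have "\<dots> + \<dots> = ennreal \<delta>" using pos by (subst ennreal_plus[symmetric]) auto
      finally show False using D_le[of x] x by (simp add: not_le[symmetric] order.trans)
    qed
    then show "x \<in> {x \<in> space M. ennreal (\<delta> / 4) < Z x} \<union> {x \<in> space M. ennreal (\<delta> / 4) < Z' x}"
      using x by auto
  qed measurable
  also have "\<dots> \<le> prob {x \<in> space M. ennreal (\<delta> / 4) < Z x} + prob {x \<in> space M. ennreal (\<delta> / 4) < Z' x}"
    by (rule measure_Un_le) measurable
  finally show ?thesis
    using simple_process_diff_prob_bound[OF V V' t pos, of a] unfolding D_def Z_def Z'_def X_def by simp
qed

text \<open>The difference \<open>I - I'\<close> passes through the two simple integrals, hence the
  three portions of size \<open>\<epsilon>\<close>. As \<open>m\<close> grows only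
  \<open>q * \<delta> / \<epsilon>\<^sup>2\<close> remains of the bound, and \<open>\<delta>\<close>
  is free.\<close>

lemma has_ito_integral_unique:
  fixes a :: "real^'d"
  assumes t: "0 \<le> t" and I: "has_ito_integral M \<F> (\<lambda>s x. a \<bullet> B s x) H t I"
    and I': "has_ito_integral M \<F> (\<lambda>s x. a \<bullet> B s x) H t I'"
  shows "AE x in M. I x = I' x"
proof -
  define X where "X = (\<lambda>s x. a \<bullet> B s x)"
  define q where "q = a \<bullet> (\<Lambda> *v a)"
  have q: "0 \<le> q" unfolding q_def by (rule variance_nonneg)
  have H: "progressively_measurable \<F> H" and [measurable]: "I \<in> borel_measurable M" "I' \<in> borel_measurable M"
    using I I' by (auto simp: has_ito_integral_def)
  obtain n \<tau> \<xi> where V: "\<And>m. simple_process \<F> (n m) (\<tau> m) (\<xi> m)"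
    and Z: "tends_to_0_in_probability M (\<lambda>m x. sq_dist (simple_value (n m) (\<tau> m) (\<xi> m)) H t x)"
    and J: "tends_to_0_in_probability M
          (\<lambda>m x. ennreal \<bar>simple_integral X (n m) (\<tau> m) (\<xi> m) t x - I x\<bar>)"
    using I unfolding has_ito_integral_def X_def by blast
  obtain n' \<tau>' \<xi>' where V': "\<And>m. simple_process \<F> (n' m) (\<tau>' m) (\<xi>' m)"
    and Z': "tends_to_0_in_probability M (\<lambda>m x. sq_dist (simple_value (n' m) (\<tau>' m) (\<xi>' m)) H t x)"
    and J': "tends_to_0_in_probability M
          (\<lambda>m x. ennreal \<bar>simple_integral X (n' m) (\<tau>' m) (\<xi>' m) t x - I' x\<bar>)"
    using I' unfolding has_ito_integral_def X_def by blast
  let ?J = "\<lambda>m. simple_integral X (n m) (\<tau> m) (\<xi> m) t" and ?J' = "\<lambda>m. simple_integral X (n' m) (\<tau>' m) (\<xi>' m) t"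
  have [measurable]: "?J m \<in> borel_measurable M"
    "?J' m \<in> borel_measurable M" for m
    unfolding X_def by (rule simple_integral_measurable[OF V t] simple_integral_measurable[OF V' t])+
  have le: "prob {x \<in> space M. 3 * \<epsilon> < \<bar>I x - I' x\<bar>} \<le> q * \<delta> / \<epsilon>\<^sup>2" if pos: "0 < \<epsilon>" "0 < \<delta>" for \<epsilon> \<delta>
  proof -
    define J1 where "J1 m = {x \<in> space M. ennreal \<epsilon> < ennreal \<bar>?J m x - I x\<bar>}" for m
    define J2 where "J2 m = {x \<in> space M. ennreal \<epsilon> < ennreal \<bar>?J' m x - I' x\<bar>}" for m
    define J3 where "J3 m = {x \<in> space M. \<epsilon> <
      \<bar>?J m x - ?J' m x\<bar>}" for m
    define Z1 where "Z1 m = prob {x \<in> space M. ennreal (\<delta> / 4) < (sq_dist (simple_value (n m) (\<tau> m) (\<xi> m)) H t x)}" for m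
    define Z2 where "Z2 m = prob {x \<in> space M. ennreal (\<delta> / 4) < (sq_dist (simple_value (n' m) (\<tau>' m) (\<xi>' m)) H t x)}" for m
    have [measurable]: "J1 m \<in> events" "J2 m \<in> events" "J3 m \<in> events" for m
      unfolding J1_def J2_def J3_def by measurable
    have "prob {x \<in> space M. 3 * \<epsilon> < \<bar>I x - I' x\<bar>} \<le> prob (J1 m) + prob (J2 m) + (q * \<delta> / \<epsilon>\<^sup>2 + Z1 m + Z2 m)" for m
    proof -
      have "prob {x \<in> space M. 3 * \<epsilon> < \<bar>I x - I' x\<bar>} \<le> prob (J1 m \<union> J2 m \<union> J3 m)"
        using pos by (intro finite_measure_mono subsetI) (auto simp: J1_def J2_def J3_def ennreal_less_iff)
      also have "\<dots> \<le> prob (J1 m \<union> J2 m) + prob (J3 m)" by (rule measure_Un_le) measurable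
      also have "prob (J1 m \<union> J2 m) \<le> prob (J1 m) + prob (J2 m)" by (rule measure_Un_le) measurable
      also have "prob (J3 m) \<le> q * \<delta> / \<epsilon>\<^sup>2 + Z1 m + Z2 m"
        unfolding J3_def Z1_def Z2_def q_def X_def by (rule simple_process_prob_bound[OF V V' t H pos])
      finally show ?thesis by simp
    qed
    moreover have "(\<lambda>m. prob (J1 m) + prob (J2 m) + (q * \<delta> / \<epsilon>\<^sup>2 + Z1 m + Z2 m)) \<longlonglongrightarrow> 0 + 0 + (q * \<delta> / \<epsilon>\<^sup>2 + 0 + 0)"
      using Z Z' J J' pos unfolding tends_to_0_in_probability_def J1_def J2_def Z1_def Z2_def
      by (intro tendsto_intros) auto
    ultimately show ?thesis by (intro LIMSEQ_le_const[of _ _ "prob _"]) auto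
  qed
  have "prob {x \<in> space M. 3 * \<epsilon> < \<bar>I x - I' x\<bar>} = 0" if "0 < \<epsilon>" for \<epsilon>
  proof (rule ccontr)
    assume "prob {x \<in> space M. 3 * \<epsilon> < \<bar>I x - I' x\<bar>} \<noteq> 0" (is "?p \<noteq> 0")
    then have p: "?p > 0" using measure_nonneg[of M "{x \<in> space M. 3 * \<epsilon> < \<bar>I x - I' x\<bar>}"] by linarith
    \<comment> \<open>This choice of \<open>\<delta>\<close> makes the bound the fraction
      \<open>q / (q + 1)\<close> of \<open>?p\<close> itself, which is impossible for
      \<open>?p > 0\<close>; the 1 in the denominator covers the degenerate case
      \<open>q = 0\<close>.\<close>
    have "?p \<le> q * (?p * \<epsilon>\<^sup>2 / (q + 1)) / \<epsilon>\<^sup>2"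
      using p q that by (intro le) (auto intro!: divide_pos_pos mult_pos_pos)
    also have "\<dots> = ?p * (q / (q + 1))" using that by simp
    also have "\<dots> < ?p * 1" using p q by (intro mult_strict_left_mono) auto
    finally show False by simp
  qed
  then have "AE x in M. \<not> 3 * inverse (real (Suc k)) < \<bar>I x - I' x\<bar>" for k
    by (subst prob_Collect_eq_0[symmetric]) auto
  then have "AE x in M. \<forall>k. \<not> 3 * inverse (real (Suc k)) < \<bar>I x - I' x\<bar>"
    by (simp add: AE_all_countable)
  then show ?thesis
  proof eventually_elim
    case (elim x)
    show ?case
    proof (rule ccontr)
      assume "I x \<noteq> I' x"
      then have "\<bar>I x - I' x\<bar> / 3 > 0" by simp
      from reals_Archimedean[OF this] obtain k where "inverse (real (Suc k)) < \<bar>I x - I' x\<bar> / 3" by blast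
      with elim[rule_format, of k] show False by simp
    qed
  qed
qed

end

section \<open>Existence of the Ito integral of a continuous adapted process\<close>

text \<open>Coefficients of simple processes must be bounded over the sample space, whereas a
  continuous adapted process is in general bounded only on each path.\<close>

definition clip :: "real \<Rightarrow> real \<Rightarrow> real" where
  "clip c x = max (- c) (min c x)"

lemma clip_measurable [measurable]: "clip c \<in> borel_measurable borel"
  unfolding clip_def[abs_def] by measurable

lemma clip_eq: "\<bar>x\<bar> \<le> c \<Longrightarrow> clip c x = x"
  by (auto simp: clip_def)

lemma abs_clip_le: "0 \<le> c \<Longrightarrow> \<bar>clip c x\<bar> \<le> c" "0 \<le> c \<Longrightarrow> \<bar>clip c x\<bar> \<le> \<bar>x\<bar>"
  by (auto simp: clip_def)

text \<open>A convergent sequence is bounded, so a clipping level tending to infinity is eventually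
  inactive.\<close>

lemma tendsto_clip:
  assumes "x \<longlonglongrightarrow> l"
  shows "(\<lambda>m. clip (real m) (x m)) \<longlonglongrightarrow> l"
proof -
  have "Bseq x" using assms by (intro convergent_imp_Bseq convergentI)
  then obtain K where K: "\<And>m. \<bar>x m\<bar> \<le> K" unfolding Bseq_def by auto
  obtain N where "K \<le> real N" using real_arch_simple by blast
  then have "\<forall>\<^sub>F m in sequentially. x m = clip (real m) (x m)"
    unfolding eventually_sequentially using K
    by (intro exI[of _ N] allI impI clip_eq[symmetric]) (meson of_nat_le_iff order.trans)
  then show ?thesis using assms by (rule Lim_transform_eventually[rotated])
qed

definition dyadic :: "real \<Rightarrow> nat \<Rightarrow> nat \<Rightarrow> real" where
  "dyadic t m k = t * real k / 2 ^ m"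

lemma dyadic_simps [simp]: "dyadic t m 0 = 0" "dyadic t m (2 ^ m) = t"
  by (simp_all add: dyadic_def)

lemma dyadic_diff: "dyadic t m (Suc k) - dyadic t m k = t / 2 ^ m"
  by (simp add: dyadic_def field_simps)

lemma dyadic_nonneg [simp]: "0 \<le> t \<Longrightarrow> 0 \<le> dyadic t m k"
  by (simp add: dyadic_def)

lemma dyadic_mono: "0 \<le> t \<Longrightarrow> dyadic t m k \<le> dyadic t m (Suc k)"
  by (simp add: dyadic_def divide_right_mono mult_left_mono)

lemma dyadic_less: "0 < t \<Longrightarrow> dyadic t m k < dyadic t m (Suc k)"
  by (simp add: dyadic_def divide_strict_right_mono)

lemma dyadic_le: "0 \<le> t \<Longrightarrow> k \<le> 2 ^ m \<Longrightarrow> dyadic t m k \<le> t"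
  unfolding dyadic_def
  by (metis divide_le_eq mult_left_mono of_nat_le_iff of_nat_numeral of_nat_power zero_less_numeral zero_less_power)

lemma dyadic_interval_ex:
  assumes "0 < s" "s \<le> t"
  shows "\<exists>k<2 ^ m. s \<in> {dyadic t m k<..dyadic t m (Suc k)}"
proof -
  have t: "t > 0" using assms by simp
  define y where "y = s * 2 ^ m / t"
  have y: "0 < y" "y \<le> 2 ^ m" using assms t by (auto simp: y_def field_simps)
  \<comment> \<open>The ceiling minus 1, not the floor: cells are closed on the right, so a
    partition point belongs to the cell that ends there.\<close>
  define k where "k = nat (\<lceil>y\<rceil> - 1)"
  have "\<lceil>y\<rceil> \<ge> 1" using y by (simp add: one_le_ceiling)
  then have rk: "real k = of_int \<lceil>y\<rceil> - 1" by (simp add: k_def)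
  then have k: "real k < y" "y \<le> real (Suc k)" by linarith+
  have "real k < 2 ^ m" using k(1) y(2) by linarith
  then have "k < 2 ^ m" by (metis of_nat_less_iff of_nat_numeral of_nat_power)
  moreover have "dyadic t m k < s" "s \<le> dyadic t m (Suc k)"
    using k t by (auto simp: dyadic_def y_def field_simps)
  ultimately show ?thesis by auto
qed

lemma simple_value_eq:
  assumes \<tau>: "\<And>k. k < n \<Longrightarrow> \<tau> k < \<tau> (Suc k)" and k: "k < n" "s \<in> {\<tau> k<..\<tau> (Suc k)}"
  shows "simple_value n \<tau> \<xi> s x = \<xi> k x"
proof -
  have le: "\<tau> i \<le> \<tau> j" if "i \<le> j" "j \<le> n" for i j
    using that(1,2)
  proof (induction j rule: dec_induct)
    case (step m)
    then show ?case using \<tau>[of m] by simp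
  qed simp
  have "simple_value n \<tau> \<xi> s x = (\<Sum>j<n. if j = k then \<xi> k x else 0)"
    unfolding simple_value_def
  proof (intro sum.cong refl)
    fix j assume "j \<in> {..<n}"
    then show "\<xi> j x * indicator {\<tau> j<..\<tau> (Suc j)} s = (if j = k then \<xi> k x else 0)"
      using k le[of "Suc k" j] le[of "Suc j" k] by (cases j k rule: linorder_cases) auto
  qed
  then show ?thesis using k by simp
qed

lemma continuous_on_Icc_bounded:
  fixes g :: "real \<Rightarrow> real"
  assumes "continuous_on {a..b} g"
  obtains K where "\<And>s. s \<in> {a..b} \<Longrightarrow> \<bar>g s\<bar> \<le> K"
proof -
  have "bounded (g ` {a..b})"
    by (intro compact_imp_bounded compact_continuous_image assms compact_Icc)
  then obtain K where "\<forall>x\<in>g ` {a..b}. norm x \<le> K" unfolding bounded_iff by blast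
  then show ?thesis by (intro that[of K]) auto
qed

text \<open>Left endpoints of the cells around \<open>s\<close> converge to \<open>s\<close>, which
  gives pointwise convergence by continuity; a bound for \<open>g\<close> on \<open>[0, t]\<close>
  also bounds the clipped values and supplies the dominating function.\<close>

lemma dyadic_approximation:
  fixes g :: "real \<Rightarrow> real"
  assumes t: "0 \<le> t" and g: "continuous_on {0..t} g"
  shows "(\<lambda>m. \<integral>\<^sup>+s\<in>{0..t}. ennreal ((simple_value (if t = 0 then 0 else 2 ^ m) (dyadic t m)
    (\<lambda>k _. clip (real m) (g (dyadic t m k))) s x - g s)\<^sup>2) \<partial>lborel) \<longlonglongrightarrow> 0"
proof (cases "t = 0")
  case True
  have "(\<integral>\<^sup>+s\<in>{0..0}. ennreal ((c s)\<^sup>2) \<partial>lborel) = 0" for c :: "real \<Rightarrow> real"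
  proof -
    have "AE s in lborel. s \<noteq> (0::real)" by (rule AE_lborel_singleton)
    then have "AE s in lborel. ennreal ((c s)\<^sup>2) * indicator {0..0} s = 0"
      by eventually_elim auto
    then show ?thesis by (subst nn_integral_cong_AE[where v = "\<lambda>_. 0"]) auto
  qed
  then show ?thesis using True by simp
next
  case False
  then have t: "0 < t" using assms(1) by simp
  define V where "V m s = simple_value (2 ^ m) (dyadic t m) (\<lambda>k _. clip (real m) (g (dyadic t m k))) s x" for m s
  obtain K where K: "\<And>s. s \<in> {0..t} \<Longrightarrow> \<bar>g s\<bar> \<le> K"
    using continuous_on_Icc_bounded[OF g] by blast
  \<comment> \<open>A continuous extension to the whole line, for Borel measurability; it agrees
    with \<open>g\<close> on \<open>[0, t]\<close>.\<close>
  define gc where "gc s = g (max 0 (min t s))" for s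
  have gc: "continuous_on UNIV gc"
    unfolding gc_def using t by (intro continuous_on_compose2[OF g] continuous_intros) auto
  have [measurable]: "gc \<in> borel_measurable borel"
    using gc by (rule borel_measurable_continuous_onI)
  have [measurable]: "V m \<in> borel_measurable borel" for m
    unfolding V_def[abs_def] simple_value_def by measurable
  have ex: "\<exists>k<2 ^ m. s \<in> {dyadic t m k<..dyadic t m (Suc k)} \<and> V m s = clip (real m) (g (dyadic t m k))"
    if "0 < s" "s \<le> t" for m s
    using dyadic_interval_ex[OF that, of m] simple_value_eq[of "2 ^ m" "dyadic t m"] dyadic_less[OF t]
    unfolding V_def by metis
  have V_lim: "(\<lambda>m. V m s) \<longlonglongrightarrow> g s" if s: "0 < s" "s \<le> t" for s
  proof -
    obtain k where k: "\<And>m. k m < 2 ^ m" "\<And>m. s \<in> {dyadic t m (k m)<..dyadic t m (Suc (k m))}"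
      "\<And>m. V m s = clip (real m) (g (dyadic t m (k m)))"
      using ex[OF s] by metis
    have "(\<lambda>m. dyadic t m (k m)) \<longlonglongrightarrow> s"
    proof (rule real_tendsto_sandwich[OF always_eventually always_eventually])
      have "s - t / 2 ^ m \<le> dyadic t m (k m)" "dyadic t m (k m) \<le> s" for m
        using k(2)[of m] dyadic_diff[of t m "k m"] by auto
      then show "\<forall>m. s - t / 2 ^ m \<le> dyadic t m (k m)" "\<forall>m. dyadic t m (k m) \<le> s" by blast+
      have "(\<lambda>m. s - t * (1 / 2) ^ m) \<longlonglongrightarrow> s - t * 0"
        by (intro tendsto_intros LIMSEQ_realpow_zero) auto
      then show "(\<lambda>m. s - t / 2 ^ m) \<longlonglongrightarrow> s" by (simp add: power_divide)
    qed simp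
    moreover have "dyadic t m (k m) \<in> {0..t}" for m
      using dyadic_le[of t "k m" m] k(1)[of m] t by simp
    ultimately have "(\<lambda>m. g (dyadic t m (k m))) \<longlonglongrightarrow> g s"
      using s by (intro continuous_on_tendsto_compose[OF g]) auto
    then show ?thesis unfolding k(3) by (rule tendsto_clip)
  qed
  have "(\<lambda>m. \<integral>\<^sup>+s. ennreal ((V m s - gc s)\<^sup>2) * indicator {0..t} s \<partial>lborel) \<longlonglongrightarrow> (\<integral>\<^sup>+s. 0 \<partial>(lborel::real measure))"
  proof (rule nn_integral_dominated_convergence[where w = "\<lambda>s. ennreal ((2 * K)\<^sup>2) * indicator {0..t} s"])
    \<comment> \<open>The point 0 lies in no left-open cell, so the step function is 0 there
      whatever \<open>g 0\<close> is; it is excluded as a null set.\<close>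
    have nz: "AE s in lborel. s \<noteq> (0::real)" by (rule AE_lborel_singleton)
    show "AE s in lborel. ennreal ((V m s - gc s)\<^sup>2) * indicator {0..t} s \<le> ennreal ((2 * K)\<^sup>2) * indicator {0..t} s" for m
      using nz
    proof eventually_elim
      case (elim s)
      show ?case
      proof (cases "s \<in> {0..t}")
        case True
        then have s: "0 < s" "s \<le> t" using elim by auto
        obtain k where k: "k < 2 ^ m" "V m s = clip (real m) (g (dyadic t m k))" using ex[OF s] by metis
        have "\<bar>V m s\<bar> \<le> K"
          unfolding k(2) using dyadic_le[of t k m] k(1) t
          by (intro order.trans[OF abs_clip_le(2) K]) auto
        moreover have "\<bar>gc s\<bar> \<le> K" unfolding gc_def using t by (intro K) auto
        ultimately have "\<bar>V m s - gc s\<bar> \<le> \<bar>2 * K\<bar>" by linarith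
        then have "(V m s - gc s)\<^sup>2 \<le> (2 * K)\<^sup>2" by (simp only: abs_le_square_iff)
        then show ?thesis using True by (simp add: ennreal_leI)
      qed simp
    qed
    show "(\<integral>\<^sup>+s. ennreal ((2 * K)\<^sup>2) * indicator {0..t} s \<partial>lborel) < \<infinity>"
      using t by (simp add: nn_integral_cmult_indicator ennreal_mult_less_top)
    show "AE s in lborel. (\<lambda>m. ennreal ((V m s - gc s)\<^sup>2) * indicator {0..t} s) \<longlonglongrightarrow> 0"
      using nz
    proof eventually_elim
      case (elim s)
      show ?case
      proof (cases "s \<in> {0..t}")
        case True
        then have s: "0 < s" "s \<le> t" using elim by auto
        then have "gc s = g s" by (simp add: gc_def)
        have "(\<lambda>m. ennreal ((V m s - g s)\<^sup>2)) \<longlonglongrightarrow> ennreal ((g s - g s)\<^sup>2)"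
          by (intro tendsto_ennrealI tendsto_intros V_lim s)
        then show ?thesis using True \<open>gc s = g s\<close> by simp
      qed simp
    qed
  qed measurable
  moreover have "(\<integral>\<^sup>+s. ennreal ((V m s - gc s)\<^sup>2) * indicator {0..t} s \<partial>lborel) =
     (\<integral>\<^sup>+s. ennreal ((V m s - g s)\<^sup>2) * indicator {0..t} s \<partial>lborel)" for m
    by (intro nn_integral_cong) (auto simp: gc_def split: split_indicator)
  ultimately show ?thesis using False by (simp add: V_def)
qed

section \<open>Almost sure convergence and convergence in probability\<close>

lemma (in prob_space) tends_to_0_in_probability_AE:
  assumes [measurable]: "\<And>m. Z m \<in> borel_measurable M"
    and lim: "AE x in M. (\<lambda>m. Z m x) \<longlonglongrightarrow> 0"
  shows "tends_to_0_in_probability M Z"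
  unfolding tends_to_0_in_probability_def
proof (intro allI impI)
  fix \<epsilon> :: real assume \<epsilon>: "0 < \<epsilon>"
  define A where "A m = {x \<in> space M. ennreal \<epsilon> < Z m x}" for m
  have [measurable]: "A m \<in> events" for m unfolding A_def by measurable
  have "(\<lambda>m. expectation (\<lambda>x. indicat_real (A m) x)) \<longlonglongrightarrow> expectation (\<lambda>_. 0)"
  proof (rule integral_dominated_convergence[where w = "\<lambda>_. 1"])
    show "AE x in M. (\<lambda>m. indicat_real (A m) x) \<longlonglongrightarrow> 0"
      using lim
    proof eventually_elim
      case (elim x)
      have "\<forall>\<^sub>F m in sequentially. Z m x < ennreal \<epsilon>"
        using elim \<epsilon> by (intro order_tendstoD(2)[OF elim]) simp
      then have "\<forall>\<^sub>F m in sequentially. indicat_real (A m) x = 0"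
        by eventually_elim (auto simp: A_def indicator_def)
      then show ?case by (rule tendsto_eventually)
    qed
  qed (auto simp: indicator_def)
  then show "(\<lambda>m. prob {x \<in> space M. ennreal \<epsilon> < Z m x}) \<longlonglongrightarrow> 0" by (simp add: A_def[symmetric])
qed

lemma convergent_if_geometric_increments:
  fixes x :: "nat \<Rightarrow> real"
  assumes "\<forall>\<^sub>F m in sequentially. \<bar>x (Suc m) - x m\<bar> \<le> (1 / 2) ^ m"
  shows "convergent x"
proof -
  have "summable (\<lambda>m. x (Suc m) - x m)"
    by (rule summable_comparison_test_ev[of _ "\<lambda>m. (1 / 2) ^ m"])
       (use assms in \<open>auto simp: summable_geometric\<close>)
  then have "convergent (\<lambda>m. \<Sum>k<m. x (Suc k) - x k)" by (simp add: summable_iff_convergent)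
  then have "convergent (\<lambda>m. (x m - x 0) + x 0)"
    unfolding sum_lessThan_telescope by (intro convergent_add convergent_const)
  then show ?thesis by simp
qed

text \<open>Along a fast enough subsequence, increments above \<open>(1 / 2) ^ m\<close> have
  probability at most \<open>(1 / 2) ^ m\<close>, so Borel-Cantelli makes the increments eventually
  geometric. One subsequence serves all the finitely many \<open>i\<close>, because the limits are
  to be added up.\<close>

lemma (in prob_space) AE_convergent_subsequence:
  fixes J :: "'i::finite \<Rightarrow> nat \<Rightarrow> 'a \<Rightarrow> real"
  assumes [measurable]: "\<And>i m. J i m \<in> borel_measurable M"
    and cauchy: "\<And>i \<epsilon> e. 0 < \<epsilon> \<Longrightarrow> 0 < e \<Longrightarrow>
      \<exists>N. \<forall>p\<ge>N. \<forall>q\<ge>N. prob {x \<in> space M. \<epsilon> < \<bar>J i p x - J i q x\<bar>} \<le> e"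
  shows "\<exists>r. strict_mono r \<and> (\<forall>i. AE x in M. convergent (\<lambda>m. J i (r m) x))"
proof -
  have "\<exists>N. \<forall>p\<ge>N. \<forall>q\<ge>N. prob {x \<in> space M. (1 / 2) ^ m < \<bar>J i p x - J i q x\<bar>} \<le> (1 / 2) ^ m" for i m
    by (rule cauchy) auto
  note ex_N = this
  define N where "N i m = (SOME N. \<forall>p\<ge>N. \<forall>q\<ge>N.
    prob {x \<in> space M. (1 / 2) ^ m < \<bar>J i p x - J i q x\<bar>} \<le> (1 / 2) ^ m)" for i m
  have N: "prob {x \<in> space M. (1 / 2) ^ m < \<bar>J i p x - J i q x\<bar>} \<le> (1 / 2) ^ m"
    if "N i m \<le> p" "N i m \<le> q" for i m p q
    using someI_ex[OF ex_N[of m i]] that unfolding N_def by simp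
  \<comment> \<open>The sum dominates every threshold \<open>N i m\<close> and is nondecreasing in
    \<open>m\<close>; the added \<open>m\<close> makes it strictly increasing.\<close>
  define r where "r m = (\<Sum>j\<le>m. \<Sum>i\<in>UNIV. N i j) + m" for m
  have "strict_mono r" by (rule strict_monoI_Suc) (simp add: r_def)
  have r: "N i m \<le> r m" for i m
  proof -
    have "N i m \<le> (\<Sum>i\<in>UNIV. N i m)" by (rule member_le_sum) auto
    also have "\<dots> \<le> (\<Sum>j\<le>m. \<Sum>i\<in>UNIV. N i j)" by (rule member_le_sum) auto
    finally show ?thesis by (simp add: r_def)
  qed
  have "AE x in M. convergent (\<lambda>m. J i (r m) x)" for i
  proof -
    define A where "A m = {x \<in> space M. (1 / 2) ^ m < \<bar>J i (r (Suc m)) x - J i (r m) x\<bar>}" for m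
    have [measurable]: "A m \<in> events" for m unfolding A_def by measurable
    have A_le: "prob (A m) \<le> (1 / 2) ^ m" for m
      unfolding A_def using r[of i m] strict_monoD[OF \<open>strict_mono r\<close>, of m "Suc m"]
      by (intro N) auto
    have "summable (\<lambda>m. (1 / 2 :: real) ^ m)" by (rule summable_geometric) simp
    then have A_sum: "summable (\<lambda>m. prob (A m))"
    proof (rule summable_comparison_test'[where N = 0])
      show "norm (prob (A m)) \<le> (1 / 2) ^ m" for m using A_le[of m] by simp
    qed
    have "AE x in M. \<forall>\<^sub>F m in sequentially. x \<in> space M - A m"
    proof (rule borel_cantelli_AE1[OF _ _ A_sum])
      show "A m \<in> events" for m by measurable
      show "emeasure M (A m) < \<infinity>" for m by (simp add: emeasure_eq_measure)
    qed
    then show ?thesis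
    proof eventually_elim
      case (elim x)
      then have "\<forall>\<^sub>F m in sequentially. \<bar>J i (r (Suc m)) x - J i (r m) x\<bar> \<le> (1 / 2) ^ m"
        by eventually_elim (auto simp: A_def)
      then show ?case by (rule convergent_if_geometric_increments)
    qed
  qed
  with \<open>strict_mono r\<close> show ?thesis by blast
qed

context filtered_brownian_motion
begin

text \<open>At times rounded down to a grid the process is glued from countably many measurable
  pieces; continuity of paths recovers it as the mesh tends to 0.\<close>

lemma progressively_measurable_continuous:
  assumes H: "\<And>s. 0 \<le> s \<Longrightarrow> H s \<in> borel_measurable (\<F> s)"
    and cont: "\<And>x. x \<in> space M \<Longrightarrow> continuous_on {0..} (\<lambda>s. H s x)"
  shows "progressively_measurable \<F> H"
  unfolding progressively_measurable_def split_beta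
proof (intro allI impI)
  fix u :: real assume u: "0 \<le> u"
  define N where "N = restrict_space borel {0..u} \<Otimes>\<^sub>M \<F> u"
  \<comment> \<open>The clamp acts on no actual grid approximation of a point of
    \<open>[0, u]\<close>, but it makes the piece for every integer value of the floor a variable at
    a time in \<open>[0, u]\<close>, hence measurable for \<open>\<F> u\<close>.\<close>
  define \<rho> where "\<rho> n p = max 0 (min u (real_of_int \<lfloor>real (Suc n) * fst p\<rfloor> / real (Suc n)))"
    for n and p :: "real \<times> 'a"
  have fst_N [measurable]: "fst \<in> borel_measurable N"
  proof -
    have "(\<lambda>x. x) \<in> restrict_space borel {0..u} \<rightarrow>\<^sub>M (borel :: real measure)"
      by (rule measurable_restrict_space1) simp
    from measurable_compose[OF measurable_fst this] show ?thesis unfolding N_def .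
  qed
  have snd_N: "snd \<in> N \<rightarrow>\<^sub>M \<F> u" unfolding N_def by (rule measurable_snd)
  have sp: "fst p \<in> {0..u}" "snd p \<in> space M" if "p \<in> space N" for p
    using that by (auto simp: N_def space_pair_measure space_restrict_space)
  show "(\<lambda>p. H (fst p) (snd p)) \<in> borel_measurable (restrict_space borel {0..u} \<Otimes>\<^sub>M \<F> u)"
    unfolding N_def[symmetric]
  proof (rule borel_measurable_LIMSEQ_real[where u = "\<lambda>n p. H (\<rho> n p) (snd p)"])
    fix p assume p: "p \<in> space N"
    have "(\<lambda>n. \<rho> n p) \<longlonglongrightarrow> fst p"
    proof (rule real_tendsto_sandwich[OF always_eventually always_eventually])
      have fl: "fst p - inverse (real (Suc n)) \<le> real_of_int \<lfloor>real (Suc n) * fst p\<rfloor> / real (Suc n)"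
        "real_of_int \<lfloor>real (Suc n) * fst p\<rfloor> / real (Suc n) \<le> fst p" for n
      proof -
        have f: "real (Suc n) * fst p - 1 \<le> real_of_int \<lfloor>real (Suc n) * fst p\<rfloor>"
          "real_of_int \<lfloor>real (Suc n) * fst p\<rfloor> \<le> real (Suc n) * fst p" by linarith+
        have "fst p - inverse (real (Suc n)) = (real (Suc n) * fst p - 1) / real (Suc n)"
          by (simp add: field_simps)
        also have "\<dots> \<le> real_of_int \<lfloor>real (Suc n) * fst p\<rfloor> / real (Suc n)"
          by (rule divide_right_mono[OF f(1)]) simp
        finally show "fst p - inverse (real (Suc n)) \<le> real_of_int \<lfloor>real (Suc n) * fst p\<rfloor> / real (Suc n)" .
        show "real_of_int \<lfloor>real (Suc n) * fst p\<rfloor> / real (Suc n) \<le> fst p"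
          using f(2) by (simp add: pos_divide_le_eq mult.commute del: of_nat_Suc)
      qed
      have "fst p - inverse (real (Suc n)) \<le> \<rho> n p" for n
        using fl[of n] sp(1)[OF p] unfolding \<rho>_def by (auto simp: le_max_iff_disj)
      then show "\<forall>n. fst p - inverse (real (Suc n)) \<le> \<rho> n p" by blast
      have "\<rho> n p \<le> fst p" for n
        using fl[of n] sp(1)[OF p] unfolding \<rho>_def by auto
      then show "\<forall>n. \<rho> n p \<le> fst p" by blast
      have "(\<lambda>n. fst p - inverse (real (Suc n))) \<longlonglongrightarrow> fst p - 0"
        by (intro tendsto_intros LIMSEQ_inverse_real_of_nat)
      then show "(\<lambda>n. fst p - inverse (real (Suc n))) \<longlonglongrightarrow> fst p" by simp
    qed simp
    then show "(\<lambda>n. H (\<rho> n p) (snd p)) \<longlonglongrightarrow> H (fst p) (snd p)"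
      using sp[OF p] by (intro continuous_on_tendsto_compose[OF cont[OF sp(2)[OF p]]]) (auto simp: \<rho>_def)
  next
    fix n
    have "(\<lambda>p. H (max 0 (min u (real_of_int \<lfloor>real (Suc n) * fst p\<rfloor> / real (Suc n)))) (snd p))
        \<in> borel_measurable N"
    proof (rule measurable_compose_countable[where f = "\<lambda>i p. H (max 0 (min u (real_of_int i / real (Suc n)))) (snd p)"
          and g = "\<lambda>p. \<lfloor>real (Suc n) * fst p\<rfloor>"])
      fix i :: int
      have "H (max 0 (min u (real_of_int i / real (Suc n)))) \<in> borel_measurable (\<F> u)"
        using u by (intro measurable_F_mono[OF H]) auto
      from measurable_compose[OF snd_N this]
      show "(\<lambda>p. H (max 0 (min u (real_of_int i / real (Suc n)))) (snd p)) \<in> borel_measurable N" .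
    qed measurable
    then show "(\<lambda>p. H (\<rho> n p) (snd p)) \<in> borel_measurable N" by (simp add: \<rho>_def)
  qed
qed

text \<open>The partition points of a simple process are strictly increasing, whence the empty partition
  for \<open>t = 0\<close>.\<close>

lemma simple_process_dyadic:
  assumes H: "\<And>s. 0 \<le> s \<Longrightarrow> H s \<in> borel_measurable (\<F> s)" and t: "0 \<le> t"
  shows "simple_process \<F> (if t = 0 then 0 else 2 ^ m) (dyadic t m) (\<lambda>k x. clip (real m) (H (dyadic t m k) x))"
proof -
  have "(\<lambda>x. clip (real m) (H (dyadic t m k) x)) \<in> borel_measurable (\<F> (dyadic t m k))" for k
    using H[OF dyadic_nonneg[OF t]] by measurable
  moreover have "bounded ((\<lambda>x. clip (real m) (H (dyadic t m k) x)) ` space M)" for k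
    unfolding bounded_iff by (intro exI[of _ "real m"]) (auto simp: abs_clip_le)
  ultimately show ?thesis
    using t by (auto simp: simple_process_def dyadic_less)
qed

abbreviation dyadic_incr :: "real \<Rightarrow> nat \<Rightarrow> nat \<Rightarrow> 'a \<Rightarrow> real^'d" where
  "dyadic_incr t m k x \<equiv> B (dyadic t m (Suc k)) x - B (dyadic t m k) x"

text \<open>Left endpoints keep each coefficient measurable when its increment starts. The level of
  clipping grows with \<open>m\<close>, so every sum is an admissible simple integral and an
  unbounded \<open>H\<close> is still approximated.\<close>

definition dyadic_sum :: "(real \<Rightarrow> 'a \<Rightarrow> real) \<Rightarrow> real^'d \<Rightarrow> real \<Rightarrow> nat \<Rightarrow> 'a \<Rightarrow> real" where
  "dyadic_sum H a t m x = (\<Sum>k<2 ^ m. clip (real m) (H (dyadic t m k) x) *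
     (a \<bullet> dyadic_incr t m k x))"

lemma simple_integral_dyadic:
  assumes t: "0 \<le> t"
  shows "simple_integral (\<lambda>s x. a \<bullet> B s x) (if t = 0 then 0 else 2 ^ m) (dyadic t m)
    (\<lambda>k x. clip (real m) (H (dyadic t m k) x)) t x = dyadic_sum H a t m x"
proof (cases "t = 0")
  case True
  then show ?thesis by (simp add: simple_integral_def dyadic_sum_def dyadic_def)
next
  case False
  have "min t (dyadic t m k) = dyadic t m k" if "k \<le> 2 ^ m" for k
    using dyadic_le[OF t that] by simp
  then show ?thesis
    using False by (auto simp: simple_integral_def dyadic_sum_def inner_diff_right intro!: sum.cong)
qed

text \<open>The dyadic sums are Cauchy in probability, so a common subsequence converges almost
  surely. Its limit satisfies the specification of the integral with the same simple processes as
  witnesses; hence the chosen version satisfies it as well, and uniqueness identifies the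
  two.\<close>

lemma ito_integral_subsequence:
  fixes H :: "'i::finite \<Rightarrow> real \<Rightarrow> 'a \<Rightarrow> real" and a :: "'i \<Rightarrow> real^'d"
  assumes H: "\<And>i s. 0 \<le> s \<Longrightarrow> H i s \<in> borel_measurable (\<F> s)"
    and cont: "\<And>i x. x \<in> space M \<Longrightarrow> continuous_on {0..} (\<lambda>s. H i s x)" and t: "0 \<le> t"
  shows "\<exists>r. strict_mono r \<and> (\<forall>i. AE x in M.
    (\<lambda>m. dyadic_sum (H i) (a i) t (r m) x) \<longlonglongrightarrow> ito_integral M \<F> (\<lambda>s x. a i \<bullet> B s x) (H i) t x)"
proof -
  define n :: "nat \<Rightarrow> nat" where "n m = (if t = 0 then 0 else 2 ^ m)" for m
  define \<xi> where "\<xi> i m k x = clip (real m) (H i (dyadic t m k) x)" for i m k x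
  have V: "simple_process \<F> (n m) (dyadic t m) (\<xi> i m)" for i m
    using simple_process_dyadic[of "H i" t m, OF H t] by (simp add: n_def \<xi>_def[abs_def])
  have J_eq: "simple_integral (\<lambda>s x. a i \<bullet> B s x) (n m) (dyadic t m) (\<xi> i m) t = dyadic_sum (H i) (a i) t m" for i m
    unfolding n_def \<xi>_def[abs_def] by (intro ext simple_integral_dyadic t)
  have J_meas [measurable]: "dyadic_sum (H i) (a i) t m \<in> borel_measurable M" for i m
    using simple_integral_measurable[OF V[of m i] t, of "a i"] unfolding J_eq .
  have prog: "progressively_measurable \<F> (H i)" for i
    using H cont by (rule progressively_measurable_continuous)
  define Z where "Z i m x = (sq_dist (simple_value (n m) (dyadic t m) (\<xi> i m)) (H i) t x)"
    for i m x
  have Z_meas [measurable]: "Z i m \<in> borel_measurable M" for i m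
    unfolding Z_def[abs_def] by (rule simple_process_approx_measurable[OF V prog t])
  have Z_lim: "(\<lambda>m. Z i m x) \<longlonglongrightarrow> 0" if "x \<in> space M" for i x
  proof -
    have "continuous_on {0..t} (\<lambda>s. H i s x)"
      by (rule continuous_on_subset[OF cont[OF that]]) auto
    from dyadic_approximation[OF t this, of x]
    show ?thesis by (simp add: Z_def n_def \<xi>_def simple_value_def)
  qed
  have Z_prob: "tends_to_0_in_probability M (Z i)" for i
    using Z_lim by (intro tends_to_0_in_probability_AE) auto
  have "\<exists>N. \<forall>p\<ge>N. \<forall>q\<ge>N. prob {x \<in> space M. \<epsilon> < \<bar>dyadic_sum (H i) (a i) t p x - dyadic_sum (H i) (a i) t q x\<bar>} \<le> e"
    if pos: "0 < \<epsilon>" "0 < e" for i \<epsilon> e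
  proof -
    define v where "v = a i \<bullet> (\<Lambda> *v a i)"
    have v: "0 \<le> v" unfolding v_def by (rule variance_nonneg)
    \<comment> \<open>Chosen so that the variance term of the bound is at most \<open>e / 3\<close>,
      like each of the two approximation terms; \<open>v + 1\<close> in place of \<open>v\<close>
      covers \<open>v = 0\<close>.\<close>
    define \<delta> where "\<delta> = e * \<epsilon>\<^sup>2 / (3 * (v + 1))"
    have \<delta>: "0 < \<delta>" unfolding \<delta>_def using pos v by (auto intro!: divide_pos_pos mult_pos_pos)
    have "v * \<delta> / \<epsilon>\<^sup>2 = (e / 3) * (v / (v + 1))" using pos v by (simp add: \<delta>_def)
    also have "\<dots> \<le> (e / 3) * 1" using pos v by (intro mult_left_mono) auto
    finally have \<delta>_le: "v * \<delta> / \<epsilon>\<^sup>2 \<le> e / 3" by simp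
    have "(\<lambda>m. prob {x \<in> space M. ennreal (\<delta> / 4) < Z i m x}) \<longlonglongrightarrow> 0"
      using Z_prob[of i] \<delta> by (simp add: tends_to_0_in_probability_def)
    from order_tendstoD(2)[OF this, of "e / 3"] pos
    obtain N where N: "\<And>m. m \<ge> N \<Longrightarrow> prob {x \<in> space M. ennreal (\<delta> / 4) < Z i m x} < e / 3"
      by (auto simp: eventually_sequentially)
    show ?thesis
    proof (intro exI[of _ N] allI impI)
      fix p q assume "p \<ge> N" "q \<ge> N"
      then show "prob {x \<in> space M. \<epsilon> < \<bar>dyadic_sum (H i) (a i) t p x - dyadic_sum (H i) (a i) t q x\<bar>} \<le> e"
        using simple_process_prob_bound[OF V[of p i] V[of q i] t prog[of i] pos(1) \<delta>, of "a i"] N[of p] N[of q] \<delta>_le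
        unfolding J_eq Z_def[symmetric] v_def[symmetric] by linarith
    qed
  qed
  then obtain r where r: "strict_mono r" "\<And>i. AE x in M. convergent (\<lambda>m. dyadic_sum (H i) (a i) t (r m) x)"
    using AE_convergent_subsequence[of "\<lambda>i. dyadic_sum (H i) (a i) t"] J_meas by blast
  have "AE x in M. (\<lambda>m. dyadic_sum (H i) (a i) t (r m) x) \<longlonglongrightarrow> ito_integral M \<F> (\<lambda>s x. a i \<bullet> B s x) (H i) t x" for i
  proof -
    define I where "I x = lim (\<lambda>m. dyadic_sum (H i) (a i) t (r m) x)" for x
    have I_lim: "AE x in M. (\<lambda>m. dyadic_sum (H i) (a i) t (r m) x) \<longlonglongrightarrow> I x"
      using r(2)[of i] by eventually_elim (simp add: I_def convergent_LIMSEQ_iff)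
    have [measurable]: "I \<in> borel_measurable M"
      unfolding I_def[abs_def] by (rule borel_measurable_lim_metric) measurable
    have "has_ito_integral M \<F> (\<lambda>s x. a i \<bullet> B s x) (H i) t I"
      unfolding has_ito_integral_def
    proof (intro conjI prog exI allI)
      show "AE x in M. (\<integral>\<^sup>+s\<in>{0..t}. ennreal ((H i s x)\<^sup>2) \<partial>lborel) < \<infinity>"
      proof (rule AE_I2)
        fix x assume "x \<in> space M"
        then have "continuous_on {0..t} (\<lambda>s. H i s x)"
          by (intro continuous_on_subset[OF cont]) auto
        from continuous_on_Icc_bounded[OF this]
        obtain K where K: "\<And>s. s \<in> {0..t} \<Longrightarrow> \<bar>H i s x\<bar> \<le> K" by blast
        have "(\<integral>\<^sup>+s\<in>{0..t}. ennreal ((H i s x)\<^sup>2) \<partial>lborel) \<le> (\<integral>\<^sup>+s. ennreal (K\<^sup>2) * indicator {0..t} s \<partial>lborel)"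
        proof (rule nn_integral_mono)
          fix s
          show "ennreal ((H i s x)\<^sup>2) * indicator {0..t} s \<le> ennreal (K\<^sup>2) * indicator {0..t} s"
          proof (cases "s \<in> {0..t}")
            case True
            then have "\<bar>H i s x\<bar>\<^sup>2 \<le> K\<^sup>2" by (intro power_mono K) auto
            then show ?thesis using True by (simp add: ennreal_leI)
          qed simp
        qed
        also have "\<dots> < \<infinity>" using t by (simp add: nn_integral_cmult_indicator ennreal_mult_less_top)
        finally show "(\<integral>\<^sup>+s\<in>{0..t}. ennreal ((H i s x)\<^sup>2) \<partial>lborel) < \<infinity>" .
      qed
      show "simple_process \<F> (n (r m)) (dyadic t (r m)) (\<xi> i (r m))" for m by (rule V)
      show "tends_to_0_in_probability M (\<lambda>m x. sq_dist (simple_value (n (r m)) (dyadic t (r m)) (\<xi> i (r m))) (H i) t x)"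
        unfolding Z_def[symmetric]
        using Z_lim LIMSEQ_subseq_LIMSEQ[OF _ r(1)]
        by (intro tends_to_0_in_probability_AE AE_I2) (auto simp: comp_def)
      show "tends_to_0_in_probability M (\<lambda>m x. ennreal
         \<bar>simple_integral (\<lambda>s x. a i \<bullet> B s x) (n (r m)) (dyadic t (r m)) (\<xi> i (r m)) t x - I x\<bar>)"
        unfolding J_eq
      proof (rule tends_to_0_in_probability_AE)
        show "AE x in M. (\<lambda>m. ennreal \<bar>dyadic_sum (H i) (a i) t (r m) x - I x\<bar>) \<longlonglongrightarrow> 0"
          using I_lim
        proof eventually_elim
          case (elim x)
          then have "(\<lambda>m. ennreal \<bar>dyadic_sum (H i) (a i) t (r m) x - I x\<bar>) \<longlonglongrightarrow> ennreal \<bar>I x - I x\<bar>"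
            by (intro tendsto_ennrealI tendsto_intros)
          then show ?case by simp
        qed
      qed measurable
    qed measurable
    moreover from this have "has_ito_integral M \<F> (\<lambda>s x. a i \<bullet> B s x) (H i) t
        (ito_integral M \<F> (\<lambda>s x. a i \<bullet> B s x) (H i) t)"
      unfolding ito_integral_def by (rule someI[of "\<lambda>I. has_ito_integral M \<F> (\<lambda>s x. a i \<bullet> B s x) (H i) t I" I])
    ultimately have "AE x in M. I x = ito_integral M \<F> (\<lambda>s x. a i \<bullet> B s x) (H i) t x"
      by (rule has_ito_integral_unique[OF t])
    then show ?thesis using I_lim by eventually_elim simp
  qed
  then show ?thesis by (intro exI[of _ r] conjI r(1) allI)
qed

end

section \<open>Quadratic variation and Taylor expansion\<close>

context filtered_brownian_motion
begin

lemma increment_square_moments: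
  fixes a :: "real^'d"
  assumes su: "0 \<le> s" "s \<le> u"
  defines "W \<equiv> \<lambda>x. a \<bullet> (B u x - B s x)" and "v \<equiv> (a \<bullet> (\<Lambda> *v a)) * (u - s)"
  shows "integrable M (\<lambda>x. ((W x)\<^sup>2 - v)\<^sup>2)" "expectation (\<lambda>x. (W x)\<^sup>2 - v) = 0"
    "expectation (\<lambda>x. ((W x)\<^sup>2 - v)\<^sup>2) = 2 * v\<^sup>2"
proof -
  have i: "integrable M (\<lambda>x. W x ^ k)" for k
    using increment_moments(1)[OF su, of a k] by (simp add: W_def)
  have m2: "expectation (\<lambda>x. (W x)\<^sup>2) = v" and m4: "expectation (\<lambda>x. W x ^ 4) = 3 * v\<^sup>2"
    using increment_moments(3,4)[OF su, of a] by (simp_all add: W_def v_def)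
  have eq: "((W x)\<^sup>2 - v)\<^sup>2 = W x ^ 4 - 2 * v * (W x)\<^sup>2 + v\<^sup>2" for x
    by (simp add: power2_eq_square power4_eq_xxxx algebra_simps)
  show "integrable M (\<lambda>x. ((W x)\<^sup>2 - v)\<^sup>2)" unfolding eq using i[of 2] i[of 4] by simp
  show "expectation (\<lambda>x. (W x)\<^sup>2 - v) = 0" using i[of 2] m2 by (simp add: prob_space)
  show "expectation (\<lambda>x. ((W x)\<^sup>2 - v)\<^sup>2) = 2 * v\<^sup>2"
    unfolding eq using i[of 2] i[of 4] m2 m4 by (simp add: prob_space power2_eq_square)
qed

text \<open>The second moments are summable in \<open>m\<close>, so the sum of all
  \<open>(Z m x)\<^sup>2\<close> has finite expectation and is finite almost everywhere. This yields
  convergence along the whole dyadic sequence, with no passage to a subsequence.\<close>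

lemma quadratic_variation_clipped:
  fixes a :: "real^'d" and g :: "real \<Rightarrow> 'a \<Rightarrow> real"
  assumes g: "\<And>s. 0 \<le> s \<Longrightarrow> g s \<in> borel_measurable (\<F> s)" and t: "0 \<le> t" and K: "0 \<le> K"
  shows "AE x in M. (\<lambda>m. \<Sum>k<2 ^ m. clip K (g (dyadic t m k) x) *
    ((a \<bullet> dyadic_incr t m k x)\<^sup>2 - (a \<bullet> (\<Lambda> *v a)) * (t / 2 ^ m))) \<longlonglongrightarrow> 0"
proof -
  define q where "q = a \<bullet> (\<Lambda> *v a)"
  define Y where "Y m k x = clip K (g (dyadic t m k) x)" for m k x
  define Z where "Z m x = (\<Sum>k<2 ^ m. Y m k x *
    ((a \<bullet> dyadic_incr t m k x)\<^sup>2 - q * (t / 2 ^ m)))" for m x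
  have mom: "integrable M (\<lambda>x. ((a \<bullet> dyadic_incr t m k x)\<^sup>2 - q * (t / 2 ^ m))\<^sup>2)"
    "expectation (\<lambda>x. (a \<bullet> dyadic_incr t m k x)\<^sup>2 - q * (t / 2 ^ m)) = 0"
    "expectation (\<lambda>x. ((a \<bullet> dyadic_incr t m k x)\<^sup>2 - q * (t / 2 ^ m))\<^sup>2) =
       2 * (q * (t / 2 ^ m))\<^sup>2" for m k
    using increment_square_moments[OF dyadic_nonneg dyadic_mono, OF t t, of a m k]
    unfolding dyadic_diff q_def by simp_all
  have Y_bound: "\<bar>Y m k x\<bar> \<le> K" for m k x using K by (simp add: Y_def abs_clip_le)
  have Y_meas: "Y m k \<in> borel_measurable (\<F> (dyadic t m k))" for m k
    using g[OF dyadic_nonneg[OF t]] unfolding Y_def[abs_def] by measurable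
  have Z: "Z m \<in> borel_measurable (\<F> (dyadic t m (2 ^ m))) \<and> integrable M (\<lambda>x. (Z m x)\<^sup>2) \<and>
    expectation (\<lambda>x. (Z m x)\<^sup>2) = (\<Sum>k<2 ^ m. expectation (\<lambda>x. (Y m k x)\<^sup>2) *
      expectation (\<lambda>x. ((a \<bullet> dyadic_incr t m k x)\<^sup>2 - q * (t / 2 ^ m))\<^sup>2)) \<and>
    0 \<le> dyadic t m (2 ^ m)" for m
    unfolding Z_def
    by (rule orthogonal_sum[of "dyadic t m" "2 ^ m" "Y m" "\<lambda>_. K" "\<lambda>_ x. x\<^sup>2 - q * (t / 2 ^ m)" a])
       (use t dyadic_mono Y_meas Y_bound mom in auto)
  \<comment> \<open>There are \<open>2 ^ m\<close> cells, each contributing at most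
    \<open>K\<^sup>2\<close> times the variance \<open>2 * (q * (t / 2 ^ m))\<^sup>2\<close> of a
    squared increment.\<close>
  define c where "c = 2 * K\<^sup>2 * q\<^sup>2 * t\<^sup>2"
  have EZ: "expectation (\<lambda>x. (Z m x)\<^sup>2) \<le> c * (1 / 2) ^ m" for m
  proof -
    have "expectation (\<lambda>x. (Y m k x)\<^sup>2) \<le> K\<^sup>2" for k
      by (rule expectation_square_bounded(2)[OF measurable_F[OF Y_meas] Y_bound])
    then have "(\<Sum>k<2 ^ m. expectation (\<lambda>x. (Y m k x)\<^sup>2) * (2 * (q * (t / 2 ^ m))\<^sup>2)) \<le>
        (\<Sum>k<(2::nat) ^ m. K\<^sup>2 * (2 * (q * (t / 2 ^ m))\<^sup>2))"
      by (intro sum_mono mult_right_mono) simp_all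
    moreover have "expectation (\<lambda>x. (Z m x)\<^sup>2) =
        (\<Sum>k<2 ^ m. expectation (\<lambda>x. (Y m k x)\<^sup>2) * (2 * (q * (t / 2 ^ m))\<^sup>2))"
      using Z[of m] unfolding mom(3) by blast
    ultimately have "expectation (\<lambda>x. (Z m x)\<^sup>2) \<le> (\<Sum>k<(2::nat) ^ m. K\<^sup>2 * (2 * (q * (t / 2 ^ m))\<^sup>2))"
      by simp
    also have "\<dots> = c * (1 / 2) ^ m"
      by (simp add: c_def power_mult_distrib power_divide power2_eq_square)
    finally show ?thesis .
  qed
  have Z_meas [measurable]: "Z m \<in> borel_measurable M" for m using Z[of m] by (auto intro: measurable_F)
  have "summable (\<lambda>m. expectation (\<lambda>x. (Z m x)\<^sup>2))"
  proof (rule summable_comparison_test'[where N = 0 and g = "\<lambda>m. c * (1 / 2) ^ m"])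
    show "summable (\<lambda>m. c * (1 / 2) ^ m)" by (intro summable_mult summable_geometric) simp
    show "norm (expectation (\<lambda>x. (Z m x)\<^sup>2)) \<le> c * (1 / 2) ^ m" for m using EZ[of m] by simp
  qed
  have "(\<integral>\<^sup>+x. (\<Sum>m. ennreal ((Z m x)\<^sup>2)) \<partial>M) = (\<Sum>m. \<integral>\<^sup>+x. ennreal ((Z m x)\<^sup>2) \<partial>M)"
    by (rule nn_integral_suminf) measurable
  also have "\<dots> = (\<Sum>m. ennreal (expectation (\<lambda>x. (Z m x)\<^sup>2)))"
    using Z by (intro suminf_cong nn_integral_eq_integral) auto
  also have "\<dots> \<noteq> \<infinity>"
    using \<open>summable (\<lambda>m. expectation (\<lambda>x. (Z m x)\<^sup>2))\<close> by (subst suminf_ennreal2) auto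
  finally have "AE x in M. (\<Sum>m. ennreal ((Z m x)\<^sup>2)) \<noteq> \<infinity>"
    by (intro nn_integral_PInf_AE) auto
  then have "AE x in M. (\<lambda>m. Z m x) \<longlonglongrightarrow> 0"
  proof eventually_elim
    case (elim x)
    then have "summable (\<lambda>m. (Z m x)\<^sup>2)" by (intro summable_suminf_not_top) auto
    then have "(\<lambda>m. (Z m x)\<^sup>2) \<longlonglongrightarrow> 0" by (rule summable_LIMSEQ_zero)
    from tendsto_real_sqrt[OF this] have "(\<lambda>m. \<bar>Z m x\<bar>) \<longlonglongrightarrow> 0" by simp
    then show ?case by (simp add: tendsto_rabs_zero_iff)
  qed
  then show ?thesis by (simp add: Z_def Y_def q_def)
qed

text \<open>Letting the clipping level run through the natural numbers gives one null set for all
  levels; outside it, a level above the maximum of the given path leaves the weights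
  unchanged.\<close>

lemma quadratic_variation:
  fixes a :: "real^'d" and g :: "real \<Rightarrow> 'a \<Rightarrow> real"
  assumes g: "\<And>s. 0 \<le> s \<Longrightarrow> g s \<in> borel_measurable (\<F> s)"
    and cont: "\<And>x. x \<in> space M \<Longrightarrow> continuous_on {0..} (\<lambda>s. g s x)" and t: "0 \<le> t"
  shows "AE x in M. (\<lambda>m. \<Sum>k<2 ^ m. g (dyadic t m k) x *
    ((a \<bullet> dyadic_incr t m k x)\<^sup>2 - (a \<bullet> (\<Lambda> *v a)) * (t / 2 ^ m))) \<longlonglongrightarrow> 0"
proof -
  have "AE x in M. \<forall>K::nat. (\<lambda>m. \<Sum>k<2 ^ m. clip (real K) (g (dyadic t m k) x) *
    ((a \<bullet> dyadic_incr t m k x)\<^sup>2 - (a \<bullet> (\<Lambda> *v a)) * (t / 2 ^ m))) \<longlonglongrightarrow> 0"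
    unfolding AE_all_countable using g t by (intro allI quadratic_variation_clipped) auto
  then show ?thesis
    using AE_space
  proof eventually_elim
    case (elim x)
    have "continuous_on {0..t} (\<lambda>s. g s x)"
      by (rule continuous_on_subset[OF cont[OF elim(2)]]) auto
    then obtain c where c: "\<And>s. s \<in> {0..t} \<Longrightarrow> \<bar>g s x\<bar> \<le> c"
      using continuous_on_Icc_bounded by blast
    obtain K where "c \<le> real K" using real_arch_simple by blast
    then have "clip (real K) (g (dyadic t m k) x) = g (dyadic t m k) x" if "k < 2 ^ m" for m k
      using c[of "dyadic t m k"] dyadic_le[of t k m] that t by (intro clip_eq) auto
    then show ?case using elim(1)[rule_format, of K] by simp
  qed
qed

end

section \<open>Deterministic estimates: Riemann sums and Taylor remainder\<close>

lemma continuous_on_dyadic_close: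
  fixes g :: "real \<Rightarrow> 'b::metric_space"
  assumes g: "continuous_on {0..t} g" and t: "0 \<le> t" and e: "0 < e"
  shows "\<forall>\<^sub>F m in sequentially. \<forall>k<2 ^ m. \<forall>s\<in>{dyadic t m k..dyadic t m (Suc k)}. dist (g s) (g (dyadic t m k)) < e"
proof -
  have "uniformly_continuous_on {0..t} g" by (rule compact_uniformly_continuous[OF g compact_Icc])
  then obtain d where d: "d > 0" "\<And>x y. x \<in> {0..t} \<Longrightarrow> y \<in> {0..t} \<Longrightarrow> dist y x < d \<Longrightarrow> dist (g y) (g x) < e"
    using e unfolding uniformly_continuous_on_def by metis
  have "(\<lambda>m. t * (1 / 2) ^ m) \<longlonglongrightarrow> t * 0" by (intro tendsto_intros LIMSEQ_realpow_zero) auto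
  then have "\<forall>\<^sub>F m in sequentially. t * (1 / 2) ^ m < d" using d by (intro order_tendstoD(2)) auto
  then show ?thesis
  proof eventually_elim
    case (elim m)
    show ?case
    proof (intro allI impI ballI d(2))
      fix k s assume k: "k < (2::nat) ^ m" and s: "s \<in> {dyadic t m k..dyadic t m (Suc k)}"
      show "dyadic t m k \<in> {0..t}" "s \<in> {0..t}"
        using dyadic_le[of t k m] dyadic_le[of t "Suc k" m] k s t
        by (auto intro: order.trans[OF dyadic_nonneg[OF t]])
      show "dist s (dyadic t m k) < d"
        using s elim dyadic_diff[of t m k] by (simp add: dist_real_def power_divide)
    qed
  qed
qed

lemma dyadic_riemann_sum:
  fixes h :: "real \<Rightarrow> real"
  assumes h: "continuous_on {0..t} h" and t: "0 \<le> t"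
  shows "(\<lambda>m. \<Sum>k<2 ^ m. h (dyadic t m k) * (t / 2 ^ m)) \<longlonglongrightarrow> integral {0..t} h"
proof (rule LIMSEQ_I)
  fix e :: real assume e: "0 < e"
  \<comment> \<open>The errors of the cells add up to \<open>e' * t\<close>; dividing by
    \<open>t + 1\<close> keeps this below \<open>e\<close> and allows \<open>t = 0\<close>.\<close>
  define e' where "e' = e / (t + 1)"
  have e': "0 < e'" using e t by (simp add: e'_def)
  from continuous_on_dyadic_close[OF h t this]
  obtain N where N: "\<And>m k s. N \<le> m \<Longrightarrow> k < 2 ^ m \<Longrightarrow> s \<in> {dyadic t m k..dyadic t m (Suc k)} \<Longrightarrow>
      dist (h s) (h (dyadic t m k)) < e'"
    unfolding eventually_sequentially by blast
  show "\<exists>N. \<forall>m\<ge>N. norm ((\<Sum>k<2 ^ m. h (dyadic t m k) * (t / 2 ^ m)) - integral {0..t} h) < e"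
  proof (intro exI[of _ N] allI impI)
    fix m assume m: "N \<le> m"
    define G where "G x = integral {0..x} h" for x
    have int: "h integrable_on {c..d}" if "0 \<le> c" "d \<le> t" for c d
      using that by (intro integrable_continuous_real continuous_on_subset[OF h]) auto
    have "\<bar>h (dyadic t m k) * (t / 2 ^ m) - (G (dyadic t m (Suc k)) - G (dyadic t m k))\<bar> \<le> e' * (t / 2 ^ m)"
      if k: "k < 2 ^ m" for k
    proof -
      define c d where "c = dyadic t m k" and "d = dyadic t m (Suc k)"
      have cd: "0 \<le> c" "c \<le> d" "d \<le> t" "d - c = t / 2 ^ m"
        using dyadic_le[of t "Suc k" m] k t dyadic_mono[of t m k] dyadic_diff[of t m k]
        by (auto simp: c_def d_def)
      have "G c + integral {c..d} h = G d"
        unfolding G_def using cd int by (intro Henstock_Kurzweil_Integration.integral_combine) auto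
      moreover have "integral {c..d} (\<lambda>s. h s - h c) = integral {c..d} h - h c * (d - c)"
        using cd int by (subst Henstock_Kurzweil_Integration.integral_diff) (auto simp: mult.commute)
      moreover have "norm (integral {c..d} (\<lambda>s. h s - h c)) \<le> e' * (d - c)"
      proof (rule integral_bound[OF cd(2)])
        show "continuous_on {c..d} (\<lambda>s. h s - h c)"
          using cd by (intro continuous_intros continuous_on_subset[OF h]) auto
        show "norm (h s - h c) \<le> e'" if "s \<in> {c..d}" for s
          using N[OF m k, of s] that by (simp add: c_def d_def dist_norm)
      qed
      ultimately show ?thesis using cd(4) by (simp add: c_def d_def abs_minus_commute)
    qed
    then have "\<bar>\<Sum>k<2 ^ m. h (dyadic t m k) * (t / 2 ^ m) - (G (dyadic t m (Suc k)) - G (dyadic t m k))\<bar> \<le>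
        (\<Sum>k<(2::nat) ^ m. e' * (t / 2 ^ m))"
      by (intro order.trans[OF sum_abs] sum_mono) auto
    also have "\<dots> = e' * t" by simp
    also have "\<dots> < e" using e t by (simp add: e'_def field_simps)
    also have "(\<Sum>k<2 ^ m. h (dyadic t m k) * (t / 2 ^ m) - (G (dyadic t m (Suc k)) - G (dyadic t m k))) =
        (\<Sum>k<2 ^ m. h (dyadic t m k) * (t / 2 ^ m)) - integral {0..t} h"
      using sum_lessThan_telescope[of "\<lambda>k. G (dyadic t m k)" "2 ^ m"]
      by (subst sum_subtractf) (simp add: G_def)
    finally show "norm ((\<Sum>k<2 ^ m. h (dyadic t m k) * (t / 2 ^ m)) - integral {0..t} h) < e" by simp
  qed
qed

text \<open>The Lagrange form of Taylor's formula on the segment from \<open>x\<close> to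
  \<open>x + v\<close> evaluates the second derivative at an intermediate point. Moving it back to
  \<open>x\<close> costs only the oscillation of \<open>f''\<close> on the segment, so no third
  derivative is needed.\<close>

lemma taylor_remainder_2:
  fixes F :: "'v::real_normed_vector \<Rightarrow> real" and f' :: "'v \<Rightarrow> 'v \<Rightarrow>\<^sub>L real"
    and f'' :: "'v \<Rightarrow> 'v \<Rightarrow>\<^sub>L 'v \<Rightarrow>\<^sub>L real"
  assumes f': "\<And>x. (F has_derivative blinfun_apply (f' x)) (at x)"
    and f'': "\<And>x. (f' has_derivative blinfun_apply (f'' x)) (at x)"
    and e: "\<And>r. 0 \<le> r \<Longrightarrow> r \<le> 1 \<Longrightarrow> norm (f'' (x + r *\<^sub>R v) - f'' x) \<le> e"
  shows "\<bar>F (x + v) - F x - f' x v - 1/2 * f'' x v v\<bar> \<le> 1/2 * e * (norm v)\<^sup>2"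
proof -
  define D where "D m r = (if m = 0 then F (x + r *\<^sub>R v) else if m = 1 then f' (x + r *\<^sub>R v) v
    else f'' (x + r *\<^sub>R v) v v)" for m :: nat and r
  have line: "((\<lambda>r. x + r *\<^sub>R v) has_derivative (\<lambda>h. h *\<^sub>R v)) (at r)" for r :: real
    by (auto intro!: derivative_eq_intros)
  have 0: "((\<lambda>r. F (x + r *\<^sub>R v)) has_real_derivative f' (x + r *\<^sub>R v) v) (at r)" for r
  proof -
    have "((\<lambda>r. F (x + r *\<^sub>R v)) has_derivative (\<lambda>h. f' (x + r *\<^sub>R v) (h *\<^sub>R v))) (at r)"
      using has_derivative_compose[OF line f'] .
    then show ?thesis
      by (simp add: has_field_derivative_def blinfun.scaleR_right mult.commute[of _ "f' _ _"])
  qed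
  have 1: "((\<lambda>r. f' (x + r *\<^sub>R v) v) has_real_derivative f'' (x + r *\<^sub>R v) v v) (at r)" for r
  proof -
    have "((\<lambda>r. f' (x + r *\<^sub>R v)) has_derivative (\<lambda>h. f'' (x + r *\<^sub>R v) (h *\<^sub>R v))) (at r)"
      using has_derivative_compose[OF line f''] .
    then have "((\<lambda>r. f' (x + r *\<^sub>R v) v) has_derivative (\<lambda>h. f'' (x + r *\<^sub>R v) (h *\<^sub>R v) v)) (at r)"
      by (auto intro!: derivative_eq_intros)
    then show ?thesis
      by (simp add: has_field_derivative_def blinfun.scaleR_right blinfun.scaleR_left mult.commute[of _ "f'' _ _ _"])
  qed
  have "\<exists>\<theta>>0. \<theta> < 1 \<and> F (x + 1 *\<^sub>R v) = (\<Sum>m<2. D m 0 / fact m * 1 ^ m) + D 2 \<theta> / fact 2 * 1 ^ 2"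
    by (rule Maclaurin) (use 0 1 in \<open>auto simp: D_def less_Suc_eq numeral_2_eq_2\<close>)
  then obtain \<theta> where \<theta>: "0 < \<theta>" "\<theta> < 1" "F (x + v) = F x + f' x v + 1/2 * f'' (x + \<theta> *\<^sub>R v) v v"
    by (auto simp: D_def numeral_2_eq_2)
  have "\<bar>(f'' (x + \<theta> *\<^sub>R v) - f'' x) v v\<bar> \<le> norm ((f'' (x + \<theta> *\<^sub>R v) - f'' x) v) * norm v"
    using norm_blinfun[of "(f'' (x + \<theta> *\<^sub>R v) - f'' x) v" v] by simp
  also have "\<dots> \<le> (e * norm v) * norm v"
  proof (rule mult_right_mono)
    have "norm ((f'' (x + \<theta> *\<^sub>R v) - f'' x) v) \<le> norm (f'' (x + \<theta> *\<^sub>R v) - f'' x) * norm v"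
      by (rule norm_blinfun)
    also have "\<dots> \<le> e * norm v" using e[of \<theta>] \<theta> by (intro mult_right_mono) auto
    finally show "norm ((f'' (x + \<theta> *\<^sub>R v) - f'' x) v) \<le> e * norm v" .
  qed simp
  finally have "\<bar>(f'' (x + \<theta> *\<^sub>R v) - f'' x) v v\<bar> \<le> e * (norm v)\<^sup>2" by (simp add: power2_eq_square)
  moreover have "F (x + v) - F x - f' x v - 1/2 * f'' x v v = 1/2 * ((f'' (x + \<theta> *\<^sub>R v) - f'' x) v v)"
    using \<theta>(3) by (simp add: blinfun.diff_left algebra_simps)
  ultimately show ?thesis by (simp only: abs_mult)
qed

section \<open>The Ito formula\<close>

text \<open>This concerns one deterministic path; probability will enter only through
  \<open>covariation\<close> and \<open>variation_bound\<close>. The former replaces products of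
  increments by \<open>\<Lambda>\<close> times the time step, the latter controls the sum of the
  Taylor remainders. Convergence of the first-order sums is a conclusion, and their limit is what
  the stochastic integrals have to equal.\<close>

lemma pathwise_ito_formula:
  fixes F :: "real \<times> (real^'d) \<Rightarrow> real" and b :: "real \<Rightarrow> real^'d" and \<Lambda> :: "real^'d^'d"
    and f' :: "real \<times> (real^'d) \<Rightarrow> (real \<times> (real^'d)) \<Rightarrow>\<^sub>L real"
    and f'' :: "real \<times> (real^'d) \<Rightarrow> (real \<times> (real^'d)) \<Rightarrow>\<^sub>L (real \<times> (real^'d)) \<Rightarrow>\<^sub>L real"
  defines "e \<equiv> \<lambda>i. (0, axis i 1) :: real \<times> (real^'d)"
  assumes f': "\<And>x. (F has_derivative blinfun_apply (f' x)) (at x)"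
    and f'': "\<And>x. (f' has_derivative blinfun_apply (f'' x)) (at x)"
    and f''_cont: "continuous_on UNIV f''"
    and b: "continuous_on {0..t} b" and t: "0 \<le> t"
  defines "\<gamma> \<equiv> \<lambda>s. (s, b s)"
    and "w \<equiv> \<lambda>m k. b (dyadic t m (Suc k)) - b (dyadic t m k)"
  assumes covariation: "\<And>i j. (\<lambda>m. \<Sum>k<2 ^ m. f'' (\<gamma> (dyadic t m k)) (e i) (e j) *
      (w m k $ i * w m k $ j - \<Lambda> $ i $ j * (t / 2 ^ m))) \<longlonglongrightarrow> 0"
    and variation_bound: "\<And>m. (\<Sum>k<2 ^ m. (norm (w m k))\<^sup>2) \<le> C"
  shows "(\<lambda>m. \<Sum>i\<in>UNIV. \<Sum>k<2 ^ m. f' (\<gamma> (dyadic t m k)) (e i) * w m k $ i) \<longlonglongrightarrow>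
    F (\<gamma> t) - F (\<gamma> 0) - integral {0..t} (\<lambda>s. f' (\<gamma> s) (1, 0) +
      1/2 * (\<Sum>i\<in>UNIV. \<Sum>j\<in>UNIV. f'' (\<gamma> s) (e i) (e j) * \<Lambda> $ i $ j))"
proof -
  define x where "x m k = \<gamma> (dyadic t m k)" for m k
  define \<Delta> where "\<Delta> m = t / 2 ^ m" for m :: nat
  define v where "v m k = (\<Delta> m, w m k)" for m k
  \<comment> \<open>Only the purely spatial second-order term is split off; those involving the time
    increment are left in \<open>R\<close>, where they are negligible.\<close>
  define R where "R m k = F (x m (Suc k)) - F (x m k) - f' (x m k) (v m k) -
    1/2 * f'' (x m k) (0, w m k) (0, w m k)" for m k
  define h where "h s = f' (\<gamma> s) (1, 0) +
      1/2 * (\<Sum>i\<in>UNIV. \<Sum>j\<in>UNIV. f'' (\<gamma> s) (e i) (e j) * \<Lambda> $ i $ j)" for s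
  have \<Delta>_nonneg: "0 \<le> \<Delta> m" for m using t by (simp add: \<Delta>_def)
  have x_Suc: "x m (Suc k) = x m k + v m k" for m k
    using dyadic_diff[of t m k] by (simp add: x_def \<gamma>_def v_def w_def \<Delta>_def)
  have \<gamma>_cont: "continuous_on {0..t} \<gamma>" unfolding \<gamma>_def by (intro continuous_intros b)
  have f'_cont: "continuous_on UNIV f'"
    using f'' by (auto simp: continuous_on_eq_continuous_at intro: has_derivative_continuous)
  have h_cont: "continuous_on {0..t} h"
    unfolding h_def
    by (intro continuous_intros continuous_on_compose2[OF f'_cont \<gamma>_cont] continuous_on_compose2[OF f''_cont \<gamma>_cont]) auto
  have C0: "0 \<le> C" using variation_bound[of 0] by (rule order.trans[rotated]) (simp add: sum_nonneg)
  have R_lim: "(\<lambda>m. \<Sum>k<2 ^ m. R m k) \<longlonglongrightarrow> 0"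
  proof (rule LIMSEQ_I)
    fix r :: real assume r: "0 < r"
    \<comment> \<open>A ball is used in place of the image of the path because it is convex: it
      contains the segments between consecutive points, on which \<open>f''\<close> must be
      estimated.\<close>
    have "bounded (\<gamma> ` {0..t})"
      by (intro compact_imp_bounded compact_continuous_image \<gamma>_cont compact_Icc)
    then obtain \<rho> where \<rho>: "\<And>s. s \<in> {0..t} \<Longrightarrow> norm (\<gamma> s) \<le> \<rho>" unfolding bounded_iff by blast
    have x_in: "x m k \<in> cball 0 \<rho>" if "k \<le> 2 ^ m" for m k
      unfolding x_def using dyadic_le[OF t that] \<rho>[of "dyadic t m k"] t by simp
    have f''_cball: "continuous_on (cball 0 \<rho>) f''" by (rule continuous_on_subset[OF f''_cont]) simp
    have "bounded (f'' ` cball 0 \<rho>)"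
      by (intro compact_imp_bounded compact_continuous_image f''_cball compact_cball)
    then obtain L where L: "\<And>y. y \<in> cball 0 \<rho> \<Longrightarrow> norm (f'' y) \<le> L" unfolding bounded_iff by blast
    have L0: "0 \<le> L" using order.trans[OF norm_ge_zero L[OF x_in[of 0 0]]] by simp
    \<comment> \<open>The summed remainders are at most \<open>\<epsilon>\<close> times the first
      three summands; the last one makes \<open>K\<close> positive and the final estimate
      strict.\<close>
    define K where "K = t\<^sup>2 + C + L * t + 1"
    have K: "0 < K" unfolding K_def using C0 L0 t by (intro add_nonneg_pos add_nonneg_nonneg) auto
    define \<epsilon> where "\<epsilon> = r / K"
    have \<epsilon>: "0 < \<epsilon>" using r K by (simp add: \<epsilon>_def)
    have "uniformly_continuous_on (cball 0 \<rho>) f''" by (rule compact_uniformly_continuous[OF f''_cball compact_cball])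
    then obtain \<delta> where \<delta>: "\<delta> > 0"
      "\<And>y z. y \<in> cball 0 \<rho> \<Longrightarrow> z \<in> cball 0 \<rho> \<Longrightarrow> dist z y < \<delta> \<Longrightarrow> dist (f'' z) (f'' y) < \<epsilon>"
      using \<epsilon> unfolding uniformly_continuous_on_def by metis
    \<comment> \<open>Steps shorter than \<open>\<delta>\<close> serve the uniform continuity of
      \<open>f''\<close>; steps shorter than \<open>\<epsilon>\<close> make the terms with a time
      increment small.\<close>
    have "0 < min \<delta> \<epsilon>" using \<delta> \<epsilon> by simp
    from continuous_on_dyadic_close[OF \<gamma>_cont t this]
    obtain N where N: "\<And>m k s. N \<le> m \<Longrightarrow> k < 2 ^ m \<Longrightarrow> s \<in> {dyadic t m k..dyadic t m (Suc k)} \<Longrightarrow>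
        dist (\<gamma> s) (\<gamma> (dyadic t m k)) < min \<delta> \<epsilon>"
      unfolding eventually_sequentially by blast
    show "\<exists>N. \<forall>m\<ge>N. norm ((\<Sum>k<2 ^ m. R m k) - 0) < r"
    proof (intro exI[of _ N] allI impI)
      fix m assume m: "N \<le> m"
      have R_le: "\<bar>R m k\<bar> \<le> 1/2 * \<epsilon> * ((\<Delta> m)\<^sup>2 + (norm (w m k))\<^sup>2) + L * \<epsilon> * \<Delta> m" if k: "k < 2 ^ m" for k
      proof -
        have v_small: "norm (v m k) < min \<delta> \<epsilon>"
          using N[OF m k, of "dyadic t m (Suc k)"] dyadic_mono[OF t, of m k] x_Suc[of m k]
          by (simp add: x_def dist_norm)
        have taylor: "\<bar>F (x m k + v m k) - F (x m k) - f' (x m k) (v m k) - 1/2 * f'' (x m k) (v m k) (v m k)\<bar>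
            \<le> 1/2 * \<epsilon> * (norm (v m k))\<^sup>2"
        proof (rule taylor_remainder_2[OF f' f''])
          fix r :: real assume r: "0 \<le> r" "r \<le> 1"
          have "x m k + r *\<^sub>R v m k = (1 - r) *\<^sub>R x m k + r *\<^sub>R x m (Suc k)"
            by (simp add: x_Suc algebra_simps)
          also have "\<dots> \<in> cball 0 \<rho>"
            using x_in[of k m] x_in[of "Suc k" m] k r by (intro convexD[OF convex_cball]) auto
          finally have "dist (f'' (x m k + r *\<^sub>R v m k)) (f'' (x m k)) < \<epsilon>"
          proof (rule \<delta>(2)[rotated])
            have "r * norm (v m k) \<le> 1 * norm (v m k)" using r by (intro mult_right_mono) auto
            then show "dist (x m k + r *\<^sub>R v m k) (x m k) < \<delta>" using v_small r by (simp add: dist_norm)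
          qed (use x_in[of k m] k in simp)
          then show "norm (f'' (x m k + r *\<^sub>R v m k) - f'' (x m k)) \<le> \<epsilon>" by (simp add: dist_norm)
        qed
        have bil: "\<bar>f'' (x m k) y z\<bar> \<le> L * norm y * norm z" for y z
        proof -
          have "\<bar>f'' (x m k) y z\<bar> \<le> norm (f'' (x m k) y) * norm z"
            using norm_blinfun[of "f'' (x m k) y" z] by simp
          also have "\<dots> \<le> (norm (f'' (x m k)) * norm y) * norm z"
            by (intro mult_right_mono norm_blinfun) simp
          also have "\<dots> \<le> (L * norm y) * norm z"
            using L[OF x_in[of k m]] k by (intro mult_right_mono) auto
          finally show ?thesis .
        qed
        \<comment> \<open>Every term lost in passing from \<open>v m k\<close> to
          \<open>(0, w m k)\<close> contains a factor \<open>\<Delta> m\<close>, whose sum over the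
          cells is only \<open>t\<close>, while the other factor is below
          \<open>\<epsilon>\<close>.\<close>
        have v_split: "v m k = (\<Delta> m, 0) + (0, w m k)" by (simp add: v_def)
        have "f'' (x m k) (v m k) (v m k) - f'' (x m k) (0, w m k) (0, w m k) =
            f'' (x m k) (\<Delta> m, 0) (v m k) + f'' (x m k) (0, w m k) (\<Delta> m, 0)"
          unfolding v_split blinfun.add_left blinfun.add_right by simp
        also have "\<bar>\<dots>\<bar> \<le> L * \<Delta> m * norm (v m k) + L * norm (v m k) * \<Delta> m"
        proof (rule order.trans[OF abs_triangle_ineq add_mono])
          show "\<bar>f'' (x m k) (\<Delta> m, 0) (v m k)\<bar> \<le> L * \<Delta> m * norm (v m k)"
            using bil[of "(\<Delta> m, 0)" "v m k"] \<Delta>_nonneg[of m] by (simp add: norm_Pair)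
          have "norm (w m k) \<le> norm (v m k)" unfolding v_def by (rule norm_snd_le)
          then have "L * norm (w m k) * \<Delta> m \<le> L * norm (v m k) * \<Delta> m"
            using L0 \<Delta>_nonneg[of m] by (intro mult_right_mono mult_left_mono) auto
          then show "\<bar>f'' (x m k) (0, w m k) (\<Delta> m, 0)\<bar> \<le> L * norm (v m k) * \<Delta> m"
            using bil[of "(0, w m k)" "(\<Delta> m, 0)"] \<Delta>_nonneg[of m] by (simp add: norm_Pair)
        qed
        also have "\<dots> = 2 * (L * \<Delta> m * norm (v m k))" by simp
        also have "\<dots> \<le> 2 * (L * \<Delta> m * \<epsilon>)"
          using v_small L0 \<Delta>_nonneg[of m] by (intro mult_left_mono) auto
        also have "\<dots> = 2 * (L * \<epsilon> * \<Delta> m)" by (simp add: mult_ac)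
        finally have cross: "\<bar>f'' (x m k) (v m k) (v m k) - f'' (x m k) (0, w m k) (0, w m k)\<bar> \<le> 2 * (L * \<epsilon> * \<Delta> m)" .
        have nv: "(norm (v m k))\<^sup>2 = (\<Delta> m)\<^sup>2 + (norm (w m k))\<^sup>2" by (simp add: v_def norm_Pair)
        have "R m k = (F (x m k + v m k) - F (x m k) - f' (x m k) (v m k) - 1/2 * f'' (x m k) (v m k) (v m k)) +
            1/2 * (f'' (x m k) (v m k) (v m k) - f'' (x m k) (0, w m k) (0, w m k))"
          by (simp add: R_def x_Suc diff_divide_distrib)
        moreover have "\<bar>T + 1/2 * U\<bar> \<le> D + E" if "\<bar>T\<bar> \<le> D" "\<bar>U\<bar> \<le> 2 * E" for T U D E :: real
          using that by linarith
        ultimately show ?thesis using taylor cross unfolding nv by (simp only:)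
      qed
      have "\<bar>\<Sum>k<2 ^ m. R m k\<bar> \<le> (\<Sum>k<(2::nat) ^ m. 1/2 * \<epsilon> * ((\<Delta> m)\<^sup>2 + (norm (w m k))\<^sup>2) + L * \<epsilon> * \<Delta> m)"
        using R_le by (intro order.trans[OF sum_abs] sum_mono) auto
      also have "\<dots> = 1/2 * \<epsilon> * (2 ^ m * (\<Delta> m)\<^sup>2 + (\<Sum>k<2 ^ m. (norm (w m k))\<^sup>2)) + L * \<epsilon> * t"
        by (simp only: sum.distrib sum_distrib_left[symmetric]) (simp add: \<Delta>_def)
      also have "\<dots> \<le> 1/2 * \<epsilon> * (t\<^sup>2 + C) + L * \<epsilon> * t"
      proof (intro add_mono mult_left_mono variation_bound order.refl)
        have "2 ^ m * (\<Delta> m)\<^sup>2 = t\<^sup>2 / 2 ^ m" by (simp add: \<Delta>_def power2_eq_square)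
        also have "\<dots> \<le> t\<^sup>2 / 1" by (intro divide_left_mono) auto
        finally show "2 ^ m * (\<Delta> m)\<^sup>2 \<le> t\<^sup>2" by simp
      qed (use \<epsilon> L0 in auto)
      also have "\<dots> \<le> \<epsilon> * (t\<^sup>2 + C) + L * \<epsilon> * t" using \<epsilon> C0 by simp
      also have "\<dots> < \<epsilon> * K" using \<epsilon> by (simp add: K_def algebra_simps)
      also have "\<dots> = r" using K by (simp add: \<epsilon>_def)
      finally show "norm ((\<Sum>k<2 ^ m. R m k) - 0) < r" by simp
    qed
  qed
  define Q where "Q i j m = (\<Sum>k<2 ^ m. f'' (x m k) (e i) (e j) * (w m k $ i * w m k $ j - \<Lambda> $ i $ j * \<Delta> m))" for i j m
  have Q_lim: "Q i j \<longlonglongrightarrow> 0" for i j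
    using covariation[of i j] unfolding Q_def[abs_def] x_def \<Delta>_def .
  have h_lim: "(\<lambda>m. \<Sum>k<2 ^ m. h (dyadic t m k) * \<Delta> m) \<longlonglongrightarrow> integral {0..t} h"
    unfolding \<Delta>_def by (rule dyadic_riemann_sum[OF h_cont t])
  have axes: "(0, y) = (\<Sum>i\<in>UNIV. y $ i *\<^sub>R e i)" for y :: "real^'d"
  proof -
    have "(\<Sum>i\<in>UNIV. y $ i *\<^sub>R axis i 1) = y"
      using basis_expansion[of y] by (simp add: scalar_mult_eq_scaleR)
    then show ?thesis by (simp add: e_def prod_eq_iff fst_sum snd_sum)
  qed
  \<comment> \<open>The expansion over one cell is solved for its first-order part. On summation
    \<open>F\<close> telescopes, and every other term on the right has a known limit.\<close>
  have step: "(\<Sum>i\<in>UNIV. f' (x m k) (e i) * w m k $ i) = F (x m (Suc k)) - F (x m k) - h (dyadic t m k) * \<Delta> m -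
      1/2 * (\<Sum>i\<in>UNIV. \<Sum>j\<in>UNIV. f'' (x m k) (e i) (e j) * (w m k $ i * w m k $ j - \<Lambda> $ i $ j * \<Delta> m)) - R m k" for m k
  proof -
    have "v m k = \<Delta> m *\<^sub>R (1, 0) + (0, w m k)" by (simp add: v_def)
    then have 1: "f' (x m k) (v m k) = \<Delta> m * f' (x m k) (1, 0) + (\<Sum>i\<in>UNIV. f' (x m k) (e i) * w m k $ i)"
      unfolding axes
      by (simp only: blinfun.add_right blinfun.scaleR_right blinfun.sum_right real_scaleR_def)
         (simp add: mult.commute)
    have 2: "f'' (x m k) (0, w m k) (0, w m k) = (\<Sum>i\<in>UNIV. \<Sum>j\<in>UNIV. f'' (x m k) (e i) (e j) * (w m k $ i * w m k $ j))"
      unfolding axes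
      by (simp only: blinfun.scaleR_right blinfun.scaleR_left blinfun.sum_right blinfun.sum_left real_scaleR_def)
         (subst sum.swap, simp add: sum_distrib_left mult_ac)
    have 3: "h (dyadic t m k) * \<Delta> m = \<Delta> m * f' (x m k) (1, 0) +
        1/2 * (\<Sum>i\<in>UNIV. \<Sum>j\<in>UNIV. f'' (x m k) (e i) (e j) * (\<Lambda> $ i $ j * \<Delta> m))"
    proof -
      have "(\<Sum>i\<in>UNIV. \<Sum>j\<in>UNIV. f'' (x m k) (e i) (e j) * (\<Lambda> $ i $ j * \<Delta> m)) =
          (\<Sum>i\<in>UNIV. \<Sum>j\<in>UNIV. f'' (x m k) (e i) (e j) * \<Lambda> $ i $ j) * \<Delta> m"
        by (simp only: sum_distrib_right mult.assoc)
      then show ?thesis by (simp only: h_def x_def) (simp add: algebra_simps)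
    qed
    show ?thesis unfolding R_def 1 2 3 right_diff_distrib sum_subtractf by simp
  qed
  have "(\<Sum>i\<in>UNIV. \<Sum>k<2 ^ m. f' (x m k) (e i) * w m k $ i) =
      (F (\<gamma> t) - F (\<gamma> 0)) - (\<Sum>k<2 ^ m. h (dyadic t m k) * \<Delta> m) - 1/2 * (\<Sum>i\<in>UNIV. \<Sum>j\<in>UNIV. Q i j m) -
      (\<Sum>k<2 ^ m. R m k)" for m
  proof -
    have "(\<Sum>k<2 ^ m. F (x m (Suc k)) - F (x m k)) = F (\<gamma> t) - F (\<gamma> 0)"
      using sum_lessThan_telescope[of "\<lambda>k. F (x m k)" "2 ^ m"] by (simp add: x_def)
    moreover have "(\<Sum>k<2 ^ m. \<Sum>i\<in>UNIV. \<Sum>j\<in>UNIV. f'' (x m k) (e i) (e j) * (w m k $ i * w m k $ j - \<Lambda> $ i $ j * \<Delta> m)) =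
        (\<Sum>i\<in>UNIV. \<Sum>j\<in>UNIV. Q i j m)"
      unfolding Q_def by (subst sum.swap) (intro sum.cong refl sum.swap)
    moreover have "(\<Sum>i\<in>UNIV. \<Sum>k<2 ^ m. f' (x m k) (e i) * w m k $ i) =
        (\<Sum>k<2 ^ m. \<Sum>i\<in>UNIV. f' (x m k) (e i) * w m k $ i)"
      by (rule sum.swap)
    ultimately show ?thesis
      unfolding step by (simp only: sum_subtractf sum_distrib_left[symmetric])
  qed
  moreover have "(\<lambda>m. (F (\<gamma> t) - F (\<gamma> 0)) - (\<Sum>k<2 ^ m. h (dyadic t m k) * \<Delta> m) -
      1/2 * (\<Sum>i\<in>UNIV. \<Sum>j\<in>UNIV. Q i j m) - (\<Sum>k<2 ^ m. R m k)) \<longlonglongrightarrow>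
      (F (\<gamma> t) - F (\<gamma> 0)) - integral {0..t} h - 1/2 * (\<Sum>i\<in>(UNIV::'d set). \<Sum>j\<in>(UNIV::'d set). 0) - 0"
    by (intro tendsto_intros h_lim Q_lim R_lim)
  ultimately show ?thesis by (simp add: x_def h_def[abs_def])
qed

lemma partial_deriv_eq:
  assumes "(f has_derivative D) (at x)"
  shows "partial_deriv e f x = D e"
proof -
  have "((\<lambda>h. x + h *\<^sub>R e) has_derivative (\<lambda>h. h *\<^sub>R e)) (at 0)"
    by (auto intro!: derivative_eq_intros)
  moreover have "(f has_derivative D) (at (x + 0 *\<^sub>R e))" using assms by simp
  ultimately have "((\<lambda>h. f (x + h *\<^sub>R e)) has_derivative (\<lambda>h. D (h *\<^sub>R e))) (at 0)"
    by (rule has_derivative_compose)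
  then have "((\<lambda>h. f (x + h *\<^sub>R e)) has_real_derivative D e) (at 0)"
    using assms by (simp add: has_field_derivative_def linear_cmul[OF has_derivative_linear] mult_commute_abs)
  then show ?thesis unfolding partial_deriv_def by (rule DERIV_imp_deriv)
qed

context filtered_brownian_motion
begin

text \<open>Polarisation: the sums for the directions \<open>a i + a j\<close>, \<open>a i\<close>
  and \<open>a j\<close> give the product of coordinates, and symmetry of \<open>\<Lambda>\<close>
  merges its two mixed entries.\<close>

lemma quadratic_covariation:
  fixes g :: "real \<Rightarrow> 'a \<Rightarrow> real"
  assumes g: "\<And>s. 0 \<le> s \<Longrightarrow> g s \<in> borel_measurable (\<F> s)"
    and cont: "\<And>x. x \<in> space M \<Longrightarrow> continuous_on {0..} (\<lambda>s. g s x)" and t: "0 \<le> t"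
  shows "AE x in M. (\<lambda>m. \<Sum>k<2 ^ m. g (dyadic t m k) x *
    (dyadic_incr t m k x $ i * dyadic_incr t m k x $ j -
     \<Lambda> $ i $ j * (t / 2 ^ m))) \<longlonglongrightarrow> 0"
proof -
  define a where "a l = (axis l 1 :: real^'d)" for l
  have dot: "a l \<bullet> (\<Lambda> *v a l') = \<Lambda> $ l $ l'" for l l'
    by (simp add: a_def inner_axis' matrix_vector_mult_basis column_def)
  have sym: "\<Lambda> $ j $ i = \<Lambda> $ i $ j"
  proof -
    have "transpose \<Lambda> $ i $ j = \<Lambda> $ i $ j" using psd by (simp add: positive_semidefinite_def)
    then show ?thesis by (simp add: transpose_def)
  qed
  have qv: "AE x in M. (\<lambda>m. \<Sum>k<2 ^ m. g (dyadic t m k) x *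
    ((c \<bullet> dyadic_incr t m k x)\<^sup>2 - (c \<bullet> (\<Lambda> *v c)) * (t / 2 ^ m))) \<longlonglongrightarrow> 0" for c
    by (rule quadratic_variation[OF _ _ t]) (auto intro: g cont)
  show ?thesis
    using qv[of "a i + a j"] qv[of "a i"] qv[of "a j"]
  proof eventually_elim
    case (elim x)
    define w where "w m k = B (dyadic t m (Suc k)) x - B (dyadic t m k) x" for m k
    define S where "S c m = (\<Sum>k<2 ^ m. g (dyadic t m k) x * ((c \<bullet> w m k)\<^sup>2 - (c \<bullet> (\<Lambda> *v c)) * (t / 2 ^ m)))" for c m
    have "(\<lambda>m. 1/2 * (S (a i + a j) m - S (a i) m - S (a j) m)) \<longlonglongrightarrow> 1/2 * (0 - 0 - 0)"
      using elim unfolding S_def w_def by (intro tendsto_intros) auto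
    moreover have "1/2 * (S (a i + a j) m - S (a i) m - S (a j) m) =
        (\<Sum>k<2 ^ m. g (dyadic t m k) x * (w m k $ i * w m k $ j - \<Lambda> $ i $ j * (t / 2 ^ m)))" for m
    proof -
      have "1/2 * (g (dyadic t m k) x * (((a i + a j) \<bullet> w m k)\<^sup>2 - ((a i + a j) \<bullet> (\<Lambda> *v (a i + a j))) * (t / 2 ^ m)) -
          g (dyadic t m k) x * ((a i \<bullet> w m k)\<^sup>2 - (a i \<bullet> (\<Lambda> *v a i)) * (t / 2 ^ m)) -
          g (dyadic t m k) x * ((a j \<bullet> w m k)\<^sup>2 - (a j \<bullet> (\<Lambda> *v a j)) * (t / 2 ^ m))) =
          g (dyadic t m k) x * (w m k $ i * w m k $ j - \<Lambda> $ i $ j * (t / 2 ^ m))" for k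
      proof -
        have "a l \<bullet> w m k = w m k $ l" for l by (simp add: a_def inner_axis')
        then show ?thesis
          by (simp add: inner_add_left inner_add_right matrix_vector_right_distrib dot sym
              power2_eq_square algebra_simps)
      qed
      then show ?thesis
        unfolding S_def sum_subtractf[symmetric] sum_distrib_left by (intro sum.cong refl)
    qed
    ultimately show ?case by (simp add: w_def)
  qed
qed

lemma ito_formula:
  fixes F :: "real \<times> (real^'d) \<Rightarrow> real"
  assumes F: "twice_continuously_differentiable F" and t: "0 \<le> t"
  shows "AE x in M.
    F (t, B t x) =
      F (0, B 0 x)
      + (\<Sum>i\<in>UNIV. ito_integral M \<F> (\<lambda>s x. B s x $ i) (\<lambda>s x. space_deriv i F (s, B s x)) t x)
      + (LBINT s:{0..t}. time_deriv F (s, B s x)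
            + 1/2 * (\<Sum>i\<in>UNIV. \<Sum>j\<in>UNIV. space_deriv i (space_deriv j F) (s, B s x) * \<Lambda> $ i $ j))"
proof -
  obtain f' f'' where f': "\<And>x. (F has_derivative blinfun_apply (f' x)) (at x)"
    and f'': "\<And>x. (f' has_derivative blinfun_apply (f'' x)) (at x)"
    and f''_cont: "continuous_on UNIV f''"
    using F unfolding twice_continuously_differentiable_def by blast
  define e where "e i = (0 :: real, axis i 1 :: real^'d)" for i
  have sd: "space_deriv i F = (\<lambda>p. f' p (e i))" for i
    unfolding e_def by (intro ext partial_deriv_eq f')
  have td: "time_deriv F = (\<lambda>p. f' p (1, 0))"
    by (intro ext partial_deriv_eq f')
  \<comment> \<open>The outer derivative, in direction \<open>e i\<close>, differentiates
    \<open>f'\<close> itself, so \<open>e i\<close> becomes the first argument of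
    \<open>f''\<close>; the inner direction \<open>e j\<close> is the second.\<close>
  have sd2: "space_deriv i (space_deriv j F) = (\<lambda>p. f'' p (e i) (e j))" for i j
  proof
    fix p
    have "((\<lambda>p. f' p (e j)) has_derivative (\<lambda>h. f'' p h (e j))) (at p)"
      by (auto intro!: derivative_eq_intros f'')
    then show "space_deriv i (space_deriv j F) p = f'' p (e i) (e j)"
      unfolding sd e_def by (rule partial_deriv_eq)
  qed
  have f'_cont: "continuous_on UNIV f'"
    using f'' by (auto simp: continuous_on_eq_continuous_at intro: has_derivative_continuous)
  have adapted_comp: "(\<lambda>x. G (s, B s x)) \<in> borel_measurable (\<F> s)"
    if "continuous_on UNIV G" "0 \<le> s" for G :: "real \<times> (real^'d) \<Rightarrow> real" and s
  proof -
    have "continuous_on UNIV (\<lambda>x. G (s, x))"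
      by (intro continuous_on_compose2[OF that(1)] continuous_intros) auto
    then have "(\<lambda>x. G (s, x)) \<in> borel_measurable borel" by (rule borel_measurable_continuous_onI)
    from measurable_compose[OF adapted[OF that(2)] this] show ?thesis .
  qed
  have path_comp: "continuous_on {0..} (\<lambda>s. G (s, B s x))"
    if "continuous_on UNIV G" "x \<in> space M" for G :: "real \<times> (real^'d) \<Rightarrow> real" and x
    by (intro continuous_on_compose2[OF that(1)] continuous_intros continuous_paths that) auto
  have G1: "continuous_on UNIV (\<lambda>p. f' p y)" for y
    by (intro continuous_intros f'_cont)
  have G2: "continuous_on UNIV (\<lambda>p. f'' p y z)" for y z
    by (intro continuous_intros f''_cont)
  define w where "w x m k = B (dyadic t m (Suc k)) x - B (dyadic t m k) x" for x m k
  let ?H = "\<lambda>i s x. f' (s, B s x) (e i)"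
  have "\<exists>r. strict_mono r \<and> (\<forall>i. AE x in M.
    (\<lambda>m. dyadic_sum (?H i) (axis i 1) t (r m) x) \<longlonglongrightarrow>
      ito_integral M \<F> (\<lambda>s x. axis i 1 \<bullet> B s x) (?H i) t x)"
    by (rule ito_integral_subsequence) (auto intro!: adapted_comp path_comp G1 t)
  then obtain r where r: "strict_mono r" and
    "\<And>i. AE x in M. (\<lambda>m. dyadic_sum (?H i) (axis i 1) t (r m) x) \<longlonglongrightarrow>
      ito_integral M \<F> (\<lambda>s x. B s x $ i) (?H i) t x"
    by (auto simp: inner_axis')
  then have ito: "AE x in M. \<forall>i. (\<lambda>m. dyadic_sum (?H i) (axis i 1) t (r m) x) \<longlonglongrightarrow>
      ito_integral M \<F> (\<lambda>s x. B s x $ i) (?H i) t x"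
    by (simp add: AE_all_countable)
  have "AE x in M. (\<lambda>m. \<Sum>k<2 ^ m. f'' (dyadic t m k, B (dyadic t m k) x) (e i) (e j) *
      (w x m k $ i * w x m k $ j - \<Lambda> $ i $ j * (t / 2 ^ m))) \<longlonglongrightarrow> 0" for i j
    unfolding w_def by (rule quadratic_covariation) (auto intro!: adapted_comp path_comp G2 t)
  then have covariation: "AE x in M. \<forall>i j. (\<lambda>m. \<Sum>k<2 ^ m. f'' (dyadic t m k, B (dyadic t m k) x) (e i) (e j) *
      (w x m k $ i * w x m k $ j - \<Lambda> $ i $ j * (t / 2 ^ m))) \<longlonglongrightarrow> 0"
    by (simp add: AE_all_countable)
  \<comment> \<open>With the constant weight 1 the sums of squared increments converge on almost
    every path, hence are bounded in \<open>m\<close> there.\<close>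
  have "AE x in M. (\<lambda>m. \<Sum>k<2 ^ m. 1 * (w x m k $ i * w x m k $ i - \<Lambda> $ i $ i * (t / 2 ^ m))) \<longlonglongrightarrow> 0" for i
    unfolding w_def by (rule quadratic_covariation) (auto intro!: t)
  then have variation: "AE x in M. \<forall>i. (\<lambda>m. \<Sum>k<2 ^ m. 1 * (w x m k $ i * w x m k $ i - \<Lambda> $ i $ i * (t / 2 ^ m))) \<longlonglongrightarrow> 0"
    by (simp add: AE_all_countable)
  show ?thesis
    using ito covariation variation AE_space
  proof eventually_elim
    case (elim x)
    define b where "b s = B s x" for s
    have b: "continuous_on {0..t} b"
      unfolding b_def by (rule continuous_on_subset[OF continuous_paths[OF elim(4)]]) auto
    have "\<exists>C. \<forall>m. (\<Sum>k<2 ^ m. (norm (w x m k))\<^sup>2) \<le> C"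
    proof -
      have "(\<lambda>m. \<Sum>i\<in>UNIV. \<Sum>k<2 ^ m. 1 * (w x m k $ i * w x m k $ i - \<Lambda> $ i $ i * (t / 2 ^ m))) \<longlonglongrightarrow>
          (\<Sum>i\<in>(UNIV::'d set). 0)"
        using elim(3) by (intro tendsto_sum) auto
      then have "Bseq (\<lambda>m. \<Sum>i\<in>UNIV. \<Sum>k<2 ^ m. 1 * (w x m k $ i * w x m k $ i - \<Lambda> $ i $ i * (t / 2 ^ m)))"
        by (intro convergent_imp_Bseq convergentI)
      then obtain K where K: "\<And>m. \<bar>\<Sum>i\<in>UNIV. \<Sum>k<2 ^ m. 1 * (w x m k $ i * w x m k $ i - \<Lambda> $ i $ i * (t / 2 ^ m))\<bar> \<le> K"
        unfolding Bseq_def real_norm_def by blast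
      have "(\<Sum>k<2 ^ m. (norm (w x m k))\<^sup>2) \<le> K + (\<Sum>i\<in>UNIV. \<Lambda> $ i $ i * t)" for m
      proof -
        have "(\<Sum>k<2 ^ m. (norm (w x m k))\<^sup>2) = (\<Sum>i\<in>UNIV. \<Sum>k<2 ^ m. w x m k $ i * w x m k $ i)"
          by (simp add: power2_norm_eq_inner inner_vec_def sum.swap[of _ UNIV])
        also have "\<dots> = (\<Sum>i\<in>UNIV. \<Sum>k<2 ^ m. 1 * (w x m k $ i * w x m k $ i - \<Lambda> $ i $ i * (t / 2 ^ m))) +
            (\<Sum>i\<in>UNIV. \<Lambda> $ i $ i * t)"
          by (simp add: sum_subtractf)
        finally show ?thesis using K[of m] by linarith
      qed
      then show ?thesis by blast
    qed
    then obtain C where C: "\<And>m. (\<Sum>k<2 ^ m. (norm (w x m k))\<^sup>2) \<le> C" by blast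
    define RHS where "RHS = F (t, b t) - F (0, b 0) - integral {0..t} (\<lambda>s. f' (s, b s) (1, 0) +
      1/2 * (\<Sum>i\<in>UNIV. \<Sum>j\<in>UNIV. f'' (s, b s) (e i) (e j) * \<Lambda> $ i $ j))"
    have lim: "(\<lambda>m. \<Sum>i\<in>UNIV. \<Sum>k<2 ^ m. f' (dyadic t m k, b (dyadic t m k)) (e i) * w x m k $ i) \<longlonglongrightarrow> RHS"
      using pathwise_ito_formula[OF f' f'' f''_cont b t, of \<Lambda> C] elim(2) C
      unfolding e_def[symmetric] w_def b_def[symmetric] RHS_def by blast
    have "\<exists>c. \<forall>s\<in>{0..t}. \<bar>f' (s, b s) (e i)\<bar> \<le> c" for i
    proof -
      have "continuous_on {0..t} (\<lambda>s. f' (s, b s) (e i))"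
        by (intro continuous_on_compose2[OF G1] continuous_intros b) auto
      from continuous_on_Icc_bounded[OF this] obtain c where "\<And>s. s \<in> {0..t} \<Longrightarrow> \<bar>f' (s, b s) (e i)\<bar> \<le> c"
        by blast
      then show ?thesis by blast
    qed
    then obtain c where c: "\<And>i s. s \<in> {0..t} \<Longrightarrow> \<bar>f' (s, b s) (e i)\<bar> \<le> c i" by metis
    \<comment> \<open>From \<open>N\<close> on, a level depending on the path, no coefficient of any
      coordinate is clipped, so the sums of the pathwise formula and those that approximate the
      integrals coincide.\<close>
    obtain N where N: "(\<Sum>i\<in>UNIV. \<bar>c i\<bar>) \<le> real N" using real_arch_simple by blast
    have "\<forall>\<^sub>F m in sequentially. (\<Sum>i\<in>UNIV. \<Sum>k<2 ^ m. f' (dyadic t m k, b (dyadic t m k)) (e i) * w x m k $ i) =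
        (\<Sum>i\<in>UNIV. dyadic_sum (?H i) (axis i 1) t m x)"
      unfolding eventually_sequentially
    proof (intro exI[of _ N] allI impI sum.cong refl)
      fix m i assume m: "N \<le> m"
      have "clip (real m) (f' (dyadic t m k, B (dyadic t m k) x) (e i)) = f' (dyadic t m k, b (dyadic t m k)) (e i)"
        if "k < 2 ^ m" for k
        unfolding b_def[symmetric]
      proof (rule clip_eq)
        have "\<bar>f' (dyadic t m k, b (dyadic t m k)) (e i)\<bar> \<le> c i"
          using dyadic_le[of t k m] t that by (intro c) auto
        also have "c i \<le> (\<Sum>i\<in>UNIV. \<bar>c i\<bar>)"
        proof (rule order.trans[OF abs_ge_self])
          show "\<bar>c i\<bar> \<le> (\<Sum>i\<in>UNIV. \<bar>c i\<bar>)" by (rule member_le_sum) auto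
        qed
        also have "\<dots> \<le> real m" using N m by simp
        finally show "\<bar>f' (dyadic t m k, b (dyadic t m k)) (e i)\<bar> \<le> real m" .
      qed
      then show "(\<Sum>k<2 ^ m. f' (dyadic t m k, b (dyadic t m k)) (e i) * w x m k $ i) =
          dyadic_sum (?H i) (axis i 1) t m x"
        unfolding dyadic_sum_def by (intro sum.cong) (auto simp: w_def inner_axis')
    qed
    with lim have "(\<lambda>m. \<Sum>i\<in>UNIV. dyadic_sum (?H i) (axis i 1) t m x) \<longlonglongrightarrow> RHS"
      by (rule Lim_transform_eventually)
    \<comment> \<open>The total of the first-order sums converges along the full sequence, the
      single coordinates along \<open>r\<close>; comparing both along \<open>r\<close> identifies
      the sum of the integrals.\<close>
    from LIMSEQ_subseq_LIMSEQ[OF this r]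
    have "(\<lambda>m. \<Sum>i\<in>UNIV. dyadic_sum (?H i) (axis i 1) t (r m) x) \<longlonglongrightarrow> RHS"
      by (simp add: comp_def)
    moreover have "(\<lambda>m. \<Sum>i\<in>UNIV. dyadic_sum (?H i) (axis i 1) t (r m) x) \<longlonglongrightarrow>
        (\<Sum>i\<in>UNIV. ito_integral M \<F> (\<lambda>s x. B s x $ i) (?H i) t x)"
      using elim(1) by (intro tendsto_sum) auto
    ultimately have eq: "RHS = (\<Sum>i\<in>UNIV. ito_integral M \<F> (\<lambda>s x. B s x $ i) (?H i) t x)"
      by (rule LIMSEQ_unique)
    have "continuous_on {0..t} (\<lambda>s. f' (s, b s) (1, 0) +
        1/2 * (\<Sum>i\<in>UNIV. \<Sum>j\<in>UNIV. f'' (s, b s) (e i) (e j) * \<Lambda> $ i $ j))"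
      by (intro continuous_intros continuous_on_compose2[OF f'_cont] continuous_on_compose2[OF f''_cont] b) auto
    then have "(LBINT s:{0..t}. f' (s, b s) (1, 0) +
        1/2 * (\<Sum>i\<in>UNIV. \<Sum>j\<in>UNIV. f'' (s, b s) (e i) (e j) * \<Lambda> $ i $ j)) =
      integral {0..t} (\<lambda>s. f' (s, b s) (1, 0) +
        1/2 * (\<Sum>i\<in>UNIV. \<Sum>j\<in>UNIV. f'' (s, b s) (e i) (e j) * \<Lambda> $ i $ j))"
      by (intro set_borel_integral_eq_integral borel_integrable_atLeastAtMost')
    then show ?case
      using eq unfolding sd2 unfolding sd td RHS_def b_def by simp
  qed
qed

end

theorem lemma4p1:
  fixes M :: "'a measure"
    and \<Lambda> :: "real^'d^'d"
    and B :: "real \<Rightarrow> 'a \<Rightarrow> real^'d"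
    and F :: "real \<times> (real^'d) \<Rightarrow> real"
    and t :: real
  assumes "prob_space M"
    and "positive_semidefinite \<Lambda>"
    and "brownian_motion M \<Lambda> B"
    and "twice_continuously_differentiable F"
    and "0 \<le> t"
  shows "AE \<omega> in M.
    F (t, B t \<omega>) =
      F (0, B 0 \<omega>)
      + (\<Sum>i\<in>UNIV. ito_integral (completion M) (brownian_filtration M B)
            (\<lambda>s \<omega>. B s \<omega> $ i) (\<lambda>s \<omega>. space_deriv i F (s, B s \<omega>)) t \<omega>)
      + (LBINT s:{0..t}. time_deriv F (s, B s \<omega>)
            + 1/2 * (\<Sum>i\<in>UNIV. \<Sum>j\<in>UNIV. space_deriv i (space_deriv j F) (s, B s \<omega>) * \<Lambda> $ i $ j))"
proof -
  interpret M: prob_space M by fact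
  interpret P: prob_space "completion M"
    using M.emeasure_space_1 by (intro prob_spaceI) simp
  \<comment> \<open>The natural filtration depends on the measure only through its underlying space,
    which the completion does not change.\<close>
  have "brownian_filtration M B = usual_augmentation (completion M) (natural_filtration (completion M) B)"
    by (simp add: brownian_filtration_def natural_filtration_def[abs_def])
  then interpret filtered_brownian_motion "completion M" "brownian_filtration M B" \<Lambda> B
    using P.brownian_motion_filtered[OF assms(2) brownian_motion_completion[OF assms(3)]] by simp
  \<comment> \<open>A null set of the completion is contained in a null set of \<open>M\<close>, so
    the almost sure statement descends to \<open>M\<close>.\<close>
  show ?thesis
    using ito_formula[OF assms(4,5)] by (simp only: AE_completion_iff)
qed

end
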